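(* Let $E$ be contained in a nondegenerate regular curve $V\subset\mathbb F_q^2$ and let $k\ge 4$ be an integer. There is a sufficiently large constant $C>0$ (independent of $q$) such that if $|E|\ge Cq^{\frac12+\frac{1}{2k-4}}$, then $\mathbb F_q^*\subset\Delta_k(E)$.
   Context: $\mathbb F_q$ is a finite field with $q$ elements, $q$ odd, $\mathbb F_q^*=\mathbb F_q\setminus\{0\}$. For $\alpha\in\mathbb F_q^2$, $\|\alpha\|=\alpha_1^2+\alpha_2^2$; $\Delta_k(E)=\{\|x^1-x^2-\cdots-x^k\|: x^j\in E\}$. Fix a nontrivial additive character $\chi$ of $\mathbb F_q$; $\widehat f(m)=q^{-d}\sum_{x\in\mathbb F_q^d}\chi(-m\cdot x)f(x)$, identifying sets with characteristic functions. A variety $V=\{x\in\mathbb F_q^d:Q(x)=0\}$, $Q\in\mathbb F_q[x_1,\dots,x_d]$, is regular if $|V|\approx q^{d-1}$ and $|\widehat V(m)|\lesssim q^{-(d+1)/2}$ for all $m\neq 0$, with constants independent of $q$. A regular variety $V\subset\mathbb F_q^2$ is a nondegenerate regular curve if its defining polynomial $Q(x)$ does not contain any linear factor. *)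

theory Defs
  imports Complex_Main "HOL-Library.Indicator_Function" "HOL-Algebra.UnivPoly" "HOL-Algebra.Divisibility"
begin

text \<open>
  Fields are records with an explicit carrier, not instances of the type class: a statement can
  then bound a constant before it quantifies over all finite fields on a given type. On an
  infinite type such as \<^typ>\<open>nat\<close> every finite field occurs up to isomorphism.
\<close>

definition plane :: "'a ring \<Rightarrow> ('a \<times> 'a) set"
  where "plane F = carrier F \<times> carrier F"

definition dot :: "'a ring \<Rightarrow> 'a \<times> 'a \<Rightarrow> 'a \<times> 'a \<Rightarrow> 'a"
  where "dot F m x = fst m \<otimes>\<^bsub>F\<^esub> fst x \<oplus>\<^bsub>F\<^esub> snd m \<otimes>\<^bsub>F\<^esub> snd x"

definition modulus :: "'a ring \<Rightarrow> 'a \<times> 'a \<Rightarrow> 'a"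
  where "modulus F v = fst v [^]\<^bsub>F\<^esub> (2::nat) \<oplus>\<^bsub>F\<^esub> snd v [^]\<^bsub>F\<^esub> (2::nat)"

definition resultant :: "'a ring \<Rightarrow> nat \<Rightarrow> (nat \<Rightarrow> 'a \<times> 'a) \<Rightarrow> 'a \<times> 'a"
  where "resultant F k x =
    (fst (x 1) \<ominus>\<^bsub>F\<^esub> (\<Oplus>\<^bsub>F\<^esub>j\<in>{2..k}. fst (x j)),
     snd (x 1) \<ominus>\<^bsub>F\<^esub> (\<Oplus>\<^bsub>F\<^esub>j\<in>{2..k}. snd (x j)))"

definition resultant_modulus_set :: "'a ring \<Rightarrow> nat \<Rightarrow> ('a \<times> 'a) set \<Rightarrow> 'a set"
  where "resultant_modulus_set F k E = {modulus F (resultant F k x) |x. \<forall>j\<in>{1..k}. x j \<in> E}"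

definition additive_character :: "'a ring \<Rightarrow> ('a \<Rightarrow> complex) \<Rightarrow> bool"
  where "additive_character F \<chi> \<longleftrightarrow>
    (\<forall>a\<in>carrier F. norm (\<chi> a) = 1) \<and>
    (\<forall>a\<in>carrier F. \<forall>b\<in>carrier F. \<chi> (a \<oplus>\<^bsub>F\<^esub> b) = \<chi> a * \<chi> b)"

definition nontrivial_additive_character :: "'a ring \<Rightarrow> ('a \<Rightarrow> complex) \<Rightarrow> bool"
  where "nontrivial_additive_character F \<chi> \<longleftrightarrow>
    additive_character F \<chi> \<and> (\<exists>a\<in>carrier F. \<chi> a \<noteq> 1)"

definition fourier :: "'a ring \<Rightarrow> ('a \<Rightarrow> complex) \<Rightarrow> ('a \<times> 'a \<Rightarrow> complex) \<Rightarrow> 'a \<times> 'a \<Rightarrow> complex"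
  where "fourier F \<chi> f m =
    (\<Sum>x\<in>plane F. \<chi> (\<ominus>\<^bsub>F\<^esub> dot F m x) * f x) / of_nat (order F ^ 2)"

text \<open>
  Polynomials in two variables are elements of \<open>F[X][Y]\<close>: the coefficient of \<open>X\<^sup>i Y\<^sup>j\<close> is the
  \<open>i\<close>-th coefficient of the \<open>j\<close>-th coefficient.
\<close>

definition bicoeff :: "'a ring \<Rightarrow> (nat \<Rightarrow> nat \<Rightarrow> 'a) \<Rightarrow> nat \<Rightarrow> nat \<Rightarrow> 'a"
  where "bicoeff F Q i j = coeff (UP F) (coeff (UP (UP F)) Q j) i"

definition bieval :: "'a ring \<Rightarrow> (nat \<Rightarrow> nat \<Rightarrow> 'a) \<Rightarrow> 'a \<times> 'a \<Rightarrow> 'a"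
  where "bieval F Q v = eval (UP F) F (eval F F id (fst v)) (snd v) Q"

definition total_degree_le :: "'a ring \<Rightarrow> nat \<Rightarrow> (nat \<Rightarrow> nat \<Rightarrow> 'a) \<Rightarrow> bool"
  where "total_degree_le F n Q \<longleftrightarrow> (\<forall>i j. bicoeff F Q i j \<noteq> \<zero>\<^bsub>F\<^esub> \<longrightarrow> i + j \<le> n)"

definition linear_bipoly :: "'a ring \<Rightarrow> (nat \<Rightarrow> nat \<Rightarrow> 'a) \<Rightarrow> bool"
  where "linear_bipoly F L \<longleftrightarrow>
    L \<in> carrier (UP (UP F)) \<and> total_degree_le F 1 L \<and> \<not> total_degree_le F 0 L"

definition has_linear_factor :: "'a ring \<Rightarrow> (nat \<Rightarrow> nat \<Rightarrow> 'a) \<Rightarrow> bool"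
  where "has_linear_factor F Q \<longleftrightarrow> (\<exists>L. linear_bipoly F L \<and> L divides\<^bsub>UP (UP F)\<^esub> Q)"

definition variety :: "'a ring \<Rightarrow> (nat \<Rightarrow> nat \<Rightarrow> 'a) \<Rightarrow> ('a \<times> 'a) set"
  where "variety F Q = {v \<in> plane F. bieval F Q v = \<zero>\<^bsub>F\<^esub>}"

text \<open>
  The parameters \<open>a\<close>, \<open>b\<close>, \<open>c\<close> are the implied constants in \<open>|V| \<approx> q\<close> and in the Fourier decay
  bound; independence of \<open>q\<close> is a matter of where they are quantified.
\<close>

definition regular_curve ::
    "'a ring \<Rightarrow> ('a \<Rightarrow> complex) \<Rightarrow> real \<Rightarrow> real \<Rightarrow> real \<Rightarrow> ('a \<times> 'a) set \<Rightarrow> bool"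
  where "regular_curve F \<chi> a b c V \<longleftrightarrow>
    a * real (order F) \<le> real (card V) \<and>
    real (card V) \<le> b * real (order F) \<and>
    (\<forall>m\<in>plane F - {(\<zero>\<^bsub>F\<^esub>, \<zero>\<^bsub>F\<^esub>)}.
       norm (fourier F \<chi> (indicator V) m) \<le> c * real (order F) powr (- (3 / 2)))"

definition nondegenerate_regular_curve ::
    "'a ring \<Rightarrow> ('a \<Rightarrow> complex) \<Rightarrow> real \<Rightarrow> real \<Rightarrow> real \<Rightarrow> (nat \<Rightarrow> nat \<Rightarrow> 'a) \<Rightarrow> bool"
  where "nondegenerate_regular_curve F \<chi> a b c Q \<longleftrightarrow>
    Q \<in> carrier (UP (UP F)) \<and> regular_curve F \<chi> a b c (variety F Q) \<and> \<not> has_linear_factor F Q"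

end

theory Submission
  imports Defs "HOL-Algebra.Algebraic_Closure" "HOL-Library.Product_Plus"
begin

text \<open>
  Expand the number of representations of \<open>t\<close> in additive characters. The circle of radius
  \<open>t \<noteq> 0\<close> contributes \<open>O(\<surd>q)\<close> at nonzero frequencies, which is Weil's bound for
  Kloosterman sums, so it suffices to bound the moments of \<open>S(m) = \<Sum>\<^sub>x\<^sub>\<in>\<^sub>E \<chi>(m \<cdot> x)\<close>.

  For Kloosterman sums \<open>Kl\<^sub>j\<close> over a tower of quadratic extensions one has
  \<open>Kl\<^sub>j\<^sub>+\<^sub>1 = 2 Q\<^sub>j - Kl\<^sub>j\<^sup>2\<close>: for given \<open>u\<close>, \<open>v\<close> the pairs in the field with sum \<open>u\<close> and product
  \<open>v\<close> and the elements of the extension with trace \<open>u\<close> and norm \<open>v\<close> are two in total. A value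
  of \<open>\<bar>Kl\<^sub>0\<bar>\<close> above \<open>2\<surd>q\<close> would grow too fast for the estimate of Stepanov's method high up in the tower.

  Moments: positive definiteness allows one copy of \<open>E\<close> to be replaced by the curve \<open>V\<close>, whose Fourier
  decay reduces the moment of order \<open>2s + 2\<close> to that of order \<open>2s\<close>, down to the additive energy. The energy is
  \<open>O(\<bar>E\<bar>\<^sup>2)\<close> since only boundedly many translates of \<open>V\<close> meet \<open>V\<close> in many points. Otherwise, by counting
  polynomials restricted to pieces of \<open>V\<close>, the curve contains a large finite coset \<open>v + T\<close>; a polynomial
  of minimal degree vanishing on it is additive, so that its zero set, and then \<open>V\<close>, contains a coset of a
  group of order at least \<open>q / n\<close>, which contradicts the Fourier decay. This also covers curves such as
  \<open>y = x\<^sup>p\<close>, for which the number of common points of \<open>V\<close> and its translates is not bounded.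
\<close>

section \<open>Polynomial functions in one variable over a finite field\<close>

text \<open>The exponent is where the two sides of the count balance. The zero frequency contributes
  about \<open>q * |E|^k\<close>, the others at most \<open>2 * sqrt q\<close> times the moment of
  order \<open>k\<close>. If that moment has its expected size \<open>q^(k/2) * |E|^2\<close>, the
  zero frequency wins once \<open>|E|^(k-2)\<close> exceeds a multiple of
  \<open>q^((k-1)/2)\<close>, that is, once \<open>|E|\<close> exceeds a multiple of
  \<open>q^(1/2 + 1/(2k-4))\<close>. The positivity argument works with even orders; the moment of
  order \<open>k\<close> is interpolated between the orders \<open>2i\<close> and \<open>2j\<close>
  with \<open>i + j = k\<close>, and \<open>k >= 4\<close> allows \<open>i, j >= 2\<close>, so that
  both descend to the additive energy. The obstacle is uniformity in \<open>q\<close>. Instead of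
  components over the algebraic closure and Bezout's theorem, the proof uses sets of rational points
  on which every polynomial of degree at most \<open>n\<close> either vanishes identically or has
  few zeros. Such sets are told apart by the polynomials of degree at most \<open>n\<close> that
  vanish on them, and Hilbert functions show that at most \<open>n\<close> classes occur on a curve
  of degree \<open>n\<close>.\<close>

text \<open>
  The field is a subset \<open>K\<close> of a commutative ring whose unit element \<open>e\<close> need not be \<open>1\<close>. Since
  \<open>x ^ 0 = 1\<close> may lie outside \<open>K\<close>, powers with a possibly zero exponent occur multiplied
  by an element of \<open>K\<close>.
\<close>

primrec upol :: "'u::comm_ring_1 set \<Rightarrow> nat \<Rightarrow> ('u \<Rightarrow> 'u) set" where
  "upol K 0 = {f. \<exists>c\<in>K. \<forall>x\<in>K. f x = c}"
| "upol K (Suc d) = {f. \<exists>c\<in>K. \<exists>u\<in>upol K d. \<forall>x\<in>K. f x = c + x * u x}"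

text \<open>These are functions, not polynomials: on a finite \<open>K\<close> one function may have
  several exact degrees, as \<open>x ^ card K = x\<close> shows. Some representation with nonzero
  leading coefficient is all that the bound on the number of zeros needs.\<close>

primrec upol_exact :: "'u::comm_ring_1 set \<Rightarrow> nat \<Rightarrow> ('u \<Rightarrow> 'u) set" where
  "upol_exact K 0 = {f. \<exists>c\<in>K. c \<noteq> 0 \<and> (\<forall>x\<in>K. f x = c)}"
| "upol_exact K (Suc d) = {f. \<exists>c\<in>K. \<exists>u\<in>upol_exact K d. \<forall>x\<in>K. f x = c + x * u x}"

locale subfld =
  fixes K :: "'u::comm_ring_1 set" and e :: 'u
  assumes zero_in [simp, intro]: "0 \<in> K"
    and add_in [simp, intro]: "x \<in> K \<Longrightarrow> y \<in> K \<Longrightarrow> x + y \<in> K"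
    and uminus_in [simp, intro]: "x \<in> K \<Longrightarrow> - x \<in> K"
    and mult_in [simp, intro]: "x \<in> K \<Longrightarrow> y \<in> K \<Longrightarrow> x * y \<in> K"
    and e_in [simp, intro]: "e \<in> K"
    and e_neq_0 [simp]: "e \<noteq> 0"
    and e_left [simp]: "x \<in> K \<Longrightarrow> e * x = x"
    and ex_inverse: "x \<in> K \<Longrightarrow> x \<noteq> 0 \<Longrightarrow> \<exists>y\<in>K. x * y = e"
begin

lemma e_right [simp]: "x \<in> K \<Longrightarrow> x * e = x"
  using e_left by (simp add: mult.commute)

lemma minus_in [simp, intro]: "x \<in> K \<Longrightarrow> y \<in> K \<Longrightarrow> x - y \<in> K"
  using add_in[of x "- y"] by simp

lemma power_in [simp, intro]: "x \<in> K \<Longrightarrow> 0 < n \<Longrightarrow> x ^ n \<in> K"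
proof (induct n)
  case (Suc n)
  then show ?case by (cases n) auto
qed auto

lemma mult_power_in [simp, intro]: "c \<in> K \<Longrightarrow> x \<in> K \<Longrightarrow> c * x ^ n \<in> K"
  by (cases "n = 0") auto

lemma e_power [simp]: "0 < n \<Longrightarrow> e ^ n = e"
proof (induct n)
  case (Suc n)
  then show ?case by (cases n) auto
qed auto

lemma sum_in [simp, intro]: "(\<And>i. i \<in> A \<Longrightarrow> f i \<in> K) \<Longrightarrow> sum f A \<in> K"
  by (induct A rule: infinite_finite_induct) auto

lemma prod_eq_0_iff [simp]:
  assumes "x \<in> K" "y \<in> K" shows "x * y = 0 \<longleftrightarrow> x = 0 \<or> y = 0"
proof
  assume xy: "x * y = 0"
  show "x = 0 \<or> y = 0"
  proof (rule ccontr)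
    assume "\<not> (x = 0 \<or> y = 0)"
    then obtain z where "z \<in> K" "x * z = e" using ex_inverse assms by blast
    then have "y = (x * y) * z" using assms by (metis e_left mult.commute mult.left_commute)
    then show False using xy \<open>\<not> _\<close> by simp
  qed
qed auto

lemma power_eq_0: "x \<in> K \<Longrightarrow> x ^ n = 0 \<Longrightarrow> 0 < n \<Longrightarrow> x = 0"
proof (induct n)
  case (Suc n)
  then show ?case by (cases n) auto
qed auto

lemma cancel_left:
  assumes "x \<in> K" "y \<in> K" "z \<in> K" "x \<noteq> 0" shows "x * y = x * z \<longleftrightarrow> y = z"
  using prod_eq_0_iff[of x "y - z"] assms by (auto simp: algebra_simps)

definition ivs :: "'u \<Rightarrow> 'u" where "ivs x = (SOME y. y \<in> K \<and> x * y = e)"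

lemma ivs: assumes "x \<in> K" "x \<noteq> 0"
  shows ivs_in [simp]: "ivs x \<in> K" and ivs_right [simp]: "x * ivs x = e"
    and ivs_left [simp]: "ivs x * x = e" and ivs_neq_0 [simp]: "ivs x \<noteq> 0"
proof -
  have "ivs x \<in> K \<and> x * ivs x = e" unfolding ivs_def
    by (rule someI_ex) (use ex_inverse assms in blast)
  then show "ivs x \<in> K" "x * ivs x = e" "ivs x * x = e" by (auto simp: mult.commute)
  then show "ivs x \<noteq> 0" by auto
qed

lemma ivs_unique: "x \<in> K \<Longrightarrow> y \<in> K \<Longrightarrow> x * y = e \<Longrightarrow> y = ivs x"
proof -
  assume a: "x \<in> K" "y \<in> K" "x * y = e"
  then have "x \<noteq> 0" by auto
  then show "y = ivs x" using cancel_left[of x y "ivs x"] a by auto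
qed

lemma upol_closed: "f \<in> upol K d \<Longrightarrow> x \<in> K \<Longrightarrow> f x \<in> K"
  by (induct d arbitrary: f) auto

lemma upol_cong: "f \<in> upol K d \<Longrightarrow> (\<And>x. x \<in> K \<Longrightarrow> f x = g x) \<Longrightarrow> g \<in> upol K d"
  by (cases d) auto

lemma upol_exact_cong:
  "f \<in> upol_exact K d \<Longrightarrow> (\<And>x. x \<in> K \<Longrightarrow> f x = g x) \<Longrightarrow> g \<in> upol_exact K d"
  by (cases d) auto

lemma upol_const: "c \<in> K \<Longrightarrow> (\<lambda>x. c) \<in> upol K d"
proof (induct d arbitrary: c)
  case (Suc d)
  show ?case using Suc(1)[of 0] Suc(2)
    by (auto intro!: bexI[of _ c] bexI[of _ "\<lambda>x. 0"])
qed auto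

lemma upol_add: "f \<in> upol K d \<Longrightarrow> g \<in> upol K d \<Longrightarrow> (\<lambda>x. f x + g x) \<in> upol K d"
proof (induct d arbitrary: f g)
  case (Suc d)
  then obtain c u c' u' where "c \<in> K" "u \<in> upol K d" "\<forall>x\<in>K. f x = c + x * u x"
    "c' \<in> K" "u' \<in> upol K d" "\<forall>x\<in>K. g x = c' + x * u' x" by auto
  then show ?case using Suc(1)[of u u']
    by (auto intro!: bexI[of _ "c + c'"] bexI[of _ "\<lambda>x. u x + u' x"] simp: algebra_simps)
qed auto

lemma upol_cmult: "f \<in> upol K d \<Longrightarrow> c \<in> K \<Longrightarrow> (\<lambda>x. c * f x) \<in> upol K d"
proof (induct d arbitrary: f)
  case (Suc d)
  then obtain c' u' where "c' \<in> K" "u' \<in> upol K d" "\<forall>x\<in>K. f x = c' + x * u' x" by auto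
  then show ?case using Suc(1)[of u'] Suc(3)
    by (auto intro!: bexI[of _ "c * c'"] bexI[of _ "\<lambda>x. c * u' x"] simp: algebra_simps)
qed auto

lemma upol_shift: "f \<in> upol K d \<Longrightarrow> (\<lambda>x. x * f x) \<in> upol K (Suc d)"
  by (auto intro!: bexI[of _ 0] bexI[of _ f])

lemma upol_Suc: "f \<in> upol K d \<Longrightarrow> f \<in> upol K (Suc d)"
proof (induct d arbitrary: f)
  case 0
  then obtain c where c: "c \<in> K" "\<forall>x\<in>K. f x = c" by auto
  show ?case by (rule upol_cong[OF upol_const[OF c(1)]]) (use c in auto)
next
  case (Suc d)
  then obtain c u where "c \<in> K" "u \<in> upol K d" "\<forall>x\<in>K. f x = c + x * u x" by auto
  then show ?case using Suc(1)[of u] by (subst upol.simps) blast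
qed

lemma upol_mono: "f \<in> upol K d \<Longrightarrow> d \<le> d' \<Longrightarrow> f \<in> upol K d'"
  by (induct d' rule: nat_induct) (auto simp: le_Suc_eq simp del: upol.simps dest: upol_Suc)

lemma upol_mult: "f \<in> upol K a \<Longrightarrow> g \<in> upol K b \<Longrightarrow> (\<lambda>x. f x * g x) \<in> upol K (a + b)"
proof (induct a arbitrary: f)
  case 0
  then obtain c where c: "c \<in> K" "\<forall>x\<in>K. f x = c" by auto
  show ?case by (rule upol_cong[of "\<lambda>x. c * g x"]) (use c 0 upol_cmult in auto)
next
  case (Suc a)
  then obtain c u where c: "c \<in> K" "u \<in> upol K a" "\<forall>x\<in>K. f x = c + x * u x" by auto
  have "(\<lambda>x. c * g x) \<in> upol K (Suc a + b)" by (rule upol_mono[OF upol_cmult[OF Suc(3) c(1)]]) simp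
  moreover have "(\<lambda>x. x * (u x * g x)) \<in> upol K (Suc a + b)"
    unfolding add_Suc by (rule upol_shift[OF Suc(1)[OF c(2) Suc(3)]])
  ultimately show ?case
    by (rule upol_cong[OF upol_add]) (use c in \<open>auto simp: algebra_simps\<close>)
qed

lemma upol_sum:
  "(\<And>i. i \<in> A \<Longrightarrow> f i \<in> upol K d) \<Longrightarrow> (\<lambda>x. \<Sum>i\<in>A. f i x) \<in> upol K d"
proof (induct A rule: infinite_finite_induct)
  case (insert i A)
  then have "(\<lambda>x. f i x + (\<Sum>i\<in>A. f i x)) \<in> upol K d"
    by (intro upol_add) auto
  then show ?case using insert by simp
qed (use upol_const in auto)

lemma upol_monom: "c \<in> K \<Longrightarrow> (\<lambda>x. c * x ^ n) \<in> upol K n"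
proof (induct n)
  case (Suc n)
  show ?case by (rule upol_cong[OF upol_shift[OF Suc(1)[OF Suc(2)]]]) (simp add: algebra_simps)
qed auto

lemma upol_cmult_power: "c \<in> K \<Longrightarrow> f \<in> upol K d \<Longrightarrow> (\<lambda>x. c * f x ^ n) \<in> upol K (d * n)"
proof (induct n)
  case (Suc n)
  show ?case
    by (rule upol_cong[of "\<lambda>x. f x * (c * f x ^ n)"])
      (use upol_mult[OF Suc(3) Suc(1)[OF Suc(2,3)]] in \<open>auto simp: algebra_simps\<close>)
qed auto

lemma upol_exact_upol: "f \<in> upol_exact K d \<Longrightarrow> f \<in> upol K d"
  by (induct d arbitrary: f) auto

lemma upol_zero_or_exact:
  "f \<in> upol K d \<Longrightarrow> (\<forall>x\<in>K. f x = 0) \<or> (\<exists>d'\<le>d. f \<in> upol_exact K d')"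
proof (induct d arbitrary: f)
  case 0
  then show ?case by auto
next
  case (Suc d)
  then obtain c u where c: "c \<in> K" "u \<in> upol K d" "\<forall>x\<in>K. f x = c + x * u x" by auto
  consider "\<forall>x\<in>K. u x = 0" | d' where "d' \<le> d" "u \<in> upol_exact K d'" using Suc(1)[OF c(2)] by blast
  then show ?case
  proof cases
    case 1
    then show ?thesis using c by (cases "c = 0") (auto intro!: exI[of _ 0])
  next
    case 2
    then have "f \<in> upol_exact K (Suc d')" using c by auto
    then show ?thesis using 2 Suc_le_mono by blast
  qed
qed

lemma upol_exact_cmult:
  "f \<in> upol_exact K d \<Longrightarrow> c \<in> K \<Longrightarrow> c \<noteq> 0 \<Longrightarrow> (\<lambda>x. c * f x) \<in> upol_exact K d"
proof (induct d arbitrary: f)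
  case 0
  then obtain c' where "c' \<in> K" "c' \<noteq> 0" "\<forall>x\<in>K. f x = c'" by auto
  then show ?case using 0 by (auto intro!: bexI[of _ "c * c'"])
next
  case (Suc d)
  then obtain c' u' where "c' \<in> K" "u' \<in> upol_exact K d" "\<forall>x\<in>K. f x = c' + x * u' x" by auto
  then show ?case using Suc(1)[of u'] Suc(3-)
    by (auto intro!: bexI[of _ "c * c'"] bexI[of _ "\<lambda>x. c * u' x"] simp: algebra_simps)
qed

lemma upol_exact_add:
  "f \<in> upol_exact K (Suc d) \<Longrightarrow> g \<in> upol K d \<Longrightarrow> (\<lambda>x. f x + g x) \<in> upol_exact K (Suc d)"
proof (induct d arbitrary: f g)
  case 0
  then obtain c u c' where *: "c \<in> K" "u \<in> upol_exact K 0" "\<forall>x\<in>K. f x = c + x * u x"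
    "c' \<in> K" "\<forall>x\<in>K. g x = c'" by auto
  show ?case unfolding upol_exact.simps(2)
    by (intro CollectI bexI[of _ "c + c'"] bexI[of _ u]) (use * in auto)
next
  case (Suc d)
  obtain c u where cu: "c \<in> K" "u \<in> upol_exact K (Suc d)" "\<forall>x\<in>K. f x = c + x * u x"
    using Suc(2)[unfolded upol_exact.simps(2)[of K "Suc d"]] by blast
  obtain c' u' where cu': "c' \<in> K" "u' \<in> upol K d" "\<forall>x\<in>K. g x = c' + x * u' x"
    using Suc(3) by auto
  note * = cu cu'
  show ?case
    by (subst upol_exact.simps, intro CollectI bexI[of _ "c + c'"] bexI[of _ "\<lambda>x. u x + u' x"])
      (use * Suc(1)[OF *(2,5)] in \<open>simp_all add: algebra_simps del: upol_exact.simps\<close>)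
qed

lemma upol_exact_shift: "f \<in> upol_exact K d \<Longrightarrow> (\<lambda>x. x * f x) \<in> upol_exact K (Suc d)"
  by (auto intro!: bexI[of _ 0] bexI[of _ f])

lemma upol_exact_mult:
  "f \<in> upol_exact K a \<Longrightarrow> g \<in> upol_exact K b \<Longrightarrow> (\<lambda>x. f x * g x) \<in> upol_exact K (a + b)"
proof (induct a arbitrary: f)
  case 0
  then obtain c where c: "c \<in> K" "c \<noteq> 0" "\<forall>x\<in>K. f x = c" by auto
  show ?case by (rule upol_exact_cong[of "\<lambda>x. c * g x"]) (use c 0 upol_exact_cmult in auto)
next
  case (Suc a)
  then obtain c u where c: "c \<in> K" "u \<in> upol_exact K a" "\<forall>x\<in>K. f x = c + x * u x" by auto
  have "(\<lambda>x. c * g x) \<in> upol K (a + b)"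
    using upol_mono[OF upol_cmult[OF upol_exact_upol[OF Suc(3)] c(1)]] by simp
  then have *: "(\<lambda>x. x * (u x * g x) + c * g x) \<in> upol_exact K (Suc (a + b))"
    by (intro upol_exact_add upol_exact_shift Suc(1)[OF c(2) Suc(3)])
  show ?case unfolding add_Suc
  proof (rule upol_exact_cong[OF *])
    fix x assume "x \<in> K"
    then show "x * (u x * g x) + c * g x = f x * g x" using c(3) by (simp add: algebra_simps)
  qed
qed

lemma upol_exact_monom: "c \<in> K \<Longrightarrow> c \<noteq> 0 \<Longrightarrow> (\<lambda>x. c * x ^ n) \<in> upol_exact K n"
proof (induct n)
  case (Suc n)
  show ?case by (rule upol_exact_cong[OF upol_exact_shift[OF Suc(1)[OF Suc(2,3)]]]) (simp add: algebra_simps)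
qed auto

lemma upol_exact_cmult_power:
  "c \<in> K \<Longrightarrow> c \<noteq> 0 \<Longrightarrow> f \<in> upol_exact K d \<Longrightarrow> (\<lambda>x. c * f x ^ n) \<in> upol_exact K (d * n)"
proof (induct n)
  case (Suc n)
  show ?case
    by (rule upol_exact_cong[of "\<lambda>x. f x * (c * f x ^ n)"])
      (use upol_exact_mult[OF Suc(4) Suc(1)[OF Suc(2-4)]] in \<open>auto simp: algebra_simps\<close>)
qed auto

text \<open>Division by \<open>x - a\<close>; the quotient keeps the leading coefficient, so its
  degree is again exact.\<close>

lemma upol_exact_root:
  "f \<in> upol_exact K (Suc d) \<Longrightarrow> a \<in> K \<Longrightarrow> \<exists>g\<in>upol_exact K d. \<forall>x\<in>K. f x = f a + (x - a) * g x"
proof (induct d arbitrary: f)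
  case 0
  then obtain c u where *: "c \<in> K" "u \<in> upol_exact K 0" "\<forall>x\<in>K. f x = c + x * u x" by auto
  then obtain c' where c': "c' \<noteq> 0" "c' \<in> K" "\<forall>x\<in>K. u x = c'" by auto
  show ?case by (rule bexI[of _ u]) (use * c' 0 in \<open>auto simp: algebra_simps\<close>)
next
  case (Suc d)
  obtain c u where *: "c \<in> K" "u \<in> upol_exact K (Suc d)" "\<forall>x\<in>K. f x = c + x * u x"
    using Suc(2)[unfolded upol_exact.simps(2)[of K "Suc d"]] by blast
  obtain g where g: "g \<in> upol_exact K d" "\<forall>x\<in>K. u x = u a + (x - a) * g x" using Suc(1)[OF *(2) Suc(3)] by auto
  have ua: "u a \<in> K" using upol_closed[OF upol_exact_upol[OF *(2)]] Suc(3) by blast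
  have "f x = f a + (x - a) * (u a + x * g x)" if "x \<in> K" for x
  proof -
    have 1: "u x = u a + (x - a) * g x" and 2: "f x = c + x * u x" and 3: "f a = c + a * u a"
      using g(2) * that Suc(3) by blast+
    have "f x = c + x * (u a + (x - a) * g x)" unfolding 2 by (subst 1) (rule refl)
    also have "\<dots> = (c + a * u a) + (x - a) * (u a + x * g x)" by (simp add: algebra_simps)
    finally show ?thesis unfolding 3 .
  qed
  then have "\<forall>x\<in>K. f x = f a + (x - a) * (u a + x * g x)" by blast
  moreover have "(\<lambda>x. u a + x * g x) \<in> upol_exact K (Suc d)" using ua g(1) by auto
  ultimately show ?case by (rule bexI[where x = "\<lambda>x. u a + x * g x"])
qed

lemma upol_exact_roots:
  "f \<in> upol_exact K d \<Longrightarrow> finite {x\<in>K. f x = 0} \<and> card {x\<in>K. f x = 0} \<le> d"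
proof (induct d arbitrary: f)
  case 0
  then have "{x\<in>K. f x = 0} = {}" by auto
  then show ?case by (metis card.empty finite.emptyI le0)
next
  case (Suc d)
  show ?case
  proof (cases "\<exists>a\<in>K. f a = 0")
    case True
    then obtain a where a: "a \<in> K" "f a = 0" by auto
    obtain g where g: "g \<in> upol_exact K d" "\<forall>x\<in>K. f x = f a + (x - a) * g x"
      using upol_exact_root[OF Suc(2) a(1)] by auto
    have gx: "g x \<in> K" if "x \<in> K" for x using upol_closed[OF upol_exact_upol[OF g(1)]] that by blast
    have "{x\<in>K. f x = 0} \<subseteq> insert a {x\<in>K. g x = 0}"
      using g(2) a gx by auto
    moreover have "finite (insert a {x\<in>K. g x = 0})" "card (insert a {x\<in>K. g x = 0}) \<le> Suc d"
      using Suc(1)[OF g(1)] by (auto simp: card_insert_if)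
    ultimately show ?thesis by (meson card_mono finite_subset order_trans)
  next
    case False
    then have "{x\<in>K. f x = 0} = {}" by auto
    then show ?thesis by (metis card.empty finite.emptyI le0)
  qed
qed

lemma upol_vanish:
  assumes "f \<in> upol K d" "A \<subseteq> {x\<in>K. f x = 0}" "d < card A" "x \<in> K"
  shows "f x = 0"
proof (rule ccontr)
  assume "f x \<noteq> 0"
  then obtain d' where d': "d' \<le> d" "f \<in> upol_exact K d'" using upol_zero_or_exact[OF assms(1)] assms(4) by auto
  show False using upol_exact_roots[OF d'(2)] assms(2,3) d'(1)
    by (meson card_mono leD order_trans)
qed

text \<open>A function is given by \<open>d + 1\<close> coefficients in \<open>K\<close>.
  Restriction identifies functions that agree on \<open>K\<close>, so that they can be
  counted.\<close>

lemma upol_card: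
  assumes "finite K"
  shows "finite ((\<lambda>f. restrict f K) ` upol K d) \<and> card ((\<lambda>f. restrict f K) ` upol K d) \<le> card K ^ Suc d"
proof (induct d)
  case 0
  have "(\<lambda>f. restrict f K) ` upol K 0 \<subseteq> (\<lambda>c. \<lambda>x\<in>K. c) ` K" by (auto simp: restrict_def image_iff fun_eq_iff)
  then show ?case using assms surj_card_le[OF assms] finite_subset[OF _ finite_imageI[OF assms]]
    by (metis One_nat_def power_one_right)
next
  case (Suc d)
  define R where "R = (\<lambda>f. restrict f K) ` upol K d"
  have R: "finite R" "card R \<le> card K ^ Suc d" using Suc unfolding R_def by blast+
  have sub: "(\<lambda>f. restrict f K) ` upol K (Suc d) \<subseteq> (\<lambda>(c, u). \<lambda>x\<in>K. c + x * u x) ` (K \<times> R)"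
  proof
    fix h assume "h \<in> (\<lambda>f. restrict f K) ` upol K (Suc d)"
    then obtain f where f: "f \<in> upol K (Suc d)" "h = restrict f K" by blast
    then obtain c u where *: "c \<in> K" "u \<in> upol K d" "\<forall>x\<in>K. f x = c + x * u x" by auto
    then have "h = (\<lambda>x\<in>K. c + x * restrict u K x)" using f by (auto simp: fun_eq_iff)
    moreover have "(c, restrict u K) \<in> K \<times> R" using * by (auto simp: R_def)
    ultimately show "h \<in> (\<lambda>(c, u). \<lambda>x\<in>K. c + x * u x) ` (K \<times> R)"
      by (intro image_eqI[of _ _ "(c, restrict u K)"]) (simp_all only: prod.case)
  qed
  have fin: "finite (K \<times> R)" and le: "card (K \<times> R) \<le> card K ^ Suc (Suc d)"
    using R assms by (simp_all add: card_cartesian_product)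
  show ?case using finite_surj[OF fin sub] le_trans[OF surj_card_le[OF fin sub] le] by (rule conjI)
qed

end

section \<open>Stepanov's method\<close>

context subfld
begin

text \<open>The degrees \<open>D i\<close> are distinct, so among the terms with nonzero coefficient
  the one of largest degree cannot be cancelled.\<close>

lemma upol_exact_lincomb:
  assumes "finite J" "\<And>i. i \<in> J \<Longrightarrow> E i \<in> K" "inj_on D J" "\<And>i. i \<in> J \<Longrightarrow> g i \<in> upol_exact K (D i)"
    and "i1 \<in> J" "E i1 \<noteq> 0"
  shows "\<exists>i0\<in>J. (\<lambda>x. \<Sum>i\<in>J. E i * g i x) \<in> upol_exact K (D i0)"
proof -
  define S where "S = {i\<in>J. E i \<noteq> 0}"
  have "finite S" "S \<noteq> {}" using assms by (auto simp: S_def)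
  then obtain i0 where i0: "i0 \<in> S" "\<And>i. i \<in> S \<Longrightarrow> D i \<le> D i0"
    using finite_imageI[of S D] Max_in[of "D ` S"] Max_ge[of "D ` S"] by (metis (no_types) image_iff image_is_empty imageI)
  have less: "D i < D i0" if "i \<in> S" "i \<noteq> i0" for i
    using i0 that assms(3) unfolding S_def inj_on_def by (metis (mono_tags, lifting) le_neq_implies_less mem_Collect_eq)
  have main: "(\<lambda>x. E i0 * g i0 x) \<in> upol_exact K (D i0)"
    using i0(1) assms(2,4) by (intro upol_exact_cmult) (auto simp: S_def)
  have split: "(\<Sum>i\<in>J. E i * g i x) = E i0 * g i0 x + (\<Sum>i\<in>S - {i0}. E i * g i x)" for x
  proof -
    have "(\<Sum>i\<in>J. E i * g i x) = (\<Sum>i\<in>S. E i * g i x)"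
      unfolding S_def using assms(1) by (intro sum.mono_neutral_right) auto
    then show ?thesis using \<open>finite S\<close> i0(1) by (simp add: sum.remove)
  qed
  have "(\<lambda>x. \<Sum>i\<in>J. E i * g i x) \<in> upol_exact K (D i0)"
  proof (cases "D i0")
    case 0
    then have "S - {i0} = {}" using less by fastforce
    then show ?thesis using main by (simp only: split sum.empty add_0_right)
  next
    case (Suc d)
    have "(\<lambda>x. \<Sum>i\<in>S - {i0}. E i * g i x) \<in> upol K d"
    proof (rule upol_sum)
      fix i assume i: "i \<in> S - {i0}"
      show "(\<lambda>x. E i * g i x) \<in> upol K d"
        by (rule upol_mono[of _ "D i"], rule upol_cmult, rule upol_exact_upol)
          (use i less[of i] Suc assms(2,4) in \<open>auto simp: S_def\<close>)
    qed
    then show ?thesis using main upol_exact_add unfolding split Suc by blast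
  qed
  then show ?thesis using i0(1) by (auto simp: S_def)
qed

lemma prod_in: "finite A \<Longrightarrow> A \<noteq> {} \<Longrightarrow> (\<And>i. i \<in> A \<Longrightarrow> f i \<in> K \<and> f i \<noteq> 0) \<Longrightarrow> prod f A \<in> K \<and> prod f A \<noteq> 0"
  by (induct A rule: finite_ne_induct) auto

text \<open>Multiplication by \<open>x \<noteq> 0\<close> permutes the nonzero elements; comparing
  their products gives \<open>x ^ (card K - 1) = e\<close>.\<close>

lemma power_card:
  assumes "finite K" "x \<in> K"
  shows "x ^ card K = x"
proof (cases "x = 0")
  case True
  have "card K > 0" using assms by (auto simp: card_gt_0_iff)
  then show ?thesis using True by (simp add: zero_power)
next
  case False
  define P where "P = prod id (K - {0})"
  have P: "P \<in> K" "P \<noteq> 0" unfolding P_def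
    using prod_in[of "K - {0}" id] assms False by auto
  have "(\<lambda>y. x * y) ` (K - {0}) = K - {0}"
  proof (rule card_subset_eq)
    show "(\<lambda>y. x * y) ` (K - {0}) \<subseteq> K - {0}" using assms False by auto
    have "inj_on (\<lambda>y. x * y) (K - {0})" using cancel_left[OF assms(2) _ _ False] by (auto simp: inj_on_def)
    then show "card ((\<lambda>y. x * y) ` (K - {0})) = card (K - {0})" by (rule card_image)
  qed (use assms in auto)
  moreover have inj: "inj_on (\<lambda>y. x * y) (K - {0})" using cancel_left[OF assms(2) _ _ False] by (auto simp: inj_on_def)
  ultimately have "P = (\<Prod>y\<in>K - {0}. x * y)"
    unfolding P_def using prod.reindex[OF inj, of id] by (simp add: comp_def)
  also have "\<dots> = x ^ card (K - {0}) * P" by (simp add: P_def prod.distrib)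
  finally have "P = x ^ card (K - {0}) * P" .
  moreover have pos: "card (K - {0}) > 0" using assms False card_gt_0_iff[of "K - {0}"] by blast
  moreover have xk: "x ^ card (K - {0}) \<in> K" using pos assms by auto
  ultimately have "P * e = P * x ^ card (K - {0})" using P by (simp add: mult.commute)
  then have "x ^ card (K - {0}) = e" using cancel_left[OF P(1) e_in xk P(2)] by simp
  then have "x * x ^ card (K - {0}) = x" using assms by simp
  moreover have "card K = Suc (card (K - {0}))" using assms card.remove[of K 0] zero_in by blast
  ultimately show ?thesis by (simp only: power_Suc)
qed

end

text \<open>Additivity of the \<open>q\<close>-th power is assumed directly, so that no
  characteristic and no factorisation of \<open>q\<close> has to be discussed.\<close>

locale frob_subfld = subfld +
  fixes q :: nat
  assumes frob: "x \<in> K \<Longrightarrow> y \<in> K \<Longrightarrow> (x + y) ^ q = x ^ q + y ^ q"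
    and q_ge: "2 \<le> q"
begin

lemma frob_pow: "x \<in> K \<Longrightarrow> y \<in> K \<Longrightarrow> (x + y) ^ (q ^ i) = x ^ (q ^ i) + y ^ (q ^ i)"
proof (induct i)
  case (Suc i)
  have "q > 0" "q ^ i > 0" using q_ge by auto
  then show ?case using Suc frob[of "x ^ q ^ i" "y ^ q ^ i"]
    by (simp add: power_mult mult.commute[of q])
qed auto

lemma frob_pow_sum:
  "(\<And>i. i \<in> A \<Longrightarrow> f i \<in> K) \<Longrightarrow> (\<Sum>i\<in>A. f i) ^ (q ^ n) = (\<Sum>i\<in>A. f i ^ (q ^ n))"
proof (induct A rule: infinite_finite_induct)
  case (insert i A)
  then show ?case using frob_pow[of "f i" "sum f A"] by auto
qed (use q_ge in \<open>auto simp: zero_power\<close>)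

lemma frob_pow_diff:
  assumes "x \<in> K" "y \<in> K" shows "(x - y) ^ (q ^ i) = x ^ (q ^ i) - y ^ (q ^ i)"
  using frob_pow[of "x - y" y i] assms by simp

text \<open>
  With \<open>w = \<Sum>\<^sub>i\<^sub><\<^sub>j (a x + b / x)^(q^i)\<close> the condition reads \<open>w ^ r = c - w\<close>. The auxiliary function is
  \<open>G = \<Sum> E\<^sub>\<alpha>\<^sub>\<beta>\<^sub>\<gamma> x^(\<alpha> + r\<beta>) w^\<gamma>\<close>, cleared of denominators. It is not zero because the degrees of its terms are distinct,
  while on the points counted \<open>G ^ r = \<Sum> E\<^sub>\<alpha>\<^sub>\<beta>\<^sub>\<gamma>^r x^(r\<alpha> + \<beta>) (c - w)^\<gamma>\<close>, which is of low degree and is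
  killed by a pigeonhole choice of \<open>E\<close>.
\<close>

lemma stepanov:
  assumes fin: "finite K" and card: "card K = r ^ 2" and r: "r = q ^ j" "3 \<le> r"
    and ab: "a \<in> K" "a \<noteq> 0" "a ^ q = a" "b \<in> K" "b ^ q = b" and c: "c \<in> K"
  shows "card {x\<in>K - {0}. (\<Sum>i<2 * j. (a * x + b * ivs x) ^ (q ^ i)) = c} \<le> r * (r div q + 5)"
proof -
  obtain j' where j': "j = Suc j'" using r by (cases j) auto
  define \<rho> where "\<rho> = q ^ j'"
  have rq: "r = \<rho> * q" "r div q = \<rho>" using r q_ge by (auto simp: j' \<rho>_def)
  have \<rho>: "0 < \<rho>" "\<rho> < r" using q_ge by (auto simp: \<rho>_def rq)
  \<comment> \<open>The \<open>r * m\<close> free coefficients of \<open>G\<close> must outnumber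
    the \<open>r * \<rho> + r + m + 1\<close> coefficients of \<open>H\<close>. The margin 4
    achieves this as soon as \<open>r >= 3\<close>, and it turns into the 5 of the final bound
    \<open>r * (m + 1)\<close>.\<close>
  define m where "m = \<rho> + 4"
  define A where "A = {x\<in>K - {0}. (\<Sum>i<2 * j. (a * x + b * ivs x) ^ (q ^ i)) = c}"
  \<comment> \<open>This is \<open>x ^ \<rho> * w\<close>: the poles of \<open>w\<close> have order
    at most \<open>\<rho> = q ^ (j - 1)\<close>, the largest power that occurs for
    \<open>i < j\<close>.\<close>
  define wt where "wt = (\<lambda>x. \<Sum>i<j. a * x ^ (\<rho> + q ^ i) + b * x ^ (\<rho> - q ^ i))"
  define J where "J = {..<\<rho>} \<times> {..<m} \<times> {..<q}"
  \<comment> \<open>Since \<open>wt\<close> has degree \<open>2 * \<rho>\<close>, the factor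
    \<open>x ^ (\<rho> * (q - 1 - \<gamma>)) * wt x ^ \<gamma>\<close> has degree
    \<open>\<rho> * (q - 1) + \<rho> * \<gamma>\<close>. With \<open>r = \<rho> * q\<close>, the
    indices \<open>\<alpha> < \<rho>\<close>, \<open>\<gamma> < q\<close> and \<open>\<beta>\<close>
    become the digits of a mixed radix expansion, which makes \<open>D\<close> injective.\<close>
  define D where "D = (\<lambda>(\<alpha>, \<beta>, \<gamma>). \<alpha> + r * \<beta> + \<rho> * (q - 1) + \<rho> * \<gamma>)"
  define g where "g = (\<lambda>(\<alpha>, \<beta>, \<gamma>) x. e * x ^ (\<alpha> + r * \<beta> + \<rho> * (q - 1 - \<gamma>)) * (e * wt x ^ \<gamma>))"
  define G where "G = (\<lambda>E x. \<Sum>i\<in>J. E i * g i x)"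
  define k where "k = (\<lambda>(\<alpha>, \<beta>, \<gamma>) x. e * x ^ (r * \<alpha> + \<beta> + \<rho> * (q - 1 - \<gamma>)) * (e * (c * x ^ \<rho> - wt x) ^ \<gamma>))"
  define H where "H = (\<lambda>E x. \<Sum>i\<in>J. E i ^ r * k i x)"
  have finJ: "finite J" by (simp add: J_def)
  have r0: "r > 0" using r(2) by simp
  have qi: "q ^ i \<le> \<rho>" if "i < j" for i unfolding \<rho>_def using that q_ge j' by (intro power_increasing) auto

  have a_pow: "a ^ (q ^ i) = a" for i by (induct i) (auto simp: power_mult ab)
  have b_pow: "b ^ (q ^ i) = b" for i by (induct i) (auto simp: power_mult ab)

  have wt_exact: "wt \<in> upol_exact K (2 * \<rho>)"
  proof -
    define v where "v = (\<lambda>x. (\<Sum>i<j'. a * x ^ (\<rho> + q ^ i)) + (\<Sum>i<j. b * x ^ (\<rho> - q ^ i)))"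
    have "v \<in> upol K (2 * \<rho> - 1)" unfolding v_def
    proof (intro upol_add upol_sum)
      fix i assume "i \<in> {..<j'}"
      then have "q ^ i < \<rho>" unfolding \<rho>_def using q_ge by (intro power_strict_increasing) auto
      then show "(\<lambda>x. a * x ^ (\<rho> + q ^ i)) \<in> upol K (2 * \<rho> - 1)"
        by (intro upol_mono[OF upol_monom[OF ab(1)]]) auto
    next
      fix i assume "i \<in> {..<j}"
      have "q ^ i > 0" using q_ge by simp
      then show "(\<lambda>x. b * x ^ (\<rho> - q ^ i)) \<in> upol K (2 * \<rho> - 1)"
        using \<rho> by (intro upol_mono[OF upol_monom[OF ab(4)]]) auto
    qed
    moreover have "2 * \<rho> = Suc (2 * \<rho> - 1)" using \<rho> by simp
    ultimately have "(\<lambda>x. a * x ^ (2 * \<rho>) + v x) \<in> upol_exact K (2 * \<rho>)"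
      using upol_exact_add upol_exact_monom[OF ab(1,2), of "2 * \<rho>"] by metis
    moreover have "wt x = a * x ^ (2 * \<rho>) + v x" for x
      by (simp add: wt_def v_def j' sum.distrib algebra_simps \<rho>_def[symmetric] mult_2_right)
    ultimately show ?thesis by (elim upol_exact_cong) simp
  qed
  then have wt_in: "wt x \<in> K" if "x \<in> K" for x using that upol_closed[OF upol_exact_upol] by blast

  have g_exact: "g i \<in> upol_exact K (D i)" if "i \<in> J" for i
  proof -
    obtain \<alpha> \<beta> \<gamma> where i: "i = (\<alpha>, \<beta>, \<gamma>)" by (cases i)
    have "\<gamma> < q" using that by (auto simp: i J_def)
    then have "q - 1 = (q - 1 - \<gamma>) + \<gamma>" by simp
    then have "\<rho> * (q - 1) = \<rho> * (q - 1 - \<gamma>) + \<rho> * \<gamma>" by (metis add_mult_distrib2)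
    then have "(\<alpha> + r * \<beta> + \<rho> * (q - 1 - \<gamma>)) + 2 * \<rho> * \<gamma> = D i"
      by (simp add: i D_def)
    then show ?thesis unfolding i g_def prod.case
      using upol_exact_mult[OF upol_exact_monom[OF e_in e_neq_0, of "\<alpha> + r * \<beta> + \<rho> * (q - 1 - \<gamma>)"]
          upol_exact_cmult_power[OF e_in e_neq_0 wt_exact, of \<gamma>]]
      by (simp only:)
  qed
  have g_in: "g i x \<in> K" if "i \<in> J" "x \<in> K" for i x
    using upol_closed[OF upol_exact_upol[OF g_exact]] that by blast

  have D_inj: "inj_on D J"
  proof -
    have "\<alpha> = \<alpha>' \<and> \<beta> = \<beta>' \<and> \<gamma> = \<gamma>'" if lt: "\<alpha> < \<rho>" "\<alpha>' < \<rho>" "\<gamma> < q" "\<gamma>' < q"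
      and eq: "\<alpha> + r * \<beta> + \<rho> * (q - 1) + \<rho> * \<gamma> = \<alpha>' + r * \<beta>' + \<rho> * (q - 1) + \<rho> * \<gamma>'"
      for \<alpha> \<beta> \<gamma> \<alpha>' \<beta>' \<gamma>'
    proof -
    have "\<alpha> + \<rho> * (\<gamma> + q * \<beta>) = \<alpha>' + \<rho> * (\<gamma>' + q * \<beta>')" using eq by (simp add: rq algebra_simps)
    then have "(\<alpha> + \<rho> * (\<gamma> + q * \<beta>)) mod \<rho> = (\<alpha>' + \<rho> * (\<gamma>' + q * \<beta>')) mod \<rho>"
      "(\<alpha> + \<rho> * (\<gamma> + q * \<beta>)) div \<rho> = (\<alpha>' + \<rho> * (\<gamma>' + q * \<beta>')) div \<rho>" by simp_all
    then have 1: "\<alpha> = \<alpha>'" and 2: "\<gamma> + q * \<beta> = \<gamma>' + q * \<beta>'" using lt \<rho> by simp_all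
    from 2 have "(\<gamma> + q * \<beta>) mod q = (\<gamma>' + q * \<beta>') mod q" "(\<gamma> + q * \<beta>) div q = (\<gamma>' + q * \<beta>') div q" by simp_all
    then show ?thesis using 1 lt by simp
    qed
    note key = this
    show ?thesis
    proof (rule inj_onI)
      fix i i' assume i: "i \<in> J" "i' \<in> J" "D i = D i'"
      obtain \<alpha> \<beta> \<gamma> \<alpha>' \<beta>' \<gamma>' where ii: "i = (\<alpha>, \<beta>, \<gamma>)" "i' = (\<alpha>', \<beta>', \<gamma>')" by (cases i, cases i')
      show "i = i'" using i key[of \<alpha> \<alpha>' \<gamma> \<gamma>' \<beta> \<beta>'] unfolding ii J_def D_def by simp
    qed
  qed

  have D_le: "D i \<le> r * (m + 1)" if "i \<in> J" for i
  proof -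
    obtain \<alpha> \<beta> \<gamma> where i: "i = (\<alpha>, \<beta>, \<gamma>)" by (cases i)
    have lt: "\<alpha> < \<rho>" "\<beta> < m" "\<gamma> < q" using that by (auto simp: i J_def)
    have "\<alpha> + \<rho> * \<gamma> \<le> \<rho> * (\<gamma> + 1)" using lt by simp
    also have "\<dots> \<le> \<rho> * q" using lt by (intro mult_le_mono2) simp
    finally have 1: "\<alpha> + \<rho> * \<gamma> \<le> r" by (simp add: rq)
    have 2: "\<rho> * (q - 1) \<le> r" unfolding rq(1) by (intro mult_le_mono2) simp
    have "r * \<beta> \<le> r * (m - 1)" using lt by (intro mult_le_mono2) simp
    also have "\<dots> = r * m - r" by (simp add: right_diff_distrib')
    finally have "r * \<beta> + r \<le> r * m" using lt r0 by (metis Nat.le_diff_conv2 Suc_leI less_nat_zero_code mult.right_neutral mult_le_mono2 not_gr_zero One_nat_def)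
    then show ?thesis using 1 2 by (simp add: i D_def)
  qed

  have k_upol: "k i \<in> upol K (r * \<rho> + r + m)" if "i \<in> J" for i
  proof -
    obtain \<alpha> \<beta> \<gamma> where i: "i = (\<alpha>, \<beta>, \<gamma>)" by (cases i)
    have lt: "\<alpha> < \<rho>" "\<beta> < m" "\<gamma> < q" using that by (auto simp: i J_def)
    have "(\<lambda>x. c * x ^ \<rho> + (- e) * wt x) \<in> upol K (2 * \<rho>)"
      by (intro upol_add upol_cmult upol_exact_upol[OF wt_exact] upol_mono[OF upol_monom[OF c]]) auto
    then have "(\<lambda>x. c * x ^ \<rho> - wt x) \<in> upol K (2 * \<rho>)"
      by (rule upol_cong) (use wt_in in auto)
    then have *: "k i \<in> upol K ((r * \<alpha> + \<beta> + \<rho> * (q - 1 - \<gamma>)) + 2 * \<rho> * \<gamma>)"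
      unfolding i k_def prod.case by (intro upol_mult upol_monom upol_cmult_power e_in)
    have "\<rho> * (q - 1 - \<gamma>) + 2 * \<rho> * \<gamma> \<le> \<rho> * (2 * q)"
      using lt by (simp add: mult.assoc mult.left_commute[of 2] add_mult_distrib2[symmetric])
    moreover have "r * \<alpha> + r \<le> r * \<rho>" using lt by (metis Suc_leI mult_Suc_right add.commute mult_le_mono2)
    ultimately have "(r * \<alpha> + \<beta> + \<rho> * (q - 1 - \<gamma>)) + 2 * \<rho> * \<gamma> \<le> r * \<rho> + r + m"
      using lt by (simp add: rq)
    then show ?thesis using upol_mono[OF *] by blast
  qed

  have H_upol: "H E \<in> upol K (r * \<rho> + r + m)" if "E \<in> J \<rightarrow>\<^sub>E K" for E
    unfolding H_def using that r0 by (intro upol_sum upol_cmult k_upol power_in) auto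

  have GH: "G E x ^ r * x ^ (\<rho> * (q - 1)) = x ^ (r * (\<rho> * (q - 1))) * H E x"
    if E: "E \<in> J \<rightarrow>\<^sub>E K" and x: "x \<in> A" for E x
  proof -
    have xK: "x \<in> K" "x \<noteq> 0" using x by (auto simp: A_def)
    define h where "h = a * x + b * ivs x"
    define w where "w = (\<Sum>i<j. h ^ (q ^ i))"
    have hK: "h \<in> K" using xK ab by (simp add: h_def)
    have qpos: "q ^ i > 0" for i using q_ge by simp
    have wK: "w \<in> K" unfolding w_def using hK qpos by auto
    have cancel: "b * (x ^ M * ivs x ^ N) = b * x ^ (M - N)" if "N \<le> M" for M N
    proof -
      have "x ^ M * ivs x ^ N = x ^ (M - N) * (x * ivs x) ^ N"
        by (subst le_add_diff_inverse2[OF that, symmetric], subst power_add)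
          (simp only: power_mult_distrib mult.assoc diff_add_inverse2)
      also have "\<dots> = x ^ (M - N) * e ^ N" using xK by simp
      finally have "b * (x ^ M * ivs x ^ N) = (b * e ^ N) * x ^ (M - N)" by (simp only: mult_ac)
      moreover have "b * e ^ N = b" using ab by (cases "N = 0") auto
      ultimately show ?thesis by simp
    qed
    have wt: "wt x = x ^ \<rho> * w"
    proof -
      have "x ^ \<rho> * h ^ (q ^ i) = a * x ^ (\<rho> + q ^ i) + b * x ^ (\<rho> - q ^ i)" if "i < j" for i
      proof -
        have "h ^ (q ^ i) = a * x ^ q ^ i + b * ivs x ^ q ^ i"
          unfolding h_def using frob_pow[of "a * x" "b * ivs x" i] xK ab by (simp add: power_mult_distrib a_pow b_pow)
        then show ?thesis using cancel[OF qi[OF that]] by (simp add: algebra_simps power_add)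
      qed
      then show ?thesis unfolding wt_def w_def by (simp add: sum_distrib_left)
    qed
    \<comment> \<open>The \<open>r\<close>-th power shifts the range \<open>i < j\<close> to
      \<open>j \<le> i < 2 * j\<close>, so \<open>w + w ^ r\<close> is the complete sum, which
      equals \<open>c\<close>.\<close>
    have wr: "w ^ r = c - w"
    proof -
      have "w ^ r = (\<Sum>i<j. h ^ (q ^ (i + j)))" unfolding w_def r(1)
        using frob_pow_sum[of "{..<j}" "\<lambda>i. h ^ q ^ i" j] hK qpos by (simp add: power_mult[symmetric] power_add)
      also have "\<dots> = (\<Sum>i\<in>{j..<2 * j}. h ^ (q ^ i))"
        by (rule sum.reindex_bij_witness[of _ "\<lambda>i. i - j" "\<lambda>i. i + j"]) auto
      moreover have "(\<Sum>i<2 * j. h ^ (q ^ i)) = w + (\<Sum>i\<in>{j..<2 * j}. h ^ (q ^ i))"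
        unfolding w_def using sum.atLeastLessThan_concat[of 0 j "2 * j" "\<lambda>i. h ^ (q ^ i)"]
        by (simp add: atLeast0LessThan)
      moreover have "(\<Sum>i<2 * j. h ^ (q ^ i)) = c" using x by (simp add: A_def h_def)
      ultimately show ?thesis by (simp add: algebra_simps)
    qed
    have termwise: "g i x ^ r * x ^ (\<rho> * (q - 1)) = x ^ (r * (\<rho> * (q - 1))) * k i x" if "i \<in> J" for i
    proof -
      obtain \<alpha> \<beta> \<gamma> where i: "i = (\<alpha>, \<beta>, \<gamma>)" by (cases i)
      have lt: "\<gamma> < q" using that by (auto simp: i J_def)
      have xQ: "(x ^ (r * \<beta>)) ^ r = x ^ \<beta>"
      proof -
        have "(x ^ (r * \<beta>)) ^ r = (x ^ card K) ^ \<beta>"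
          by (simp add: card power_mult[symmetric] power2_eq_square mult_ac)
        then show ?thesis using power_card[OF fin xK(1)] by simp
      qed
      have er: "e ^ r = e" using r0 by simp
      define u where "u = q - 1 - \<gamma>"
      have u: "q - 1 = u + \<gamma>" using lt by (simp add: u_def)
      have ee: "e * e = e" by simp
      have "g i x ^ r = e * (x ^ (r * \<alpha>) * x ^ \<beta> * x ^ (r * (\<rho> * u)) * (x ^ (r * (\<rho> * \<gamma>)) * w ^ (r * \<gamma>)))"
      proof -
        have "g i x ^ r = (e ^ r * e ^ r) * ((x ^ \<alpha>) ^ r * (x ^ (r * \<beta>)) ^ r * (x ^ (\<rho> * u)) ^ r * ((x ^ \<rho> * w) ^ \<gamma>) ^ r)"
          by (simp add: i g_def wt u_def power_mult_distrib power_add mult_ac)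
        also have "((x ^ \<rho> * w) ^ \<gamma>) ^ r = x ^ (r * (\<rho> * \<gamma>)) * w ^ (r * \<gamma>)"
          by (simp add: power_mult_distrib power_mult[symmetric] mult_ac)
        finally show ?thesis by (simp only: er ee xQ) (simp add: power_mult[symmetric] mult_ac)
      qed
      moreover have "k i x = e * (x ^ (r * \<alpha>) * x ^ \<beta> * x ^ (\<rho> * u) * (x ^ (\<rho> * \<gamma>) * w ^ (r * \<gamma>)))"
      proof -
        have cw: "c * x ^ \<rho> - wt x = x ^ \<rho> * w ^ r" by (simp add: wt wr algebra_simps)
        have "k i x = (e * e) * (x ^ (r * \<alpha>) * x ^ \<beta> * x ^ (\<rho> * u) * (x ^ \<rho> * w ^ r) ^ \<gamma>)"
          unfolding i k_def prod.case u_def[symmetric] cw by (simp only: power_add mult_ac)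
        then show ?thesis unfolding ee by (simp add: power_mult_distrib power_mult[symmetric])
      qed
      ultimately show ?thesis unfolding u
        by (simp add: add_mult_distrib2 power_add mult_ac)
    qed
    have "G E x ^ r = (\<Sum>i\<in>J. (E i * g i x) ^ r)"
      unfolding G_def r(1) using E xK by (intro frob_pow_sum) (auto simp: g_in)
    then have "G E x ^ r * x ^ (\<rho> * (q - 1)) = (\<Sum>i\<in>J. E i ^ r * (g i x ^ r * x ^ (\<rho> * (q - 1))))"
      by (simp add: sum_distrib_right power_mult_distrib mult.assoc)
    also have "\<dots> = (\<Sum>i\<in>J. E i ^ r * (x ^ (r * (\<rho> * (q - 1))) * k i x))"
      using termwise by simp
    finally show ?thesis unfolding H_def by (simp add: sum_distrib_left mult.left_commute)
  qed

  have cardK: "card K > 1" using card r(2) by (simp add: power2_eq_square) (metis One_nat_def less_1_mult less_le_trans numeral_3_eq_3 Suc_lessI lessI zero_less_Suc Suc_less_eq2)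
  \<comment> \<open>Two coefficient families with the same \<open>H\<close> have equal
    \<open>G E ^ r\<close> and \<open>G E' ^ r\<close> at every counted point. Additivity of the
    \<open>r\<close>-th power turns this into a zero of \<open>G\<close> for the difference
    \<open>E - E'\<close>, which is not the zero family.\<close>
  have "\<not> inj_on (\<lambda>E. restrict (H E) K) (J \<rightarrow>\<^sub>E K)"
  proof
    assume inj: "inj_on (\<lambda>E. restrict (H E) K) (J \<rightarrow>\<^sub>E K)"
    have "card (J \<rightarrow>\<^sub>E K) \<le> card ((\<lambda>f. restrict f K) ` upol K (r * \<rho> + r + m))"
      using card_inj_on_le[OF inj, of "(\<lambda>f. restrict f K) ` upol K (r * \<rho> + r + m)"] H_upol upol_card[OF fin] by blast
    also have "\<dots> \<le> card K ^ Suc (r * \<rho> + r + m)" using upol_card[OF fin] by blast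
    finally have "card K ^ card J \<le> card K ^ Suc (r * \<rho> + r + m)" by (simp add: card_funcsetE[OF finJ])
    then have "card J \<le> Suc (r * \<rho> + r + m)" using cardK by (metis power_le_imp_le_exp)
    moreover have "card J = r * m" by (simp add: J_def rq mult_ac)
    ultimately show False using \<rho> r(2) by (simp add: m_def algebra_simps)
  qed
  then obtain E E' where E: "E \<in> J \<rightarrow>\<^sub>E K" "E' \<in> J \<rightarrow>\<^sub>E K" "E \<noteq> E'" "restrict (H E) K = restrict (H E') K"
    by (auto simp: inj_on_def)
  obtain i1 where i1: "i1 \<in> J" "E i1 - E' i1 \<noteq> 0" using E(1-3) by (metis PiE_ext right_minus_eq)
  have inK: "E i - E' i \<in> K" if "i \<in> J" for i using that E by auto
  obtain i0 where i0: "i0 \<in> J" "G (\<lambda>i. E i - E' i) \<in> upol_exact K (D i0)"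
    using upol_exact_lincomb[OF finJ, of "\<lambda>i. E i - E' i", OF inK D_inj g_exact i1(1) i1(2)] unfolding G_def by blast
  have "A \<subseteq> {x\<in>K. G (\<lambda>i. E i - E' i) x = 0}"
  proof
    fix x assume x: "x \<in> A"
    then have xK: "x \<in> K" "x \<noteq> 0" by (auto simp: A_def)
    have GE: "G E x \<in> K" "G E' x \<in> K" unfolding G_def using E g_in xK by (auto intro!: sum_in mult_in)
    have "H E x = H E' x" using E(4) xK by (metis restrict_apply')
    then have "x ^ (\<rho> * (q - 1)) * G E x ^ r = x ^ (\<rho> * (q - 1)) * G E' x ^ r"
      using GH[OF E(1) x] GH[OF E(2) x] by (simp add: mult.commute)
    moreover have "x ^ (\<rho> * (q - 1)) \<in> K" "x ^ (\<rho> * (q - 1)) \<noteq> 0"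
      using xK \<rho> q_ge power_eq_0[of x "\<rho> * (q - 1)"] by auto
    ultimately have "G E x ^ r = G E' x ^ r" using cancel_left GE r0 by (metis power_in)
    then have "(G E x - G E' x) ^ r = 0" using frob_pow_diff[OF GE, of j] by (simp add: r(1))
    then have "G E x - G E' x = 0" using power_eq_0[of "G E x - G E' x" r] GE r0 by blast
    moreover have "G (\<lambda>i. E i - E' i) x = G E x - G E' x"
      unfolding G_def by (simp add: sum_subtractf algebra_simps)
    ultimately show "x \<in> {x\<in>K. G (\<lambda>i. E i - E' i) x = 0}" using xK by simp
  qed
  then have "card A \<le> D i0" using upol_exact_roots[OF i0(2)] by (meson card_mono le_trans)
  also have "\<dots> \<le> r * (\<rho> + 5)" using D_le[OF i0(1)] by (simp add: m_def add.commute)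
  finally show ?thesis unfolding A_def rq(2) .
qed

end

section \<open>Kloosterman sums\<close>

lemma sum_over_fibres:
  fixes g :: "'b \<Rightarrow> complex"
  assumes "finite S" "finite B" "T ` S \<subseteq> B"
  shows "(\<Sum>s\<in>S. g (T s)) = (\<Sum>t\<in>B. of_nat (card {s\<in>S. T s = t}) * g t)"
proof -
  have "(\<Sum>t\<in>B. of_nat (card {s\<in>S. T s = t}) * g t) = (\<Sum>t\<in>B. \<Sum>s\<in>{s\<in>S. T s = t}. g (T s))"
    by (intro sum.cong) auto
  also have "\<dots> = (\<Sum>s\<in>S. g (T s))" by (rule sum.group[OF assms])
  finally show ?thesis ..
qed

locale additive_char = subfld +
  fixes \<psi> :: "'a \<Rightarrow> complex"
  assumes fin: "finite K"
    and char_add: "x \<in> K \<Longrightarrow> y \<in> K \<Longrightarrow> \<psi> (x + y) = \<psi> x * \<psi> y"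
    and char_norm: "x \<in> K \<Longrightarrow> norm (\<psi> x) = 1"
    and nontriv: "\<exists>x\<in>K. \<psi> x \<noteq> 1"
begin

lemma char_0 [simp]: "\<psi> 0 = 1"
  using char_add[of 0 0] char_norm[of 0] by auto

lemma char_sum: "(\<Sum>u\<in>K. \<psi> u) = 0"
proof -
  obtain a where a: "a \<in> K" "\<psi> a \<noteq> 1" using nontriv by blast
  have "(\<Sum>u\<in>K. \<psi> u) = (\<Sum>u\<in>K. \<psi> (a + u))"
    by (rule sum.reindex_bij_witness[of _ "\<lambda>u. a + u" "\<lambda>u. u - a"]) (use a in auto)
  also have "\<dots> = \<psi> a * (\<Sum>u\<in>K. \<psi> u)" using a by (simp add: char_add sum_distrib_left)
  finally show ?thesis using a by auto
qed

lemma char_orth: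
  assumes "c \<in> K"
  shows "(\<Sum>u\<in>K. \<psi> (u * c)) = (if c = 0 then of_nat (card K) else 0)"
proof (cases "c = 0")
  case False
  have "(\<Sum>u\<in>K. \<psi> (u * c)) = (\<Sum>u\<in>K. \<psi> u)"
    by (rule sum.reindex_bij_witness[of _ "\<lambda>u. u * ivs c" "\<lambda>u. u * c"])
      (use assms False in \<open>auto simp: mult.assoc\<close>)
  then show ?thesis using char_sum False by simp
qed auto

definition kloosterman :: "'a \<Rightarrow> 'a \<Rightarrow> complex" where
  "kloosterman a b = (\<Sum>x\<in>K - {0}. \<psi> (a * x + b * ivs x))"

end

section \<open>Towers of quadratic extensions\<close>

text \<open>The fields of the tower are the fixed sets of powers of Frobenius in one big field
  \<open>K\<close>. Only quadratic equations are ever solved, so square roots in \<open>K\<close>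
  are all the closure that is required of it.\<close>

locale tower = frob_subfld +
  assumes two: "e + e \<noteq> 0"
    and ex_sqrt: "x \<in> K \<Longrightarrow> \<exists>y\<in>K. y * y = x"
begin

definition fix_fld :: "nat \<Rightarrow> 'a set" where
  "fix_fld n = {z\<in>K. z ^ (q ^ n) = z}"

lemma qn_pos: "0 < q ^ n"
  using q_ge by simp

lemma zero_pow_qn [simp]: "0 ^ (q ^ n) = (0::'a)"
  by (simp only: zero_power qn_pos)

lemma e_pow_qn [simp]: "e ^ (q ^ n) = e"
  by (simp only: e_power qn_pos)

lemma pow_qn_in [simp]: "x \<in> K \<Longrightarrow> x ^ (q ^ n) \<in> K"
  by (simp only: power_in qn_pos)

lemma fix_fld_subset: "fix_fld n \<subseteq> K"
  by (auto simp: fix_fld_def)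

lemma frob_uminus: "x \<in> K \<Longrightarrow> (- x) ^ (q ^ n) = - (x ^ (q ^ n))"
  using frob_pow_diff[of 0 x n] by (simp add: zero_power)

lemma frob_ivs:
  assumes "x \<in> K" "x \<noteq> 0" shows "ivs x ^ (q ^ n) = ivs (x ^ (q ^ n))"
  by (rule ivs_unique) (use assms in \<open>auto simp: power_mult_distrib[symmetric]\<close>)

lemma ivs_in_fix_fld: "x \<in> fix_fld n \<Longrightarrow> x \<noteq> 0 \<Longrightarrow> ivs x \<in> fix_fld n"
  by (auto simp: fix_fld_def frob_ivs)

lemma subfld_fix: "subfld (fix_fld n) e"
proof
  fix x assume x: "x \<in> fix_fld n" "x \<noteq> 0"
  then have "x \<in> K" by (auto simp: fix_fld_def)
  then show "\<exists>y\<in>fix_fld n. x * y = e" using ivs_in_fix_fld[OF x] x by (intro bexI[of _ "ivs x"]) auto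
qed (auto simp: fix_fld_def zero_power frob_pow frob_uminus power_mult_distrib)

lemma frob_subfld_fix: "frob_subfld (fix_fld n) e q"
  by (intro frob_subfld.intro subfld_fix frob_subfld_axioms.intro)
    (use frob q_ge fix_fld_subset in auto)

lemma ivs_fix:
  assumes "x \<in> fix_fld n" "x \<noteq> 0" shows "subfld.ivs (fix_fld n) e x = ivs x"
proof -
  interpret F: subfld "fix_fld n" e by (rule subfld_fix)
  have "x \<in> K" using assms by (auto simp: fix_fld_def)
  then show ?thesis using F.ivs_unique[of x "ivs x"] ivs_in_fix_fld[OF assms] assms by auto
qed

text \<open>Both sets are made from the roots \<open>\<theta>\<close>, \<open>\<theta>'\<close> of
  \<open>X^2 - u X + v\<close>. If the root \<open>\<delta>\<close> of the discriminant lies in the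
  small field, so do \<open>\<theta>\<close> and \<open>\<theta>'\<close>: they give two ordered
  pairs and no \<open>z\<close>, or one of each when they coincide. Otherwise Frobenius changes the
  sign of \<open>\<delta>\<close> and swaps them, and they give two values of \<open>z\<close> and
  no pair.\<close>

lemma quadratic_count:
  assumes u: "u \<in> fix_fld n" and v: "v \<in> fix_fld n"
  defines "P \<equiv> {(x, y). x \<in> fix_fld n \<and> y \<in> fix_fld n \<and> x + y = u \<and> x * y = v}"
    and "Z \<equiv> {z \<in> fix_fld (2 * n). z + z ^ (q ^ n) = u \<and> z * z ^ (q ^ n) = v}"
  shows "finite P" "finite Z" "card P + card Z = 2"
proof -
  define h where "h = ivs (e + e)"
  have hK: "h \<in> K" unfolding h_def using two by (intro ivs_in add_in e_in)
  have eF: "e \<in> fix_fld n" by (simp add: fix_fld_def)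
  have eeF: "e + e \<in> fix_fld n" using eF subfld.add_in[OF subfld_fix] by blast
  have hF: "h \<in> fix_fld n" unfolding h_def using eeF two by (rule ivs_in_fix_fld)
  have hh: "h * x + h * x = x" if "x \<in> K" for x
  proof -
    have "h * x + h * x = h * (e * x + e * x)" using that by (simp add: algebra_simps)
    also have "\<dots> = (h * (e + e)) * x" by (simp add: algebra_simps)
    also have "h * (e + e) = e" unfolding h_def using two by (intro ivs_left add_in e_in)
    finally show ?thesis using that by simp
  qed
  have uK: "u \<in> K" "v \<in> K" using u v fix_fld_subset by auto
  then have "u * u - (v + v + v + v) \<in> K" by (intro minus_in mult_in add_in)
  then obtain \<delta> where \<delta>: "\<delta> \<in> K" "\<delta> * \<delta> = u * u - (v + v + v + v)" using ex_sqrt by blast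
  define \<theta> \<theta>' where "\<theta> = h * (u + \<delta>)" and "\<theta>' = h * (u - \<delta>)"
  have \<theta>K: "\<theta> \<in> K" "\<theta>' \<in> K" using hK uK \<delta> by (auto simp: \<theta>_def \<theta>'_def)
  have add: "\<theta> + \<theta>' = u" using hh[OF uK(1)] by (simp add: \<theta>_def \<theta>'_def algebra_simps)
  have mult: "\<theta> * \<theta>' = v"
  proof -
    have "\<theta> * \<theta>' = h * (h * (u * u - \<delta> * \<delta>))" by (simp add: \<theta>_def \<theta>'_def algebra_simps)
    also have "\<dots> = h * ((h * v + h * v) + (h * v + h * v))" by (simp add: \<delta>(2) algebra_simps)
    also have "\<dots> = v" unfolding hh[OF uK(2)] by (simp only: distrib_left hh[OF uK(2)])
    finally show ?thesis .
  qed
  have diff: "\<theta> - \<theta>' = \<delta>" using hh[OF \<delta>(1)] by (simp add: \<theta>_def \<theta>'_def algebra_simps)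
  have roots: "x = \<theta> \<and> y = \<theta>' \<or> x = \<theta>' \<and> y = \<theta>" if "x \<in> K" "y \<in> K" "x + y = u" "x * y = v" for x y
  proof -
    have "(x - \<theta>) * (x - \<theta>') = x * x - x * (\<theta> + \<theta>') + \<theta> * \<theta>'" by (simp add: algebra_simps)
    also have "\<dots> = x * x - x * (x + y) + x * y" unfolding add mult that(3,4) ..
    also have "\<dots> = 0" by (simp add: algebra_simps)
    finally have "x = \<theta> \<or> x = \<theta>'" using that \<theta>K by (simp add: prod_eq_0_iff)
    then show ?thesis using that(3) add by (auto simp: algebra_simps)
  qed
  have Psub: "P \<subseteq> {(\<theta>, \<theta>'), (\<theta>', \<theta>)}"
  proof
    fix s assume "s \<in> P"
    then obtain x y where s: "s = (x, y)" "x \<in> fix_fld n" "y \<in> fix_fld n" "x + y = u" "x * y = v"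
      unfolding P_def by blast
    then have "x \<in> K" "y \<in> K" using fix_fld_subset by blast+
    then show "s \<in> {(\<theta>, \<theta>'), (\<theta>', \<theta>)}" using roots[OF _ _ s(4,5)] s(1) by blast
  qed
  have Zsub: "Z \<subseteq> {\<theta>, \<theta>'}"
  proof
    fix z assume "z \<in> Z"
    then have z: "z \<in> K" "z + z ^ (q ^ n) = u" "z * z ^ (q ^ n) = v"
      unfolding Z_def using fix_fld_subset by blast+
    then show "z \<in> {\<theta>, \<theta>'}" using roots[OF z(1) pow_qn_in[OF z(1)] z(2,3)] by blast
  qed
  show "finite P" "finite Z" using Psub Zsub finite_subset by blast+
  have fixF: "x ^ (q ^ n) = x" if "x \<in> fix_fld n" for x using that by (auto simp: fix_fld_def)
  have sub2: "x \<in> fix_fld (2 * n)" if "x \<in> K" "(x ^ (q ^ n)) ^ (q ^ n) = x" for x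
    using that by (simp add: fix_fld_def mult_2 power_add power_mult)
  show "card P + card Z = 2"
  proof (cases "\<delta> \<in> fix_fld n")
    case True
    interpret F: subfld "fix_fld n" e by (rule subfld_fix)
    have \<theta>F: "\<theta> \<in> fix_fld n" "\<theta>' \<in> fix_fld n" using True hF u by (auto simp: \<theta>_def \<theta>'_def)
    show ?thesis
    proof (cases "\<delta> = 0")
      case True
      then have eq: "\<theta>' = \<theta>" using diff by simp
      have "P = {(\<theta>, \<theta>)}" using Psub \<theta>F add mult unfolding eq by (auto simp: P_def)
      moreover have "Z = {\<theta>}" using Zsub \<theta>F add mult sub2[OF \<theta>K(1)] unfolding eq by (auto simp: Z_def fixF)
      ultimately show ?thesis by simp
    next
      case False
      then have neq: "\<theta> \<noteq> \<theta>'" using diff by auto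
      have "(\<theta>, \<theta>') \<in> P" "(\<theta>', \<theta>) \<in> P"
        using \<theta>F add mult by (simp_all add: P_def add.commute mult.commute)
      then have "P = {(\<theta>, \<theta>'), (\<theta>', \<theta>)}" using Psub by blast
      moreover have "Z = {}"
      proof (rule ccontr)
        assume "Z \<noteq> {}"
        then obtain z where z: "z \<in> Z" by blast
        then have zF: "z \<in> fix_fld n" using Zsub \<theta>F by blast
        then have zz: "z + z = u" "z * z = v" using z fixF[OF zF] by (auto simp: Z_def)
        have "z \<in> K" using zF fix_fld_subset by auto
        then show False using roots[OF _ _ zz] neq by auto
      qed
      ultimately show ?thesis using neq by simp
    qed
  next
    case False
    then have neq: "\<theta> \<noteq> \<theta>'" using diff subfld.zero_in[OF subfld_fix] by auto
    have "(\<delta> ^ (q ^ n) - \<delta>) * (\<delta> ^ (q ^ n) + \<delta>) = (\<delta> * \<delta>) ^ (q ^ n) - \<delta> * \<delta>"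
      by (simp add: algebra_simps power_mult_distrib)
    also have "\<delta> * \<delta> \<in> fix_fld n" unfolding \<delta>(2)
      using u v subfld.minus_in[OF subfld_fix] subfld.add_in[OF subfld_fix] subfld.mult_in[OF subfld_fix] by metis
    then have "(\<delta> * \<delta>) ^ (q ^ n) - \<delta> * \<delta> = 0" by (simp add: fixF)
    finally have "\<delta> ^ (q ^ n) - \<delta> = 0 \<or> \<delta> ^ (q ^ n) + \<delta> = 0" using \<delta>(1) by simp
    then have \<sigma>\<delta>: "\<delta> ^ (q ^ n) = - \<delta>" using False \<delta>(1) by (auto simp: fix_fld_def eq_neg_iff_add_eq_0)
    have \<sigma>\<theta>: "\<theta> ^ (q ^ n) = \<theta>'" "\<theta>' ^ (q ^ n) = \<theta>"
      unfolding \<theta>_def \<theta>'_def using frob_pow[of u \<delta> n] frob_pow_diff[of u \<delta> n] uK \<delta>(1) fixF[OF u] fixF[OF hF]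
      by (simp_all add: power_mult_distrib \<sigma>\<delta>)
    have "Z = {\<theta>, \<theta>'}"
      using Zsub \<sigma>\<theta> sub2[OF \<theta>K(1)] sub2[OF \<theta>K(2)] add mult by (auto simp: Z_def algebra_simps)
    moreover have "P = {}"
    proof (rule ccontr)
      assume "P \<noteq> {}"
      then obtain x y where "(x, y) \<in> P" by auto
      then have "\<theta> \<in> fix_fld n" using Psub by (auto simp: P_def)
      then show False using \<sigma>\<theta> neq fixF by simp
    qed
    ultimately show ?thesis using neq by simp
  qed
qed

lemma trace_norm_in_fix_fld:
  assumes "z \<in> fix_fld (2 * n)"
  shows "z + z ^ (q ^ n) \<in> fix_fld n" "z * z ^ (q ^ n) \<in> fix_fld n" "z ^ (q ^ n) \<in> fix_fld (2 * n)"
    "(z ^ (q ^ n)) ^ (q ^ n) = z"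
proof -
  have z: "z \<in> K" and zz: "(z ^ (q ^ n)) ^ (q ^ n) = z"
    using assms by (auto simp: fix_fld_def mult_2 power_add power_mult)
  show "(z ^ (q ^ n)) ^ (q ^ n) = z" by (rule zz)
  show "z + z ^ (q ^ n) \<in> fix_fld n" "z * z ^ (q ^ n) \<in> fix_fld n"
    using z zz frob_pow[of z "z ^ (q ^ n)" n] pow_qn_in[OF z, of n]
    by (auto simp: fix_fld_def power_mult_distrib add.commute mult.commute)
  show "z ^ (q ^ n) \<in> fix_fld (2 * n)"
    using z zz by (simp add: fix_fld_def mult_2 power_add power_mult)
qed

text \<open>Sum \<open>quadratic_count\<close> over all \<open>(u, v)\<close>. Every pair of
  elements has one sum and product and every \<open>z\<close> one trace and norm, so the squared
  size of the small field plus the size of the large one is twice that square.\<close>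

lemma finite_card_fix_fld_double:
  assumes fin: "finite (fix_fld n)"
  shows "finite (fix_fld (2 * n)) \<and> card (fix_fld (2 * n)) = card (fix_fld n) ^ 2"
proof -
  define B where "B = fix_fld n \<times> fix_fld n"
  define P where "P = (\<lambda>(u, v). {(x, y). x \<in> fix_fld n \<and> y \<in> fix_fld n \<and> x + y = u \<and> x * y = v})"
  define Z where "Z = (\<lambda>(u, v). {z \<in> fix_fld (2 * n). z + z ^ (q ^ n) = u \<and> z * z ^ (q ^ n) = v})"
  have cnt: "finite (P t)" "finite (Z t)" "card (P t) + card (Z t) = 2" if "t \<in> B" for t
    using that quadratic_count unfolding B_def P_def Z_def by auto
  interpret F: subfld "fix_fld n" e by (rule subfld_fix)
  have finB: "finite B" using fin by (simp add: B_def)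
  have "s \<in> P (fst s + snd s, fst s * snd s)" "(fst s + snd s, fst s * snd s) \<in> B" if "s \<in> B" for s
    using that by (auto simp: B_def P_def)
  moreover have "P t \<subseteq> B" for t by (auto simp: B_def P_def)
  ultimately have PB: "(\<Union>t\<in>B. P t) = B" by blast
  have "z \<in> Z (z + z ^ (q ^ n), z * z ^ (q ^ n))" "(z + z ^ (q ^ n), z * z ^ (q ^ n)) \<in> B"
    if "z \<in> fix_fld (2 * n)" for z
    using that trace_norm_in_fix_fld[OF that] by (auto simp: B_def Z_def)
  moreover have "Z t \<subseteq> fix_fld (2 * n)" for t by (auto simp: Z_def)
  ultimately have ZB: "(\<Union>t\<in>B. Z t) = fix_fld (2 * n)" by blast
  have disj: "P t \<inter> P t' = {}" "Z t \<inter> Z t' = {}" if "t \<noteq> t'" for t t'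
    using that by (cases t; cases t'; auto simp: P_def Z_def)+
  have "card (\<Union>t\<in>B. P t) = (\<Sum>t\<in>B. card (P t))"
    by (rule card_UN_disjoint[OF finB]) (use cnt disj in blast)+
  moreover have "card (\<Union>t\<in>B. Z t) = (\<Sum>t\<in>B. card (Z t))"
    by (rule card_UN_disjoint[OF finB]) (use cnt disj in blast)+
  ultimately have "card B + card (fix_fld (2 * n)) = (\<Sum>t\<in>B. 2)"
    unfolding PB ZB using cnt by (simp add: sum.distrib[symmetric])
  then have "card (fix_fld (2 * n)) = card B" by simp
  moreover have "finite (fix_fld (2 * n))" unfolding ZB[symmetric] using finB cnt by blast
  ultimately show ?thesis by (simp add: B_def card_cartesian_product power2_eq_square)
qed

lemma additive_char_double:
  assumes "additive_char (fix_fld n) e \<psi>"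
  shows "additive_char (fix_fld (2 * n)) e (\<lambda>z. \<psi> (z + z ^ (q ^ n)))"
proof -
  interpret C: additive_char "fix_fld n" e \<psi> by fact
  show ?thesis
  proof (intro additive_char.intro subfld_fix additive_char_axioms.intro)
    show "finite (fix_fld (2 * n))" using finite_card_fix_fld_double C.fin by blast
    show "\<psi> (x + y + (x + y) ^ (q ^ n)) = \<psi> (x + x ^ (q ^ n)) * \<psi> (y + y ^ (q ^ n))"
      if "x \<in> fix_fld (2 * n)" "y \<in> fix_fld (2 * n)" for x y
    proof -
      have "x + y + (x + y) ^ (q ^ n) = (x + x ^ (q ^ n)) + (y + y ^ (q ^ n))"
        using that frob_pow[of x y n] by (simp add: fix_fld_def algebra_simps)
      then show ?thesis using C.char_add[OF trace_norm_in_fix_fld(1) trace_norm_in_fix_fld(1)] that by metis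
    qed
    show "norm (\<psi> (x + x ^ (q ^ n))) = 1" if "x \<in> fix_fld (2 * n)" for x
      using C.char_norm trace_norm_in_fix_fld(1) that by blast
    obtain a where a: "a \<in> fix_fld n" "\<psi> a \<noteq> 1" using C.nontriv by blast
    have "e + e \<in> fix_fld n" by (intro C.add_in C.e_in)
    \<comment> \<open>On the small field the relative trace is doubling, so half of \<open>a\<close>
      has trace \<open>a\<close>.\<close>
    define z where "z = a * ivs (e + e)"
    have z: "z \<in> fix_fld n" unfolding z_def
      using a ivs_in_fix_fld[OF \<open>e + e \<in> fix_fld n\<close> two] by auto
    have "z + z = e * z + e * z" using z fix_fld_subset e_left by (metis subsetD)
    also have "\<dots> = a * ((e + e) * ivs (e + e))" unfolding z_def by (simp only: distrib_left distrib_right mult_ac)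
    also have "\<dots> = a" unfolding ivs_right[OF add_in[OF e_in e_in] two] using a fix_fld_subset by (meson e_right subsetD)
    finally have "z + z ^ (q ^ n) = a" using z by (simp add: fix_fld_def)
    moreover have "z \<in> fix_fld (2 * n)" using z by (simp add: fix_fld_def mult_2 power_add power_mult)
    ultimately show "\<exists>x\<in>fix_fld (2 * n). \<psi> (x + x ^ (q ^ n)) \<noteq> 1" using a by blast
  qed
qed

text \<open>In \<open>u\<close> = sum or trace and \<open>v\<close> = product or norm, the square of
  the small sum and the large sum both have terms \<open>\<psi> (u * (a + b / v))\<close>. By
  \<open>quadratic_count\<close> each \<open>(u, v)\<close> occurs twice in total, and orthogonality
  in \<open>u\<close> leaves only \<open>v = - b / a\<close>.\<close>

lemma kloosterman_double:
  assumes "additive_char (fix_fld n) e \<psi>"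
    and a: "a \<in> fix_fld n" "a \<noteq> 0" and b: "b \<in> fix_fld n" "b \<noteq> 0"
  shows "additive_char.kloosterman (fix_fld (2 * n)) e (\<lambda>z. \<psi> (z + z ^ (q ^ n))) a b
    = 2 * of_nat (card (fix_fld n)) - (additive_char.kloosterman (fix_fld n) e \<psi> a b)\<^sup>2"
proof -
  interpret C: additive_char "fix_fld n" e \<psi> by fact
  interpret D: additive_char "fix_fld (2 * n)" e "\<lambda>z. \<psi> (z + z ^ (q ^ n))"
    by (rule additive_char_double) fact
  define B where "B = fix_fld n \<times> (fix_fld n - {0})"
  define g where "g = (\<lambda>(u, v). \<psi> (u * (a + b * ivs v)))"
  define S where "S = (fix_fld n - {0}) \<times> (fix_fld n - {0})"
  define T where "T = (\<lambda>(x::'a, y). (x + y, x * y))"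
  define S' where "S' = fix_fld (2 * n) - {0}"
  define T' where "T' = (\<lambda>z::'a. (z + z ^ (q ^ n), z * z ^ (q ^ n)))"
  have inK: "x \<in> K" if "x \<in> fix_fld m" for x m using that fix_fld_subset by auto
  have fin: "finite B" "finite S" "finite S'" using C.fin D.fin by (auto simp: B_def S_def S'_def)
  have ivs_add: "b * ivs x + b * ivs y = (x + y) * (b * ivs (x * y))"
    if "x \<in> K" "y \<in> K" "x \<noteq> 0" "y \<noteq> 0" for x y
  proof -
    have "ivs (x * y) = ivs x * ivs y"
    proof (rule ivs_unique[symmetric])
      have "x * y * (ivs x * ivs y) = (x * ivs x) * (y * ivs y)" by (simp only: mult_ac)
      then show "x * y * (ivs x * ivs y) = e" using that by simp
    qed (use that in auto)
    then have "(x + y) * (b * ivs (x * y)) = b * ((x * ivs x) * ivs y + (y * ivs y) * ivs x)"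
      by (simp add: algebra_simps)
    then show ?thesis using that by (simp add: algebra_simps)
  qed
  have "(C.kloosterman a b)\<^sup>2 = (\<Sum>s\<in>S. \<psi> (a * fst s + b * ivs (fst s)) * \<psi> (a * snd s + b * ivs (snd s)))"
  proof -
    have "C.kloosterman a b = (\<Sum>x\<in>fix_fld n - {0}. \<psi> (a * x + b * ivs x))"
      unfolding C.kloosterman_def by (intro sum.cong) (simp_all add: ivs_fix)
    then have "(C.kloosterman a b)\<^sup>2 = (\<Sum>x\<in>fix_fld n - {0}. \<Sum>y\<in>fix_fld n - {0}.
        \<psi> (a * x + b * ivs x) * \<psi> (a * y + b * ivs y))"
      by (simp only: power2_eq_square sum_product)
    then show ?thesis unfolding S_def sum.cartesian_product by (simp add: split_def)
  qed
  also have "\<dots> = (\<Sum>s\<in>S. g (T s))"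
  proof (rule sum.cong[OF refl])
    fix s assume "s \<in> S"
    then obtain x y where s: "s = (x, y)" and xy: "x \<in> fix_fld n" "y \<in> fix_fld n" "x \<noteq> 0" "y \<noteq> 0"
      by (auto simp: S_def)
    have "\<psi> (a * x + b * ivs x) * \<psi> (a * y + b * ivs y) = \<psi> ((a * x + b * ivs x) + (a * y + b * ivs y))"
      using xy a b ivs_in_fix_fld by (intro C.char_add[symmetric]) auto
    also have "(a * x + b * ivs x) + (a * y + b * ivs y) = (x + y) * (a + b * ivs (x * y))"
      using ivs_add[of x y] xy inK by (simp add: algebra_simps)
    finally show "\<psi> (a * fst s + b * ivs (fst s)) * \<psi> (a * snd s + b * ivs (snd s)) = g (T s)"
      by (simp add: s g_def T_def)
  qed
  also have "\<dots> = (\<Sum>t\<in>B. of_nat (card {s\<in>S. T s = t}) * g t)"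
    by (rule sum_over_fibres) (use fin in \<open>auto simp: S_def T_def B_def\<close>)
  finally have 1: "(C.kloosterman a b)\<^sup>2 = (\<Sum>t\<in>B. of_nat (card {s\<in>S. T s = t}) * g t)" .
  have "D.kloosterman a b = (\<Sum>s\<in>S'. g (T' s))"
    unfolding D.kloosterman_def S'_def
  proof (rule sum.cong[OF refl])
    fix z assume z: "z \<in> fix_fld (2 * n) - {0}"
    then have zK: "z \<in> K" "z \<noteq> 0" using inK by auto
    then have \<sigma>z: "z ^ (q ^ n) \<in> K" "z ^ (q ^ n) \<noteq> 0" using power_eq_0[OF _ _ qn_pos] pow_qn_in by blast+
    have "(a * z + b * ivs z) ^ (q ^ n) = a * z ^ (q ^ n) + b * ivs (z ^ (q ^ n))"
    proof -
      have "a ^ (q ^ n) = a" "b ^ (q ^ n) = b" "a * z \<in> K" "b * ivs z \<in> K"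
        using zK a(1) b(1) by (auto simp: fix_fld_def)
      then show ?thesis using frob_pow[of "a * z" "b * ivs z" n]
        by (simp only: power_mult_distrib frob_ivs[OF zK])
    qed
    then have "(a * z + b * ivs z) + (a * z + b * ivs z) ^ (q ^ n)
      = (z + z ^ (q ^ n)) * (a + b * ivs (z * z ^ (q ^ n)))"
      using ivs_add[OF zK(1) \<sigma>z(1) zK(2) \<sigma>z(2)] by (simp add: algebra_simps)
    then show "\<psi> (a * z + b * subfld.ivs (fix_fld (2 * n)) e z + (a * z + b * subfld.ivs (fix_fld (2 * n)) e z) ^ q ^ n)
      = g (T' z)"
      using z by (simp add: ivs_fix g_def T'_def)
  qed
  also have "\<dots> = (\<Sum>t\<in>B. of_nat (card {s\<in>S'. T' s = t}) * g t)"
  proof (rule sum_over_fibres[OF fin(3,1)])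
    show "T' ` S' \<subseteq> B"
    proof
      fix t assume "t \<in> T' ` S'"
      then obtain z where z: "z \<in> fix_fld (2 * n)" "z \<noteq> 0" "t = T' z" by (auto simp: S'_def)
      then have "z * z ^ (q ^ n) \<noteq> 0" 
        using power_eq_0[OF _ _ qn_pos, of z n] inK[of z] by (metis prod_eq_0_iff pow_qn_in)
      then show "t \<in> B" using trace_norm_in_fix_fld[OF z(1)] z(3) by (simp add: T'_def B_def)
    qed
  qed
  finally have 2: "D.kloosterman a b = (\<Sum>t\<in>B. of_nat (card {s\<in>S'. T' s = t}) * g t)" .
  have cnt: "card {s\<in>S. T s = t} + card {s\<in>S'. T' s = t} = 2" if tB: "t \<in> B" for t
  proof -
    obtain u v where t: "t = (u, v)" "u \<in> fix_fld n" "v \<in> fix_fld n" "v \<noteq> 0" using tB by (auto simp: B_def)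
    have "{s\<in>S. T s = t} = {(x, y). x \<in> fix_fld n \<and> y \<in> fix_fld n \<and> x + y = u \<and> x * y = v}"
      using t by (auto simp: S_def T_def)
    moreover have "{s\<in>S'. T' s = t} = {z \<in> fix_fld (2 * n). z + z ^ (q ^ n) = u \<and> z * z ^ (q ^ n) = v}"
      using t by (auto simp: S'_def T'_def)
    ultimately show ?thesis using quadratic_count(3)[OF t(2,3)] by simp
  qed
  have "D.kloosterman a b + (C.kloosterman a b)\<^sup>2
    = (\<Sum>t\<in>B. of_nat (card {s\<in>S. T s = t} + card {s\<in>S'. T' s = t}) * g t)"
    unfolding 1 2 by (simp add: sum.distrib[symmetric] algebra_simps)
  also have "\<dots> = (\<Sum>t\<in>B. 2 * g t)" using cnt by (intro sum.cong) auto
  also have "\<dots> = 2 * (\<Sum>v\<in>fix_fld n - {0}. \<Sum>u\<in>fix_fld n. \<psi> (u * (a + b * ivs v)))"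
    unfolding B_def g_def sum_distrib_left[symmetric]
    by (simp add: sum.cartesian_product[symmetric] sum.swap[of _ "fix_fld n - {0}"])
  also have "(\<Sum>v\<in>fix_fld n - {0}. \<Sum>u\<in>fix_fld n. \<psi> (u * (a + b * ivs v)))
    = (\<Sum>v\<in>fix_fld n - {0}. if v = - (b * ivs a) then of_nat (card (fix_fld n)) else 0)"
  proof (rule sum.cong[OF refl])
    fix v assume v: "v \<in> fix_fld n - {0}"
    have vK: "v \<in> K" "v \<noteq> 0" and abK: "a \<in> K" "b \<in> K" using v a b inK by auto
    have "a + b * ivs v = 0 \<longleftrightarrow> v = - (b * ivs a)"
    proof
      assume "a + b * ivs v = 0"
      then have "a * (v * ivs a) + b * (ivs v * v) * ivs a = 0" by (metis distrib_right mult.assoc mult.commute mult_zero_left)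
      then have "(a * ivs a) * v + b * ivs a = 0" using vK abK by (simp add: mult_ac)
      then show "v = - (b * ivs a)" using vK abK a by (simp add: eq_neg_iff_add_eq_0)
    next
      assume veq: "v = - (b * ivs a)"
      have "- (ivs b * a) = ivs v"
      proof (rule ivs_unique)
        have "v * - (ivs b * a) = (b * ivs b) * (a * ivs a)" by (simp add: veq mult_ac)
        then show "v * - (ivs b * a) = e" using abK a b by simp
      qed (use vK abK a b in auto)
      then have "a + b * ivs v = a - (b * ivs b) * a" by (simp add: algebra_simps flip: \<open>_ = ivs v\<close>)
      then show "a + b * ivs v = 0" using abK b by simp
    qed
    moreover have "a + b * ivs v \<in> fix_fld n" using v a b ivs_in_fix_fld by auto
    ultimately show "(\<Sum>u\<in>fix_fld n. \<psi> (u * (a + b * ivs v)))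
      = (if v = - (b * ivs a) then of_nat (card (fix_fld n)) else 0)"
      by (simp add: C.char_orth)
  qed
  also have "\<dots> = of_nat (card (fix_fld n))"
    using C.fin a b ivs_in_fix_fld inK by (simp add: sum.delta)
  finally show ?thesis by (simp add: algebra_simps)
qed


end

section \<open>Weil's bound from growth along the tower\<close>

locale char_tower = tower +
  fixes \<chi> :: "'a \<Rightarrow> complex"
  assumes char: "additive_char (fix_fld 1) e \<chi>"
    and card_fix: "card (fix_fld 1) = q"
begin

primrec tower_char :: "nat \<Rightarrow> 'a \<Rightarrow> complex" where
  "tower_char 0 = \<chi>"
| "tower_char (Suc j) = (\<lambda>z. tower_char j (z + z ^ (q ^ (2 ^ j))))"

lemma additive_char_tower: "additive_char (fix_fld (2 ^ j)) e (tower_char j)"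
proof (induct j)
  case 0
  show ?case using char by simp
next
  case (Suc j)
  show ?case using additive_char_double[OF Suc] by simp
qed

lemma card_tower: "card (fix_fld (2 ^ j)) = q ^ (2 ^ j)"
proof (induct j)
  case 0
  show ?case using card_fix by simp
next
  case (Suc j)
  have "finite (fix_fld (2 ^ j))" using additive_char.fin[OF additive_char_tower] .
  then show ?case using finite_card_fix_fld_double[of "2 ^ j"] Suc by (simp add: power_mult[symmetric] mult.commute)
qed

text \<open>Transitivity of the trace: it ties the recursively defined character to the sum over all
  conjugates, whose fibres \<open>stepanov\<close> counts.\<close>

lemma tower_char_trace:
  "z \<in> fix_fld (2 ^ j) \<Longrightarrow> (\<Sum>i<2 ^ j. z ^ (q ^ i)) \<in> fix_fld 1 \<and> tower_char j z = \<chi> (\<Sum>i<2 ^ j. z ^ (q ^ i))"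
proof (induct j arbitrary: z)
  case 0
  then show ?case by simp
next
  case (Suc j)
  define w where "w = z + z ^ (q ^ (2 ^ j))"
  have z: "z \<in> fix_fld (2 * 2 ^ j)" "z \<in> K" using Suc(2) fix_fld_subset by auto
  have w: "w \<in> fix_fld (2 ^ j)" unfolding w_def using trace_norm_in_fix_fld(1)[OF z(1)] .
  have "(\<Sum>i<2 ^ j. w ^ (q ^ i)) = (\<Sum>i<2 ^ j. z ^ (q ^ i)) + (\<Sum>i<2 ^ j. z ^ (q ^ (i + 2 ^ j)))"
  proof -
    have "w ^ (q ^ i) = z ^ (q ^ i) + z ^ (q ^ (i + 2 ^ j))" for i
      unfolding w_def using frob_pow[of z "z ^ (q ^ (2 ^ j))" i] z(2)
      by (simp add: power_mult[symmetric] power_add mult.commute)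
    then show ?thesis by (simp add: sum.distrib)
  qed
  also have "(\<Sum>i<2 ^ j. z ^ (q ^ (i + 2 ^ j))) = (\<Sum>i\<in>{2 ^ j..<2 ^ Suc j}. z ^ (q ^ i))"
    by (rule sum.reindex_bij_witness[of _ "\<lambda>i. i - 2 ^ j" "\<lambda>i. i + 2 ^ j"]) auto
  also have "(\<Sum>i<2 ^ j. z ^ (q ^ i)) + \<dots> = (\<Sum>i<2 ^ Suc j. z ^ (q ^ i))"
    using sum.atLeastLessThan_concat[of 0 "2 ^ j" "2 ^ Suc j" "\<lambda>i. z ^ (q ^ i)"] by (simp add: atLeast0LessThan)
  finally have "(\<Sum>i<2 ^ j. w ^ (q ^ i)) = (\<Sum>i<2 ^ Suc j. z ^ (q ^ i))" .
  then show ?case using Suc(1)[OF w] by (simp only: tower_char.simps w_def)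
qed

definition tower_kloosterman :: "'a \<Rightarrow> 'a \<Rightarrow> nat \<Rightarrow> complex" where
  "tower_kloosterman a b j = additive_char.kloosterman (fix_fld (2 ^ j)) e (tower_char j) a b"

lemma fix_fld_mono: "x \<in> fix_fld 1 \<Longrightarrow> x \<in> fix_fld n"
  by (induct n) (auto simp: fix_fld_def power_mult)

lemma tower_kloosterman_Suc:
  assumes "a \<in> fix_fld 1" "a \<noteq> 0" "b \<in> fix_fld 1" "b \<noteq> 0"
  shows "tower_kloosterman a b (Suc j) = 2 * of_nat (q ^ (2 ^ j)) - (tower_kloosterman a b j)\<^sup>2"
  using kloosterman_double[OF additive_char_tower, of a j b] fix_fld_mono assms
  by (simp add: tower_kloosterman_def card_tower)

text \<open>\<open>stepanov\<close> bounds each trace fibre \<open>N c\<close> only from above, by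
  \<open>M\<close>. That suffices: the sum of the character against the constant \<open>M\<close>
  vanishes, and the deficits \<open>M - N c\<close> are nonnegative, so the norm is at most their
  total. Since \<open>q * M = r^2 + 5 * q * r\<close> and there are \<open>r^2 - 1\<close> points,
  the total is \<open>5 * q * r + 1\<close>.\<close>

lemma tower_kloosterman_bound:
  assumes ab: "a \<in> fix_fld 1" "a \<noteq> 0" "b \<in> fix_fld 1"
    and r: "r = q ^ (2 ^ j)" "3 \<le> r"
  shows "norm (tower_kloosterman a b (Suc j)) \<le> 6 * real q * real r"
proof -
  define n :: nat where "n = 2 ^ Suc j"
  interpret C: additive_char "fix_fld n" e "tower_char (Suc j)"
    unfolding n_def by (rule additive_char_tower)
  interpret F: additive_char "fix_fld 1" e \<chi> by (rule char)
  interpret R: frob_subfld "fix_fld n" e q by (rule frob_subfld_fix)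
  define T where "T = (\<lambda>x. \<Sum>i<n. (a * x + b * C.ivs x) ^ (q ^ i))"
  define N where "N = (\<lambda>c. card {x\<in>fix_fld n - {0}. T x = c})"
  define M where "M = r * (r div q + 5)"
  have abn: "a \<in> fix_fld n" "b \<in> fix_fld n" using ab fix_fld_mono by auto
  have abq: "a ^ q = a" "b ^ q = b" using ab by (auto simp: fix_fld_def)
  have card: "card (fix_fld n) = r\<^sup>2"
    unfolding n_def card_tower r by (simp add: power_mult[symmetric] mult.commute)
  have NM: "N c \<le> M" if "c \<in> fix_fld 1" for c
    using R.stepanov[OF C.fin card r(1,2) abn(1) ab(2) abq(1) abn(2) abq(2), of c] fix_fld_mono[OF that, of n]
    unfolding N_def M_def T_def n_def by simp
  have z_in: "a * x + b * C.ivs x \<in> fix_fld n" if "x \<in> fix_fld n - {0}" for x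
    using that abn by auto
  have T_in: "T x \<in> fix_fld 1" if "x \<in> fix_fld n - {0}" for x
    unfolding T_def using tower_char_trace[of _ "Suc j"] z_in[OF that] unfolding n_def by blast
  have "tower_kloosterman a b (Suc j) = (\<Sum>x\<in>fix_fld n - {0}. \<chi> (T x))"
    unfolding tower_kloosterman_def n_def[symmetric] C.kloosterman_def
    using tower_char_trace[of _ "Suc j"] z_in by (intro sum.cong) (auto simp: T_def n_def simp del: tower_char.simps)
  also have "\<dots> = (\<Sum>c\<in>fix_fld 1. of_nat (N c) * \<chi> c)"
    unfolding N_def by (rule sum_over_fibres) (use C.fin F.fin T_in in auto)
  also have "\<dots> = - (\<Sum>c\<in>fix_fld 1. (of_nat M - of_nat (N c)) * \<chi> c)"
    using F.char_sum by (simp add: algebra_simps sum_subtractf sum_distrib_left[symmetric])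
  finally have "norm (tower_kloosterman a b (Suc j)) = norm (\<Sum>c\<in>fix_fld 1. (of_nat M - of_nat (N c)) * \<chi> c)"
    by (simp add: norm_minus_cancel)
  also have "\<dots> \<le> (\<Sum>c\<in>fix_fld 1. norm ((of_nat M - of_nat (N c)) * \<chi> c))" by (rule norm_sum)
  also have "\<dots> = (\<Sum>c\<in>fix_fld 1. real M - real (N c))"
  proof (rule sum.cong[OF refl])
    fix c assume c: "c \<in> fix_fld 1"
    have "(of_nat M - of_nat (N c) :: complex) = of_real (real M - real (N c))" by simp
    then have "norm (of_nat M - of_nat (N c) :: complex) = real M - real (N c)"
      using NM[OF c] by (simp only: norm_of_real)
    then show "norm ((of_nat M - of_nat (N c)) * \<chi> c) = real M - real (N c)"
      using F.char_norm[OF c] by (simp add: norm_mult)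
  qed
  also have "\<dots> = real q * real M - real (\<Sum>c\<in>fix_fld 1. N c)" using card_fix by (simp add: sum_subtractf)
  also have "(\<Sum>c\<in>fix_fld 1. N c) = card (fix_fld n - {0})"
  proof -
    have "card (\<Union>c\<in>fix_fld 1. {x\<in>fix_fld n - {0}. T x = c}) = (\<Sum>c\<in>fix_fld 1. N c)"
      unfolding N_def by (rule card_UN_disjoint) (use F.fin C.fin in auto)
    moreover have "(\<Union>c\<in>fix_fld 1. {x\<in>fix_fld n - {0}. T x = c}) = fix_fld n - {0}" using T_in by auto
    ultimately show ?thesis by simp
  qed
  also have "real q * real M - real (card (fix_fld n - {0})) \<le> 6 * real q * real r"
  proof -
    have "q * (r div q) = r" unfolding r(1) by (cases "2 ^ j :: nat") auto
    then have "q * M = r * r + 5 * (q * r)" unfolding M_def by (simp add: algebra_simps)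
    then have "real (q * M) = real (r * r + 5 * (q * r))" by simp
    moreover have "card (fix_fld n - {0}) = r * r - 1" using card C.fin by (simp add: power2_eq_square)
    then have "r * r \<le> card (fix_fld n - {0}) + 1" by simp
    then have "real (r * r) \<le> real (card (fix_fld n - {0}) + 1)" by (simp only: of_nat_le_iff)
    then have "real (card (fix_fld n - {0})) \<ge> real (r * r) - 1" by simp
    moreover have "real q * real r \<ge> 1" using q_ge r(2) by (metis le_trans mult_le_mono nat_mult_1 numeral_le_iff of_nat_1 of_nat_le_iff of_nat_mult one_le_numeral)
    ultimately show ?thesis by simp
  qed
  finally show ?thesis .
qed

text \<open>Divided by the square root of the field size, the norms satisfy
  \<open>\<rho> (j + 1) >= (\<rho> j)^2 - 2\<close>, and 2 is a fixed point of this recursion. A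
  start at \<open>2 + \<epsilon>\<close> forces growth at least linear in \<open>j\<close>, while
  \<open>stepanov\<close> bounds \<open>\<rho>\<close> by \<open>6 * q\<close> at every level from 2
  on. The recursion holds for \<open>b \<noteq> 0\<close>; for \<open>b = 0\<close> the sum is
  \<open>-1\<close>.\<close>

theorem kloosterman_bound:
  assumes ab: "a \<in> fix_fld 1" "a \<noteq> 0" "b \<in> fix_fld 1"
  shows "norm (additive_char.kloosterman (fix_fld 1) e \<chi> a b) \<le> 2 * sqrt (real q)"
proof (cases "b = 0")
  case True
  interpret F: additive_char "fix_fld 1" e \<chi> by (rule char)
  have "F.kloosterman a b = (\<Sum>x\<in>fix_fld 1. \<chi> (x * a)) - 1"
    unfolding F.kloosterman_def using True sum.remove[OF F.fin F.zero_in, of "\<lambda>x. \<chi> (x * a)"]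
    by (simp add: mult.commute)
  then have "norm (F.kloosterman a b) = 1" using F.char_orth[OF ab(1)] ab(2) by simp
  moreover have "sqrt (real q) \<ge> 1" using q_ge by simp
  ultimately show ?thesis by linarith
next
  case False
  define \<rho> where "\<rho> = (\<lambda>j. norm (tower_kloosterman a b j) / sqrt (real q ^ (2 ^ j)))"
  have q0: "real q > 0" using q_ge by simp
  have sq: "sqrt (real q ^ (2 ^ Suc j)) = real q ^ (2 ^ j)" for j
    using q0 by (simp add: power_mult mult.commute[of 2] real_sqrt_unique)
  have step: "\<rho> (Suc j) \<ge> (\<rho> j)\<^sup>2 - 2" for j
  proof -
    let ?k = "tower_kloosterman a b j"
    have "norm (tower_kloosterman a b (Suc j)) = norm (?k\<^sup>2 - 2 * of_nat (q ^ (2 ^ j)))"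
      unfolding tower_kloosterman_Suc[OF ab False] by (rule norm_minus_commute)
    also have "\<dots> \<ge> norm (?k\<^sup>2) - norm (2 * of_nat (q ^ (2 ^ j)) :: complex)" by (rule norm_triangle_ineq2)
    finally have "norm (tower_kloosterman a b (Suc j)) \<ge> (norm ?k)\<^sup>2 - 2 * real q ^ (2 ^ j)"
      by (simp add: norm_mult norm_power)
    then have "norm (tower_kloosterman a b (Suc j)) / real q ^ (2 ^ j) \<ge> ((norm ?k)\<^sup>2 - 2 * real q ^ (2 ^ j)) / real q ^ (2 ^ j)"
      using q0 by (intro divide_right_mono) auto
    then show ?thesis using q0 unfolding \<rho>_def sq by (simp add: power_divide diff_divide_distrib)
  qed
  have bound: "\<rho> (Suc j) \<le> 6 * real q" if "j \<ge> 1" for j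
  proof -
    have "3 \<le> (2::nat) ^ 2" by simp
    also have "\<dots> \<le> q ^ 2" using q_ge by (intro power_mono) auto
    also have "\<dots> \<le> q ^ (2 ^ j)" using q_ge that self_le_power[of "2::nat" j] by (intro power_increasing) auto
    finally show ?thesis
      using tower_kloosterman_bound[OF ab refl, of j] q0 unfolding \<rho>_def sq by (simp add: field_simps)
  qed
  show ?thesis
  proof (rule ccontr)
    assume "\<not> ?thesis"
    moreover have "tower_kloosterman a b 0 = additive_char.kloosterman (fix_fld 1) e \<chi> a b"
      by (simp add: tower_kloosterman_def)
    ultimately have "\<rho> 0 > 2" using q0 by (simp add: \<rho>_def field_simps)
    define \<epsilon> where "\<epsilon> = \<rho> 0 - 2"
    have \<epsilon>: "\<epsilon> > 0" using \<open>\<rho> 0 > 2\<close> by (simp add: \<epsilon>_def)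
    have grow: "\<rho> j \<ge> 2 + real j * \<epsilon>" for j
    proof (induct j)
      case (Suc j)
      define \<delta> where "\<delta> = real j * \<epsilon>"
      have "\<rho> (Suc j) \<ge> 2 + real (Suc j) * \<epsilon>"
      proof (cases "j = 0")
        case True
        have "(2 + \<epsilon>)\<^sup>2 = 4 + 4 * \<epsilon> + \<epsilon>\<^sup>2" by (simp add: power2_eq_square algebra_simps)
        moreover have "(\<rho> 0)\<^sup>2 = (2 + \<epsilon>)\<^sup>2" by (simp add: \<epsilon>_def)
        ultimately have "\<rho> (Suc 0) \<ge> 2 + \<epsilon>" using step[of 0] \<epsilon> zero_le_power2[of \<epsilon>] by linarith
        then show ?thesis using True by simp
      next
        case False
        have d: "\<delta> \<ge> \<epsilon>" unfolding \<delta>_def using False \<epsilon> by simp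
        have "(2 + \<delta>)\<^sup>2 \<le> (\<rho> j)\<^sup>2" using Suc d \<epsilon> by (intro power_mono) (auto simp: \<delta>_def)
        moreover have "(2 + \<delta>)\<^sup>2 = 4 + 4 * \<delta> + \<delta>\<^sup>2" by (simp add: power2_eq_square algebra_simps)
        ultimately have "\<rho> (Suc j) \<ge> 2 + 4 * \<delta>" using step[of j] zero_le_power2[of \<delta>] by linarith
        moreover have "real (Suc j) * \<epsilon> = \<delta> + \<epsilon>" by (simp add: \<delta>_def algebra_simps)
        ultimately show ?thesis using d \<epsilon> by (simp add: \<epsilon>_def)
      qed
      then show ?case .
    qed (use \<open>\<rho> 0 > 2\<close> in simp)
    obtain j :: nat where j: "real j * \<epsilon> > 6 * real q" using reals_Archimedean3[OF \<epsilon>] by blast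
    have "real j * \<epsilon> \<le> real (Suc (Suc j)) * \<epsilon>" using \<epsilon> by (intro mult_right_mono) auto
    then show False using grow[of "Suc (Suc j)"] bound[of "Suc j"] j by simp
  qed
qed

end

section \<open>Circles\<close>

text \<open>Weil's bound enters as the assumption \<open>kbound\<close>; the geometry of the plane
  is thereby independent of the tower.\<close>

locale char_plane = additive_char +
  assumes two: "e + e \<noteq> 0"
    and kbound: "a \<in> K \<Longrightarrow> a \<noteq> 0 \<Longrightarrow> b \<in> K \<Longrightarrow> norm (kloosterman a b) \<le> 2 * sqrt (real (card K))"
begin

abbreviation "q \<equiv> card K"

definition pl :: "('a \<times> 'a) set" where "pl = K \<times> K"

definition dt :: "'a \<times> 'a \<Rightarrow> 'a \<times> 'a \<Rightarrow> 'a" where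
  "dt m v = fst m * fst v + snd m * snd v"

definition nrm :: "'a \<times> 'a \<Rightarrow> 'a" where
  "nrm v = fst v * fst v + snd v * snd v"

definition circ :: "'a \<Rightarrow> ('a \<times> 'a) set" where
  "circ t = {v\<in>pl. nrm v = t}"

lemma q_pos: "0 < q"
  using fin zero_in by (metis card_gt_0_iff empty_iff)

lemma pl_simps [simp]:
  "0 \<in> pl" "x \<in> pl \<Longrightarrow> y \<in> pl \<Longrightarrow> x + y \<in> pl" "x \<in> pl \<Longrightarrow> y \<in> pl \<Longrightarrow> x - y \<in> pl" "x \<in> pl \<Longrightarrow> - x \<in> pl"
  by (auto simp: pl_def plus_prod_def minus_prod_def uminus_prod_def zero_prod_def)

lemma finite_pl [simp]: "finite pl" and card_pl: "card pl = q ^ 2"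
  using fin by (auto simp: pl_def card_cartesian_product power2_eq_square)

lemma dt_in [simp]: "m \<in> pl \<Longrightarrow> v \<in> pl \<Longrightarrow> dt m v \<in> K"
  by (auto simp: pl_def dt_def)

lemma nrm_in [simp]: "v \<in> pl \<Longrightarrow> nrm v \<in> K"
  by (auto simp: pl_def nrm_def)

lemma dt_linear: "dt m (v + w) = dt m v + dt m w" "dt m (v - w) = dt m v - dt m w" "dt m (- v) = - dt m v"
  "dt m 0 = 0" "dt 0 v = 0"
  by (auto simp: dt_def algebra_simps)

lemma dt_sum: "dt m (\<Sum>i\<in>A. f i) = (\<Sum>i\<in>A. dt m (f i))"
  by (induct A rule: infinite_finite_induct) (auto simp: dt_linear)

lemma dt_commute: "dt m v = dt v m"
  by (simp add: dt_def mult.commute)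

lemma char_neq_0 [simp]: "x \<in> K \<Longrightarrow> \<psi> x \<noteq> 0"
  using char_norm[of x] by auto

lemma char_uminus: "x \<in> K \<Longrightarrow> \<psi> (- x) = cnj (\<psi> x)"
proof -
  assume x: "x \<in> K"
  then have "\<psi> x * \<psi> (- x) = 1" using char_add[of x "- x"] by simp
  moreover have "\<psi> x * cnj (\<psi> x) = 1" using char_norm[OF x] by (simp add: complex_norm_square[symmetric])
  ultimately show ?thesis using char_neq_0[OF x] by (metis mult_left_cancel)
qed

lemma char_diff: "x \<in> K \<Longrightarrow> y \<in> K \<Longrightarrow> \<psi> (x - y) = \<psi> x * cnj (\<psi> y)"
  using char_add[of x "- y"] char_uminus[of y] by simp

lemma sum_pl: "(\<Sum>v\<in>pl. f v) = (\<Sum>x\<in>K. \<Sum>y\<in>K. f (x, y))"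
  by (simp add: pl_def sum.cartesian_product)

lemma pl_orth:
  assumes "m \<in> pl"
  shows "(\<Sum>v\<in>pl. \<psi> (dt m v)) = (if m = 0 then of_nat (q ^ 2) else 0)"
proof -
  obtain m1 m2 where m: "m = (m1, m2)" "m1 \<in> K" "m2 \<in> K" using assms by (auto simp: pl_def)
  have "(\<Sum>v\<in>pl. \<psi> (dt m v)) = (\<Sum>x\<in>K. \<Sum>y\<in>K. \<psi> (x * m1) * \<psi> (y * m2))"
    unfolding sum_pl using m by (intro sum.cong) (auto simp: dt_def char_add mult.commute)
  also have "\<dots> = (\<Sum>x\<in>K. \<psi> (x * m1)) * (\<Sum>y\<in>K. \<psi> (y * m2))" by (simp add: sum_product)
  finally show ?thesis using m by (auto simp: char_orth zero_prod_def power2_eq_square)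
qed

lemma pl_orth':
  assumes "v \<in> pl"
  shows "(\<Sum>m\<in>pl. \<psi> (dt m v)) = (if v = 0 then of_nat (q ^ 2) else 0)"
  using pl_orth[OF assms] by (simp add: dt_commute)

lemma ex_half: "\<exists>h\<in>K. \<forall>x\<in>K. h * x + h * x = x"
proof -
  have "ivs (e + e) * x + ivs (e + e) * x = x" if "x \<in> K" for x
  proof -
    have "ivs (e + e) * x + ivs (e + e) * x = ivs (e + e) * (e * x + e * x)" using that by (simp add: distrib_left)
    also have "\<dots> = (ivs (e + e) * (e + e)) * x" by (simp only: distrib_left distrib_right mult_ac)
    also have "ivs (e + e) * (e + e) = e" using two by (intro ivs_left add_in e_in)
    finally show ?thesis using that by simp
  qed
  moreover have "ivs (e + e) \<in> K" using two by (intro ivs_in add_in e_in)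
  ultimately show ?thesis by blast
qed

text \<open>At least \<open>(q + 1) / 2\<close> elements are squares, so the squares and the set of
  \<open>c\<close> minus squares cannot be disjoint.\<close>

lemma ex_circ:
  assumes "c \<in> K"
  shows "circ c \<noteq> {}"
proof -
  define A where "A = (\<lambda>x. x * x) ` K"
  define B where "B = (\<lambda>a. c - a) ` A"
  have AK: "A \<subseteq> K" and BK: "B \<subseteq> K" using assms by (auto simp: A_def B_def)
  have finA: "finite A" using fin by (simp add: A_def)
  have "0 \<in> A" by (auto simp: A_def intro!: image_eqI[of _ _ 0])
  have fib: "card {x\<in>K. x * x = s} \<le> 2" for s
  proof (cases "\<exists>y\<in>K. y * y = s")
    case True
    then obtain y where y: "y \<in> K" "y * y = s" by blast
    have "{x\<in>K. x * x = s} \<subseteq> {y, - y}"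
    proof
      fix x assume x: "x \<in> {x\<in>K. x * x = s}"
      have "(x - y) * (x + y) = x * x - y * y" by (simp add: algebra_simps)
      then have "(x - y) * (x + y) = 0" using x y by simp
      then have "x - y = 0 \<or> x + y = 0" using x y by simp
      then show "x \<in> {y, - y}" by (auto simp: eq_neg_iff_add_eq_0)
    qed
    then have "card {x\<in>K. x * x = s} \<le> card {y, - y}" by (intro card_mono) auto
    then show ?thesis using card_insert_le_m1[of 2 "{- y}" y] by simp
  next
    case False
    then have "{x\<in>K. x * x = s} = {}" by auto
    then show ?thesis by (metis card.empty le0)
  qed
  have "card K = card (\<Union>s\<in>A. {x\<in>K. x * x = s})" by (rule arg_cong[of _ _ card]) (auto simp: A_def)
  also have "\<dots> = (\<Sum>s\<in>A. card {x\<in>K. x * x = s})"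
    by (rule card_UN_disjoint) (use fin finA in auto)
  also have "\<dots> = card {x\<in>K. x * x = 0} + (\<Sum>s\<in>A - {0}. card {x\<in>K. x * x = s})"
    using finA \<open>0 \<in> A\<close> by (rule sum.remove)
  also have "{x\<in>K. x * x = 0} = {0}" by auto
  also have "(\<Sum>s\<in>A - {0}. card {x\<in>K. x * x = s}) \<le> (\<Sum>s\<in>A - {0}. 2)" using fib by (intro sum_mono) auto
  also have "\<dots> = 2 * (card A - 1)" using finA \<open>0 \<in> A\<close> by simp
  finally have "card K \<le> 1 + 2 * (card A - 1)" by simp
  moreover have "card A > 0" using finA \<open>0 \<in> A\<close> by (auto simp: card_gt_0_iff)
  ultimately have "2 * card A \<ge> card K + 1" by simp
  moreover have "card B = card A" unfolding B_def by (rule card_image) (auto simp: inj_on_def)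
  moreover have "card A + card B = card (A \<union> B)" if "A \<inter> B = {}"
    using that finA by (simp add: card_Un_disjoint B_def)
  moreover have "card (A \<union> B) \<le> card K" using AK BK fin by (intro card_mono) auto
  ultimately have "A \<inter> B \<noteq> {}" by force
  then obtain x y where "x \<in> K" "y \<in> K" "x * x = c - y * y" by (auto simp: A_def B_def)
  then have "(x, y) \<in> circ c" by (simp add: circ_def pl_def nrm_def)
  then show ?thesis by blast
qed

text \<open>Multiplication by \<open>a + b i\<close> of norm \<open>c / d\<close>, written out in
  coordinates, maps one circle injectively into the other.\<close>

lemma card_circ_le:
  assumes "c \<in> K" "c \<noteq> 0" "d \<in> K" "d \<noteq> 0"
  shows "card (circ d) \<le> card (circ c)"
proof -
  obtain a b where ab: "a \<in> K" "b \<in> K" "a * a + b * b = c * ivs d"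
    using ex_circ[of "c * ivs d"] assms by (auto simp: circ_def pl_def nrm_def)
  define f where "f = (\<lambda>v. (a * fst v - b * snd v, a * snd v + b * fst v))"
  have cd: "c * ivs d \<in> K" "c * ivs d \<noteq> 0" using assms by auto
  have nf: "nrm (f v) = (c * ivs d) * nrm v" for v
    unfolding ab(3)[symmetric] f_def nrm_def by (simp add: algebra_simps)
  have "inj_on f (circ d)"
  proof (rule inj_onI)
    fix v w assume v: "v \<in> circ d" "w \<in> circ d" "f v = f w"
    then have vK: "fst v \<in> K" "snd v \<in> K" "fst w \<in> K" "snd w \<in> K" by (auto simp: circ_def pl_def)
    have 1: "a * fst v - b * snd v = a * fst w - b * snd w" "a * snd v + b * fst v = a * snd w + b * fst w"
      using v(3) by (auto simp: f_def)
    have "(a * a + b * b) * (fst v) = a * (a * fst v - b * snd v) + b * (a * snd v + b * fst v)" by (simp add: algebra_simps)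
    also have "\<dots> = (a * a + b * b) * (fst w)" unfolding 1 by (simp add: algebra_simps)
    finally have f1: "(c * ivs d) * fst v = (c * ivs d) * fst w" unfolding ab(3) .
    have "(a * a + b * b) * (snd v) = a * (a * snd v + b * fst v) - b * (a * fst v - b * snd v)" by (simp add: algebra_simps)
    also have "\<dots> = (a * a + b * b) * (snd w)" unfolding 1 by (simp add: algebra_simps)
    finally have f2: "(c * ivs d) * snd v = (c * ivs d) * snd w" unfolding ab(3) .
    show "v = w" using f1 f2 cancel_left[OF cd(1) vK(1,3) cd(2)] cancel_left[OF cd(1) vK(2,4) cd(2)]
      by (simp add: prod_eq_iff)
  qed
  moreover have "f ` circ d \<subseteq> circ c"
  proof
    fix w assume "w \<in> f ` circ d"
    then obtain v where v: "v \<in> pl" "nrm v = d" "w = f v" by (auto simp: circ_def)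
    have "nrm w = c * (ivs d * d)" using nf[of v] v by (simp add: mult.assoc)
    then show "w \<in> circ c" using v ab assms by (auto simp: circ_def pl_def f_def)
  qed
  ultimately show ?thesis by (rule card_inj_on_le) (simp add: circ_def)
qed

text \<open>In the squared norm, \<open>nrm v - nrm w\<close> is the product
  \<open>dt (v - w) (v + w)\<close>. As 2 is invertible, \<open>v - w\<close> and
  \<open>v + w\<close> are free coordinates, and orthogonality applies.\<close>

lemma gauss_sum_sq:
  assumes s: "s \<in> K" "s \<noteq> 0"
  shows "norm (\<Sum>v\<in>pl. \<psi> (s * nrm v)) = real q"
proof -
  let ?G = "\<Sum>v\<in>pl. \<psi> (s * nrm v)"
  obtain h where h: "h \<in> K" "\<forall>x\<in>K. h * x + h * x = x" using ex_half by blast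
  define hh where "hh = (\<lambda>v::'a \<times> 'a. (h * fst v, h * snd v))"
  have hh: "hh v \<in> pl" "hh v + hh v = v" if "v \<in> pl" for v
    using that h(1) h(2)[rule_format, of "fst v"] h(2)[rule_format, of "snd v"]
    by (simp_all add: hh_def pl_def mem_Times_iff prod_eq_iff mult.commute)
  have hh_add: "hh (v + w) = hh v + hh w" "hh (v - w) = hh v - hh w" for v w
    by (auto simp: hh_def algebra_simps)
  have "complex_of_real ((norm ?G)\<^sup>2) = ?G * cnj ?G" by (rule complex_norm_square)
  also have "\<dots> = (\<Sum>v\<in>pl. \<Sum>w\<in>pl. \<psi> (s * nrm v) * cnj (\<psi> (s * nrm w)))"
    unfolding cnj_sum sum_product ..
  also have "\<dots> = (\<Sum>(v, w)\<in>pl \<times> pl. \<psi> (s * dt (v - w) (v + w)))"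
    unfolding sum.cartesian_product
  proof (rule sum.cong[OF refl], safe)
    fix v w :: "'a \<times> 'a" assume "v \<in> pl" "w \<in> pl"
    then have "\<psi> (s * nrm v) * cnj (\<psi> (s * nrm w)) = \<psi> (s * nrm v - s * nrm w)"
      using s by (subst char_diff) auto
    also have "s * nrm v - s * nrm w = s * dt (v - w) (v + w)" by (simp add: nrm_def dt_def algebra_simps)
    finally show "\<psi> (s * nrm v) * cnj (\<psi> (s * nrm w)) = \<psi> (s * dt (v - w) (v + w))" .
  qed
  also have "\<dots> = (\<Sum>(a, b)\<in>pl \<times> pl. \<psi> (s * dt a b))"
  proof (rule sum.reindex_bij_witness[of _ "\<lambda>(a, b). (hh (b + a), hh (b - a))" "\<lambda>(v, w). (v - w, v + w)"]; clarify)
    fix v w assume vw: "v \<in> pl" "w \<in> pl"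
    show "hh (v + w + (v - w)) = v \<and> hh (v + w - (v - w)) = w"
    proof
      have "hh (v + w + (v - w)) = hh v + hh v" by (simp add: hh_add)
      then show "hh (v + w + (v - w)) = v" using hh vw by simp
      have "hh (v + w - (v - w)) = hh w + hh w" by (simp add: hh_add)
      then show "hh (v + w - (v - w)) = w" using hh vw by simp
    qed
    show "v - w \<in> pl \<and> v + w \<in> pl" using vw by simp
  next
    fix a b assume ab: "a \<in> pl" "b \<in> pl"
    have "hh (b + a) - hh (b - a) = hh a + hh a" "hh (b + a) + hh (b - a) = hh b + hh b" by (auto simp: hh_add)
    then show "hh (b + a) - hh (b - a) = a \<and> hh (b + a) + hh (b - a) = b" using hh ab by simp
    show "hh (b + a) \<in> pl \<and> hh (b - a) \<in> pl" using hh ab by simp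
  qed
  also have "\<dots> = (\<Sum>a\<in>pl. \<Sum>b\<in>pl. \<psi> (dt (s * fst a, s * snd a) b))"
    unfolding sum.cartesian_product by (intro sum.cong) (auto simp: dt_def algebra_simps)
  also have "\<dots> = (\<Sum>a\<in>pl. if a = 0 then of_nat (q ^ 2) else 0)"
  proof (rule sum.cong[OF refl])
    fix a assume a: "a \<in> pl"
    then have "(s * fst a, s * snd a) \<in> pl" "(s * fst a, s * snd a) = 0 \<longleftrightarrow> a = 0"
      using s by (auto simp: pl_def zero_prod_def)
    then show "(\<Sum>b\<in>pl. \<psi> (dt (s * fst a, s * snd a) b)) = (if a = 0 then of_nat (q ^ 2) else 0)"
      using pl_orth[of "(s * fst a, s * snd a)"] by simp
  qed
  also have "\<dots> = complex_of_real ((real q)\<^sup>2)" by simp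
  finally have "(norm ?G)\<^sup>2 = (real q)\<^sup>2" using of_real_eq_iff by blast
  then show ?thesis by simp
qed

text \<open>All circles of nonzero radius have the same size, so the sum does not depend on
  \<open>s\<close>. This allows it to be taken out of the sum over \<open>s\<close> in
  \<open>circle_decay\<close>.\<close>

lemma gauss_sum_sq_eq:
  assumes s: "s \<in> K" "s \<noteq> 0"
  shows "(\<Sum>v\<in>pl. \<psi> (s * nrm v)) = of_real (real (card (circ 0)) - real (card (circ e)))"
proof -
  have const: "card (circ c) = card (circ e)" if "c \<in> K" "c \<noteq> 0" for c
    using card_circ_le[OF that e_in e_neq_0] card_circ_le[OF e_in e_neq_0 that] by simp
  have "(\<Sum>v\<in>pl. \<psi> (s * nrm v)) = (\<Sum>c\<in>K. of_nat (card {v\<in>pl. nrm v = c}) * \<psi> (s * c))"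
    by (rule sum_over_fibres[of pl K nrm "\<lambda>c. \<psi> (s * c)"]) (use fin in auto)
  also have "\<dots> = of_nat (card (circ 0)) + (\<Sum>c\<in>K - {0}. of_nat (card (circ c)) * \<psi> (s * c))"
    unfolding circ_def[symmetric]
    using sum.remove[OF fin zero_in, of "\<lambda>c. of_nat (card (circ c)) * \<psi> (s * c)"]
    by (simp only: mult_zero_right char_0 mult_1_right)
  also have "(\<Sum>c\<in>K - {0}. of_nat (card (circ c)) * \<psi> (s * c)) = of_nat (card (circ e)) * (\<Sum>c\<in>K - {0}. \<psi> (c * s))"
    unfolding sum_distrib_left
  proof (rule sum.cong[OF refl])
    fix c assume "c \<in> K - {0}"
    then have "card (circ c) = card (circ e)" using const by blast
    then show "of_nat (card (circ c)) * \<psi> (s * c) = of_nat (card (circ e)) * \<psi> (c * s)"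
      by (simp only: mult.commute[of s])
  qed
  also have "(\<Sum>c\<in>K - {0}. \<psi> (c * s)) = - 1"
    using sum.remove[OF fin zero_in, of "\<lambda>c. \<psi> (c * s)"] char_orth[OF s(1)] s(2) by (simp add: eq_neg_iff_add_eq_0 add.commute)
  finally show ?thesis by simp
qed

text \<open>The sizes of \<open>circ 0\<close> and \<open>circ t\<close> differ by exactly
  \<open>q\<close>, the modulus of the Gauss sum, and all circles together have \<open>q^2\<close>
  points. Hence \<open>q^2\<close> is at most \<open>q * (card (circ t) + 1)\<close>.\<close>

lemma card_circ_ge:
  assumes t: "t \<in> K" "t \<noteq> 0"
  shows "real q - 1 \<le> real (card (circ t))"
proof -
  have const: "card (circ c) = card (circ t)" if "c \<in> K" "c \<noteq> 0" for c
    using card_circ_le[OF that t] card_circ_le[OF t that] by simp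
  have "q ^ 2 = card (\<Union>c\<in>K. circ c)" unfolding card_pl[symmetric]
    by (rule arg_cong[of _ _ card]) (auto simp: circ_def)
  also have "\<dots> = (\<Sum>c\<in>K. card (circ c))"
    by (rule card_UN_disjoint) (use fin in \<open>auto simp: circ_def\<close>)
  also have "\<dots> = card (circ 0) + (\<Sum>c\<in>K - {0}. card (circ c))" using sum.remove[OF fin zero_in] by blast
  also have "(\<Sum>c\<in>K - {0}. card (circ c)) = (q - 1) * card (circ t)" using const fin by simp
  finally have "real (q ^ 2) = real (card (circ 0) + (q - 1) * card (circ t))" by simp
  then have 1: "(real q)\<^sup>2 = real (card (circ 0)) + (real q - 1) * real (card (circ t))"
    using q_pos by (simp add: of_nat_diff)
  have "norm (complex_of_real (real (card (circ 0)) - real (card (circ e)))) = real q"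
    using gauss_sum_sq[OF e_in e_neq_0] gauss_sum_sq_eq[OF e_in e_neq_0] by simp
  then have "\<bar>real (card (circ 0)) - real (card (circ t))\<bar> = real q"
    using const[OF e_in e_neq_0] by (simp only: norm_of_real)
  then have "real (card (circ 0)) \<le> real (card (circ t)) + real q" by linarith
  then have "(real q)\<^sup>2 \<le> real q * (real (card (circ t)) + 1)" using 1 by (simp add: algebra_simps)
  then have "real q * real q \<le> real q * (real (card (circ t)) + 1)" by (simp add: power2_eq_square)
  then have "real q \<le> real (card (circ t)) + 1" using q_pos by (simp add: mult_le_cancel_left)
  then show ?thesis by simp
qed

text \<open>The equation \<open>nrm v = t\<close> is detected by a sum over \<open>s\<close>, and
  completing the square in \<open>v\<close> splits off the Gauss sum of modulus \<open>q\<close>.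
  What remains is the Kloosterman sum with parameters \<open>- t\<close> and
  \<open>- nrm m / 4\<close>; \<open>h\<close> is one half.\<close>

lemma circle_decay:
  assumes t: "t \<in> K" "t \<noteq> 0" and m: "m \<in> pl" "m \<noteq> 0"
  shows "norm (\<Sum>v\<in>circ t. \<psi> (dt m v)) \<le> 2 * sqrt (real q)"
proof -
  let ?S = "\<Sum>v\<in>circ t. \<psi> (dt m v)"
  define \<Gamma> where "\<Gamma> = complex_of_real (real (card (circ 0)) - real (card (circ e)))"
  obtain h where h: "h \<in> K" "\<forall>x\<in>K. h * x + h * x = x" using ex_half by blast
  have hx: "h * x + h * x = x" if "x \<in> K" for x using h that by blast
  have norm\<Gamma>: "norm \<Gamma> = real q"
    using gauss_sum_sq[OF e_in e_neq_0] gauss_sum_sq_eq[OF e_in e_neq_0] by (simp add: \<Gamma>_def)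
  have K2: "x + y \<in> K" "x - y \<in> K" "x * y \<in> K" if "x \<in> K" "y \<in> K" for x y using that by auto
  have "of_nat q * ?S = (\<Sum>v\<in>pl. (\<Sum>s\<in>K. \<psi> (s * (nrm v - t))) * \<psi> (dt m v))"
  proof -
    have "(\<Sum>v\<in>pl. (\<Sum>s\<in>K. \<psi> (s * (nrm v - t))) * \<psi> (dt m v)) = (\<Sum>v\<in>pl. if nrm v = t then of_nat q * \<psi> (dt m v) else 0)"
      by (intro sum.cong) (auto simp: char_orth t)
    also have "\<dots> = (\<Sum>v\<in>circ t. of_nat q * \<psi> (dt m v))"
      unfolding circ_def by (rule sum.inter_filter[symmetric]) simp
    finally show ?thesis by (simp add: sum_distrib_left)
  qed
  also have "\<dots> = (\<Sum>s\<in>K. \<Sum>v\<in>pl. \<psi> (s * (nrm v - t)) * \<psi> (dt m v))"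
    unfolding sum_distrib_right by (rule sum.swap)
  also have "\<dots> = (\<Sum>s\<in>K - {0}. \<Sum>v\<in>pl. \<psi> (s * (nrm v - t)) * \<psi> (dt m v))"
    using sum.remove[OF fin zero_in, of "\<lambda>s. \<Sum>v\<in>pl. \<psi> (s * (nrm v - t)) * \<psi> (dt m v)"] pl_orth[OF m(1)] m(2) by simp
  also have "\<dots> = (\<Sum>s\<in>K - {0}. \<psi> ((- t) * s + (- (h * h * nrm m)) * ivs s) * \<Gamma>)"
  proof (rule sum.cong[OF refl])
    fix s assume s: "s \<in> K - {0}"
    \<comment> \<open>The centre \<open>m / (2 s)\<close> of the completed square
      \<open>s * nrm (v + w)\<close>.\<close>
    define w where "w = (h * fst m * ivs s, h * snd m * ivs s)"
    have w: "w \<in> pl" using s h m by (auto simp: w_def pl_def)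
    have sw: "s * fst w + s * fst w = fst m" "s * snd w + s * snd w = snd m"
    proof -
      have *: "s * (h * x * ivs s) + s * (h * x * ivs s) = x" if "x \<in> K" for x
      proof -
        have "s * (h * x * ivs s) + s * (h * x * ivs s) = (s * ivs s) * (h * x + h * x)" by (simp only: mult_ac distrib_left)
        then show ?thesis using hx that s by simp
      qed
      show "s * fst w + s * fst w = fst m" "s * snd w + s * snd w = snd m"
        using *[of "fst m"] *[of "snd m"] m(1) by (simp_all only: w_def pl_def mem_Times_iff fst_conv snd_conv)
    qed
    have nw: "s * nrm w = h * h * nrm m * ivs s"
    proof -
      have "s * nrm w = (s * ivs s) * (h * h * nrm m * ivs s)" by (simp add: w_def nrm_def algebra_simps)
      then show ?thesis using s h m by (simp add: K2)
    qed
    have dm: "dt m v = s * dt w v + s * dt w v" for v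
      unfolding dt_def sw[symmetric] by (simp add: algebra_simps)
    have nadd: "s * nrm (v + w) = s * nrm v + (s * dt w v + s * dt w v) + s * nrm w" for v
      by (simp add: nrm_def dt_def algebra_simps)
    have "\<psi> (s * (nrm v - t)) * \<psi> (dt m v) = \<psi> ((- t) * s + (- (h * h * nrm m)) * ivs s) * \<psi> (s * nrm (v + w))"
      if v: "v \<in> pl" for v
    proof -
      have "\<psi> (s * (nrm v - t)) * \<psi> (dt m v) = \<psi> (s * (nrm v - t) + dt m v)"
        using v s t m by (intro char_add[symmetric]) auto
      also have "s * (nrm v - t) + dt m v = ((- t) * s + (- (h * h * nrm m)) * ivs s) + s * nrm (v + w)"
        unfolding nadd dm nw by (simp add: algebra_simps)
      also have "\<psi> \<dots> = \<psi> ((- t) * s + (- (h * h * nrm m)) * ivs s) * \<psi> (s * nrm (v + w))"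
        using v s t m h w by (intro char_add) auto
      finally show ?thesis .
    qed
    then have "(\<Sum>v\<in>pl. \<psi> (s * (nrm v - t)) * \<psi> (dt m v))
      = \<psi> ((- t) * s + (- (h * h * nrm m)) * ivs s) * (\<Sum>v\<in>pl. \<psi> (s * nrm (v + w)))"
      by (simp add: sum_distrib_left)
    also have "(\<Sum>v\<in>pl. \<psi> (s * nrm (v + w))) = (\<Sum>v\<in>pl. \<psi> (s * nrm v))"
      by (rule sum.reindex_bij_witness[of _ "\<lambda>v. v - w" "\<lambda>v. v + w"]) (use w in auto)
    also have "\<dots> = \<Gamma>" unfolding \<Gamma>_def using s by (intro gauss_sum_sq_eq) auto
    finally show "(\<Sum>v\<in>pl. \<psi> (s * (nrm v - t)) * \<psi> (dt m v)) = \<psi> ((- t) * s + (- (h * h * nrm m)) * ivs s) * \<Gamma>" .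
  qed
  also have "\<dots> = kloosterman (- t) (- (h * h * nrm m)) * \<Gamma>"
    unfolding kloosterman_def by (simp add: sum_distrib_right)
  finally have "norm (of_nat q * ?S) = norm (kloosterman (- t) (- (h * h * nrm m)) * \<Gamma>)" by simp
  then have "real q * norm ?S = norm (kloosterman (- t) (- (h * h * nrm m))) * real q"
    unfolding norm_mult norm\<Gamma> by simp
  then have "norm ?S = norm (kloosterman (- t) (- (h * h * nrm m)))" using q_pos by simp
  also have "\<dots> \<le> 2 * sqrt (real q)" using t m h by (intro kbound) auto
  finally show ?thesis .
qed

end

section \<open>Moments of exponential sums\<close>

lemma cauchy_schwarz_sum:
  fixes a b :: "'b \<Rightarrow> real"
  shows "(\<Sum>i\<in>A. a i * b i)\<^sup>2 \<le> (\<Sum>i\<in>A. (a i)\<^sup>2) * (\<Sum>i\<in>A. (b i)\<^sup>2)"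
proof -
  have "0 \<le> (\<Sum>i\<in>A. \<Sum>j\<in>A. (a i * b j - a j * b i)\<^sup>2)" by (intro sum_nonneg) auto
  also have "\<dots> = (\<Sum>i\<in>A. \<Sum>j\<in>A. (a i)\<^sup>2 * (b j)\<^sup>2) + (\<Sum>i\<in>A. \<Sum>j\<in>A. (b i)\<^sup>2 * (a j)\<^sup>2)
      - 2 * (\<Sum>i\<in>A. \<Sum>j\<in>A. (a i * b i) * (a j * b j))"
    by (simp add: power2_eq_square algebra_simps sum.distrib sum_subtractf sum_distrib_left)
  also have "\<dots> = 2 * ((\<Sum>i\<in>A. (a i)\<^sup>2) * (\<Sum>i\<in>A. (b i)\<^sup>2)) - 2 * (\<Sum>i\<in>A. a i * b i)\<^sup>2"
    unfolding sum_product[symmetric] power2_eq_square[of "sum _ _"] by simp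
  finally show ?thesis by simp
qed

context char_plane
begin

definition exp_sum :: "('a \<times> 'a) set \<Rightarrow> 'a \<times> 'a \<Rightarrow> complex" where
  "exp_sum A m = (\<Sum>x\<in>A. \<psi> (dt m x))"

text \<open>The zero frequency is left out because it carries the main term.\<close>

definition moment :: "('a \<times> 'a) set \<Rightarrow> nat \<Rightarrow> real" where
  "moment A j = (\<Sum>m\<in>pl - {0}. norm (exp_sum A m) ^ j)"

definition rep_count :: "('a \<times> 'a) set \<Rightarrow> 'a \<times> 'a \<Rightarrow> nat" where
  "rep_count A z = card {s\<in>A \<times> A. fst s - snd s = z}"

lemma exp_sum_0 [simp]: "exp_sum A 0 = of_nat (card A)"
  by (simp add: exp_sum_def dt_linear)

lemma moment_nonneg: "0 \<le> moment A j"
  by (auto simp: moment_def intro: sum_nonneg)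

lemma moment_split: "(\<Sum>m\<in>pl. norm (exp_sum A m) ^ j) = real (card A) ^ j + moment A j"
  using sum.remove[of pl 0 "\<lambda>m. norm (exp_sum A m) ^ j"] by (simp add: moment_def)

lemma moment_cauchy_schwarz: "(moment A (i + j))\<^sup>2 \<le> moment A (2 * i) * moment A (2 * j)"
  using cauchy_schwarz_sum[of "\<lambda>m. norm (exp_sum A m) ^ i" "\<lambda>m. norm (exp_sum A m) ^ j" "pl - {0}"]
  by (simp add: moment_def power_add power_mult[symmetric] mult.commute)

lemma exp_sum_cnj: "A \<subseteq> pl \<Longrightarrow> m \<in> pl \<Longrightarrow> cnj (exp_sum A m) = (\<Sum>x\<in>A. \<psi> (- dt m x))"
  by (auto simp: exp_sum_def char_uminus subsetD intro!: sum.cong)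

lemma parseval:
  "(\<Sum>m\<in>pl. (norm (\<Sum>z\<in>pl. of_real (c z) * \<psi> (dt m z)))\<^sup>2) = real (q ^ 2) * (\<Sum>z\<in>pl. (c z)\<^sup>2)"
proof -
  have "complex_of_real (\<Sum>m\<in>pl. (norm (\<Sum>z\<in>pl. of_real (c z) * \<psi> (dt m z)))\<^sup>2)
    = (\<Sum>m\<in>pl. \<Sum>z\<in>pl. \<Sum>w\<in>pl. of_real (c z * c w) * \<psi> (dt m (z - w)))"
    unfolding of_real_sum complex_norm_square cnj_sum sum_product
    by (intro sum.cong refl) (simp add: dt_linear char_diff)
  also have "\<dots> = (\<Sum>z\<in>pl. \<Sum>w\<in>pl. of_real (c z * c w) * (\<Sum>m\<in>pl. \<psi> (dt m (z - w))))"
    unfolding sum_distrib_left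
    by (subst sum.swap, rule sum.cong[OF refl], rule sum.swap)
  also have "\<dots> = (\<Sum>z\<in>pl. \<Sum>w\<in>pl. if z = w then of_real (c z * c w) * of_nat (q ^ 2) else 0)"
    by (intro sum.cong refl) (simp add: pl_orth')
  also have "\<dots> = complex_of_real (real (q ^ 2) * (\<Sum>z\<in>pl. (c z)\<^sup>2))"
    by (simp add: sum_distrib_left power2_eq_square mult_ac)
  finally show ?thesis using of_real_eq_iff by blast
qed

lemma exp_sum_indicator: "A \<subseteq> pl \<Longrightarrow> exp_sum A m = (\<Sum>z\<in>pl. of_real (if z \<in> A then 1 else 0) * \<psi> (dt m z))"
proof -
  assume A: "A \<subseteq> pl"
  have "(\<Sum>z\<in>pl. of_real (if z \<in> A then 1 else 0) * \<psi> (dt m z)) = (\<Sum>z\<in>pl. if z \<in> A then \<psi> (dt m z) else 0)"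
    by (intro sum.cong) auto
  also have "\<dots> = exp_sum A m" unfolding exp_sum_def
    using A by (subst sum.inter_restrict[symmetric]) (auto simp: Int_absorb1)
  finally show ?thesis ..
qed

lemma sum_norm_exp_sum_sq: "A \<subseteq> pl \<Longrightarrow> (\<Sum>m\<in>pl. (norm (exp_sum A m))\<^sup>2) = real (q ^ 2) * real (card A)"
proof -
  assume A: "A \<subseteq> pl"
  have "(\<Sum>z\<in>pl. (if z \<in> A then 1 else 0 :: real)\<^sup>2) = (\<Sum>z\<in>pl. if z \<in> A then 1 else 0)"
    by (intro sum.cong) auto
  also have "\<dots> = real (card A)"
    using A by (subst sum.inter_restrict[symmetric]) (auto simp: Int_absorb1)
  finally show ?thesis using parseval[of "\<lambda>z. if z \<in> A then 1 else 0"] by (simp add: exp_sum_indicator[OF A])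
qed

lemma exp_sum_mult_cnj:
  assumes A: "A \<subseteq> pl" and m: "m \<in> pl"
  shows "exp_sum A m * cnj (exp_sum A m) = (\<Sum>z\<in>pl. of_real (real (rep_count A z)) * \<psi> (dt m z))"
proof -
  have finA: "finite A" using A finite_subset[OF _ finite_pl] by auto
  have "exp_sum A m * cnj (exp_sum A m) = (\<Sum>s\<in>A \<times> A. \<psi> (dt m (fst s - snd s)))"
    unfolding exp_sum_cnj[OF A m] unfolding exp_sum_def sum_product sum.cartesian_product
  proof (rule sum.cong[OF refl], clarify)
    fix x y assume "x \<in> A" "y \<in> A"
    then have xy: "x \<in> pl" "y \<in> pl" using A by auto
    have "\<psi> (dt m x) * \<psi> (- dt m y) = \<psi> (dt m x + - dt m y)"
      using xy m by (intro char_add[symmetric]) auto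
    then show "\<psi> (dt m x) * \<psi> (- dt m y) = \<psi> (dt m (fst (x, y) - snd (x, y)))" by (simp add: dt_linear)
  qed
  also have "\<dots> = (\<Sum>z\<in>pl. of_nat (card {s\<in>A \<times> A. fst s - snd s = z}) * \<psi> (dt m z))"
    by (rule sum_over_fibres[of _ _ "\<lambda>s. fst s - snd s" "\<lambda>z. \<psi> (dt m z)"]) (use A finA in \<open>auto simp: subset_eq\<close>)
  finally show ?thesis by (simp add: rep_count_def)
qed

lemma energy: "A \<subseteq> pl \<Longrightarrow> (\<Sum>m\<in>pl. norm (exp_sum A m) ^ 4) = real (q ^ 2) * (\<Sum>z\<in>pl. (real (rep_count A z))\<^sup>2)"
proof -
  assume A: "A \<subseteq> pl"
  have "norm (exp_sum A m) ^ 4 = (norm (\<Sum>z\<in>pl. of_real (real (rep_count A z)) * \<psi> (dt m z)))\<^sup>2" if "m \<in> pl" for m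
    unfolding exp_sum_mult_cnj[OF A that, symmetric] norm_mult complex_mod_cnj
    by (simp add: power2_eq_square power4_eq_xxxx)
  then show ?thesis unfolding parseval[symmetric] by (intro sum.cong) auto
qed

section \<open>Positive definite functions and the reduction of moments\<close>

text \<open>\<open>g\<close> is the Fourier transform of a nonnegative function \<open>c\<close>.
  Products of such functions correspond to convolutions, conjugation to reflection.\<close>

definition posdef :: "('a \<times> 'a \<Rightarrow> complex) \<Rightarrow> bool" where
  "posdef g \<longleftrightarrow> (\<exists>c. (\<forall>y\<in>pl. 0 \<le> c y) \<and> (\<forall>m\<in>pl. g m = (\<Sum>y\<in>pl. of_real (c y) * \<psi> (dt m y))))"

lemma posdef_one: "posdef (\<lambda>m. 1)"
  unfolding posdef_def
proof (intro exI conjI ballI)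
  fix m assume "m \<in> pl"
  have "(\<Sum>y\<in>pl. complex_of_real (if y = 0 then 1 else 0) * \<psi> (dt m y)) = (\<Sum>y\<in>pl. if y = 0 then 1 else 0)"
    by (intro sum.cong) (auto simp: dt_linear)
  then show "1 = (\<Sum>y\<in>pl. complex_of_real (if y = 0 then 1 else 0) * \<psi> (dt m y))" by simp
qed auto

lemma posdef_exp_sum: "A \<subseteq> pl \<Longrightarrow> posdef (exp_sum A)"
  unfolding posdef_def
  by (intro exI[of _ "\<lambda>z. if z \<in> A then 1 else 0"]) (simp add: exp_sum_indicator)

lemma posdef_cnj: "posdef g \<Longrightarrow> posdef (\<lambda>m. cnj (g m))"
proof -
  assume "posdef g"
  then obtain c where c: "\<forall>y\<in>pl. 0 \<le> c y" "\<forall>m\<in>pl. g m = (\<Sum>y\<in>pl. of_real (c y) * \<psi> (dt m y))"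
    by (auto simp: posdef_def)
  have "cnj (g m) = (\<Sum>y\<in>pl. of_real (c (- y)) * \<psi> (dt m y))" if "m \<in> pl" for m
  proof -
    have "cnj (g m) = (\<Sum>y\<in>pl. of_real (c y) * \<psi> (- dt m y))"
      using c(2) that by (simp add: char_uminus)
    also have "\<dots> = (\<Sum>y\<in>pl. of_real (c (- y)) * \<psi> (dt m y))"
      by (rule sum.reindex_bij_witness[of _ uminus uminus]) (auto simp: dt_linear)
    finally show ?thesis .
  qed
  then show ?thesis unfolding posdef_def using c(1) by (intro exI[of _ "\<lambda>y. c (- y)"]) auto
qed

lemma posdef_mult: "posdef g \<Longrightarrow> posdef h \<Longrightarrow> posdef (\<lambda>m. g m * h m)"
proof -
  assume "posdef g" "posdef h"
  then obtain c d where c: "\<forall>y\<in>pl. 0 \<le> c y" "\<forall>m\<in>pl. g m = (\<Sum>y\<in>pl. of_real (c y) * \<psi> (dt m y))"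
    and d: "\<forall>y\<in>pl. 0 \<le> d y" "\<forall>m\<in>pl. h m = (\<Sum>y\<in>pl. of_real (d y) * \<psi> (dt m y))"
    by (auto simp: posdef_def)
  define f where "f = (\<lambda>z. \<Sum>y\<in>pl. c y * d (z - y))"
  have "g m * h m = (\<Sum>z\<in>pl. of_real (f z) * \<psi> (dt m z))" if m: "m \<in> pl" for m
  proof -
    have "g m * h m = (\<Sum>y\<in>pl. of_real (c y) * \<psi> (dt m y) * (\<Sum>w\<in>pl. of_real (d w) * \<psi> (dt m w)))"
      using c d m by (simp add: sum_distrib_right)
    also have "\<dots> = (\<Sum>y\<in>pl. \<Sum>z\<in>pl. of_real (c y * d (z - y)) * \<psi> (dt m z))"
    proof (rule sum.cong[OF refl])
      fix y assume y: "y \<in> pl"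
      have "(\<Sum>w\<in>pl. of_real (d w) * \<psi> (dt m w)) = (\<Sum>z\<in>pl. of_real (d (z - y)) * \<psi> (dt m (z - y)))"
        by (rule sum.reindex_bij_witness[of _ "\<lambda>z. z - y" "\<lambda>w. w + y"]) (use y in auto)
      then have "of_real (c y) * \<psi> (dt m y) * (\<Sum>w\<in>pl. of_real (d w) * \<psi> (dt m w))
        = (\<Sum>z\<in>pl. of_real (c y * d (z - y)) * (\<psi> (dt m y) * \<psi> (dt m (z - y))))"
        by (simp add: sum_distrib_left mult_ac)
      also have "\<dots> = (\<Sum>z\<in>pl. of_real (c y * d (z - y)) * \<psi> (dt m z))"
        using y m by (intro sum.cong refl) (simp add: char_add[symmetric] dt_linear(1)[symmetric])
      finally show "of_real (c y) * \<psi> (dt m y) * (\<Sum>w\<in>pl. of_real (d w) * \<psi> (dt m w))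
        = (\<Sum>z\<in>pl. of_real (c y * d (z - y)) * \<psi> (dt m z))" .
    qed
    also have "\<dots> = (\<Sum>z\<in>pl. of_real (f z) * \<psi> (dt m z))"
      unfolding f_def of_real_sum sum_distrib_right by (rule sum.swap)
    finally show ?thesis .
  qed
  moreover have "\<forall>z\<in>pl. 0 \<le> f z" 
    unfolding f_def using c(1) d(1) pl_simps(3) by (intro ballI sum_nonneg mult_nonneg_nonneg) blast+
  ultimately show ?thesis unfolding posdef_def by blast
qed

lemma posdef_power: "posdef g \<Longrightarrow> posdef (\<lambda>m. g m ^ n)"
  by (induct n) (auto intro: posdef_one posdef_mult)

text \<open>Fourier inversion: the sum equals \<open>q^2 * c (- z)\<close>.\<close>

lemma posdef_coeff:
  assumes "posdef g" "z \<in> pl"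
  shows "0 \<le> Re (\<Sum>m\<in>pl. \<psi> (dt m z) * g m)"
proof -
  obtain c where c: "\<forall>y\<in>pl. 0 \<le> c y" "\<forall>m\<in>pl. g m = (\<Sum>y\<in>pl. of_real (c y) * \<psi> (dt m y))"
    using assms by (auto simp: posdef_def)
  have "(\<Sum>m\<in>pl. \<psi> (dt m z) * g m) = (\<Sum>m\<in>pl. \<Sum>y\<in>pl. of_real (c y) * \<psi> (dt m (z + y)))"
    using c assms(2) by (intro sum.cong refl) (simp add: sum_distrib_left dt_linear char_add mult_ac)
  also have "\<dots> = (\<Sum>y\<in>pl. of_real (c y) * (\<Sum>m\<in>pl. \<psi> (dt m (z + y))))"
    unfolding sum_distrib_left by (rule sum.swap)
  also have "\<dots> = of_real (\<Sum>y\<in>pl. if z + y = 0 then c y * real (q ^ 2) else 0)"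
    unfolding of_real_sum using assms(2) by (intro sum.cong refl) (simp add: pl_orth')
  finally show ?thesis using c(1) by (auto intro!: sum_nonneg)
qed

text \<open>With one factor \<open>exp_sum E\<close> split off, the remaining factor
  \<open>g\<close> is positive definite, so adding the points of \<open>V - E\<close> can only
  increase the sum. The decay of \<open>V\<close> leaves the odd moment of order
  \<open>2 * s + 3\<close>, which Cauchy-Schwarz and the arithmetic-geometric mean bound by half of
  \<open>\<kappa>\<^sup>2\<close> times the lower moment plus half of the left side. Absorbing the
  latter produces the factor 2.\<close>

lemma moment_step:
  assumes V: "V \<subseteq> pl" and E: "E \<subseteq> V" and decay: "\<And>m. m \<in> pl \<Longrightarrow> m \<noteq> 0 \<Longrightarrow> norm (exp_sum V m) \<le> \<kappa>"
  shows "moment E (2 * (s + 2)) \<le> 2 * real (card V) * real (card E) ^ (2 * s + 3) + \<kappa>\<^sup>2 * moment E (2 * (s + 1))"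
proof -
  have Epl: "E \<subseteq> pl" using V E by auto
  define g where "g = (\<lambda>m. cnj (exp_sum E m) * (exp_sum E m * cnj (exp_sum E m)) ^ (s + 1))"
  have posg: "posdef g" unfolding g_def
    by (intro posdef_mult posdef_power posdef_cnj posdef_exp_sum Epl)
  have normg: "norm (g m) = norm (exp_sum E m) ^ (2 * s + 3)" for m
  proof -
    have "norm (g m) = norm (exp_sum E m) * (norm (exp_sum E m))\<^sup>2 ^ (s + 1)"
      by (simp add: g_def norm_mult norm_power power2_eq_square)
    also have "\<dots> = norm (exp_sum E m) ^ Suc (2 * (s + 1))" by (simp only: power_mult[symmetric] power_Suc)
    finally show ?thesis by (simp add: numeral_3_eq_3)
  qed
  have eg: "exp_sum E m * g m = of_real (norm (exp_sum E m) ^ (2 * (s + 2)))" for m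
  proof -
    have "exp_sum E m * g m = (exp_sum E m * cnj (exp_sum E m)) ^ (s + 2)" by (simp add: g_def mult_ac)
    also have "\<dots> = of_real (((norm (exp_sum E m))\<^sup>2) ^ (s + 2))"
      by (simp only: complex_norm_square[symmetric] of_real_power)
    finally show ?thesis by (simp only: power_mult)
  qed
  have finV: "finite V" using V finite_subset[OF _ finite_pl] by auto
  have split: "exp_sum V m = exp_sum E m + exp_sum (V - E) m" for m
    unfolding exp_sum_def using finV E by (metis add.commute sum.subset_diff)
  have "(\<Sum>m\<in>pl. exp_sum (V - E) m * g m) = (\<Sum>z\<in>V - E. \<Sum>m\<in>pl. \<psi> (dt m z) * g m)"
    unfolding exp_sum_def sum_distrib_right by (rule sum.swap)
  then have "Re (\<Sum>m\<in>pl. exp_sum (V - E) m * g m) = (\<Sum>z\<in>V - E. Re (\<Sum>m\<in>pl. \<psi> (dt m z) * g m))"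
    by (simp only: Re_sum)
  also have "\<dots> \<ge> 0" using posdef_coeff[OF posg] V by (intro sum_nonneg) blast
  finally have "0 \<le> Re (\<Sum>m\<in>pl. exp_sum (V - E) m * g m)" .
  then have "Re (\<Sum>m\<in>pl. exp_sum E m * g m) \<le> Re (\<Sum>m\<in>pl. exp_sum V m * g m)"
    unfolding split by (simp add: distrib_right sum.distrib)
  moreover have "Re (\<Sum>m\<in>pl. exp_sum E m * g m) = (\<Sum>m\<in>pl. norm (exp_sum E m) ^ (2 * (s + 2)))"
    unfolding eg by simp
  ultimately have "(\<Sum>m\<in>pl. norm (exp_sum E m) ^ (2 * (s + 2))) \<le> norm (\<Sum>m\<in>pl. exp_sum V m * g m)"
    using complex_Re_le_cmod[of "\<Sum>m\<in>pl. exp_sum V m * g m"] by linarith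
  also have "\<dots> \<le> (\<Sum>m\<in>pl. norm (exp_sum V m) * norm (exp_sum E m) ^ (2 * s + 3))"
    by (rule order_trans[OF norm_sum]) (simp add: norm_mult normg)
  also have "\<dots> = real (card V) * real (card E) ^ (2 * s + 3) + (\<Sum>m\<in>pl - {0}. norm (exp_sum V m) * norm (exp_sum E m) ^ (2 * s + 3))"
    using sum.remove[of pl 0 "\<lambda>m. norm (exp_sum V m) * norm (exp_sum E m) ^ (2 * s + 3)"] by simp
  also have "(\<Sum>m\<in>pl - {0}. norm (exp_sum V m) * norm (exp_sum E m) ^ (2 * s + 3)) \<le> (\<Sum>m\<in>pl - {0}. \<kappa> * norm (exp_sum E m) ^ (2 * s + 3))"
    using decay by (intro sum_mono mult_right_mono) auto
  also have "\<dots> = \<kappa> * moment E (2 * s + 3)" by (simp add: moment_def sum_distrib_left)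
  finally have 1: "moment E (2 * (s + 2)) \<le> real (card V) * real (card E) ^ (2 * s + 3) + \<kappa> * moment E (2 * s + 3)"
    unfolding moment_split by (smt (verit) zero_le_power of_nat_0_le_iff)
  define Xa Y where "Xa = moment E (2 * (s + 1))" and "Y = moment E (2 * (s + 2))"
  have XY: "0 \<le> Xa" "0 \<le> Y" by (auto simp: Xa_def Y_def moment_nonneg)
  have "(s + 1) + (s + 2) = 2 * s + 3" by simp
  then have cs: "(moment E (2 * s + 3))\<^sup>2 \<le> Xa * Y"
    using moment_cauchy_schwarz[of E "s + 1" "s + 2"] unfolding Xa_def Y_def by metis
  have "\<kappa> * moment E (2 * s + 3) \<le> (\<kappa>\<^sup>2 * Xa + Y) / 2"
  proof (rule power2_le_imp_le)
    have "(\<kappa> * moment E (2 * s + 3))\<^sup>2 \<le> \<kappa>\<^sup>2 * (Xa * Y)"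
      unfolding power_mult_distrib using cs by (intro mult_left_mono) auto
    also have "\<dots> \<le> ((\<kappa>\<^sup>2 * Xa + Y) / 2)\<^sup>2"
      using zero_le_power2[of "\<kappa>\<^sup>2 * Xa - Y"] by (simp add: power2_eq_square field_simps)
    finally show "(\<kappa> * moment E (2 * s + 3))\<^sup>2 \<le> ((\<kappa>\<^sup>2 * Xa + Y) / 2)\<^sup>2" .
  qed (use XY in auto)
  then have "Y \<le> real (card V) * real (card E) ^ (2 * s + 3) + (\<kappa>\<^sup>2 * Xa + Y) / 2"
    using 1 unfolding Y_def by linarith
  then show ?thesis unfolding Xa_def[symmetric] Y_def[symmetric] by (simp add: field_simps)
qed

text \<open>If no resultant lies on the circle, the character sum counting such incidences is zero.
  Its zero frequency, the left side up to \<open>card_circ_ge\<close>, must then be cancelled by the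
  other frequencies, where \<open>circle_decay\<close> applies.\<close>

lemma resultant_count:
  assumes E: "E \<subseteq> pl" and t: "t \<in> K" "t \<noteq> 0" and k: "1 \<le> k"
    and none: "\<And>x. x \<in> {1..k} \<rightarrow>\<^sub>E E \<Longrightarrow> nrm (x 1 - (\<Sum>j\<in>{2..k}. x j)) \<noteq> t"
  shows "(real q - 1) * real (card E) ^ k \<le> 2 * sqrt (real q) * moment E k"
proof -
  have finE: "finite E" using E finite_subset[OF _ finite_pl] by auto
  define Xa where "Xa = ({1..k} \<rightarrow>\<^sub>E E)"
  define R where "R = (\<lambda>x::nat \<Rightarrow> 'a \<times> 'a. x 1 - (\<Sum>j\<in>{2..k}. x j))"
  have xj: "x j \<in> pl" if "x \<in> Xa" "j \<in> {1..k}" for x j using that E by (auto simp: Xa_def)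
  have sum_pl: "(\<Sum>j\<in>A. f j) \<in> pl" if "\<And>j. j \<in> A \<Longrightarrow> f j \<in> pl" for A :: "nat set" and f :: "nat \<Rightarrow> 'a \<times> 'a"
    using that by (induct A rule: infinite_finite_induct) auto
  have R_in: "R x \<in> pl" if "x \<in> Xa" for x
    unfolding R_def using xj[OF that] k by (auto intro!: pl_simps(3) sum_pl)
  have Rsum: "(\<Sum>x\<in>Xa. \<psi> (dt m (R x))) = exp_sum E m * cnj (exp_sum E m) ^ (k - 1)" if m: "m \<in> pl" for m
  proof -
    have chs: "\<psi> (- (\<Sum>j\<in>A. f j)) = (\<Prod>j\<in>A. cnj (\<psi> (f j)))" if "finite A" "\<And>j. j \<in> A \<Longrightarrow> f j \<in> K" for A :: "nat set" and f
      using that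
    proof (induct A rule: finite_induct)
      case (insert j A)
      have "\<psi> (- (\<Sum>j\<in>insert j A. f j)) = \<psi> (- f j + - (\<Sum>j\<in>A. f j))" using insert by simp
      also have "\<dots> = \<psi> (- f j) * \<psi> (- (\<Sum>j\<in>A. f j))"
        by (rule char_add) (use insert in auto)
      finally show ?case using insert by (simp add: char_uminus)
    qed simp
    define F where "F = (\<lambda>j v. if j = (1::nat) then \<psi> (dt m v) else cnj (\<psi> (dt m v)))"
    have "\<psi> (dt m (R x)) = (\<Prod>j\<in>{1..k}. F j (x j))" if x: "x \<in> Xa" for x
    proof -
      have "\<psi> (dt m (R x)) = \<psi> (dt m (x 1) + - (\<Sum>j\<in>{2..k}. dt m (x j)))"
        by (simp add: R_def dt_linear dt_sum)
      also have "\<dots> = \<psi> (dt m (x 1)) * \<psi> (- (\<Sum>j\<in>{2..k}. dt m (x j)))"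
        by (intro char_add uminus_in sum_in dt_in m xj[OF x]) (use k in auto)
      also have "\<psi> (- (\<Sum>j\<in>{2..k}. dt m (x j))) = (\<Prod>j\<in>{2..k}. cnj (\<psi> (dt m (x j))))"
        by (rule chs) (use xj[OF x] m in auto)
      also have "\<dots> = (\<Prod>j\<in>{2..k}. F j (x j))" by (intro prod.cong) (auto simp: F_def)
      also have "\<psi> (dt m (x 1)) * \<dots> = (\<Prod>j\<in>insert 1 {2..k}. F j (x j))" by (simp add: F_def)
      also have "insert 1 {2..k} = {1..k}" using k by auto
      finally show ?thesis .
    qed
    then have "(\<Sum>x\<in>Xa. \<psi> (dt m (R x))) = (\<Sum>x\<in>Xa. \<Prod>j\<in>{1..k}. F j (x j))" by simp
    also have "\<dots> = (\<Prod>j\<in>{1..k}. \<Sum>v\<in>E. F j v)" unfolding Xa_def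
      using finE by (simp add: prod_sum_PiE)
    also have "{1..k} = insert 1 {2..k}" using k by auto
    also have "(\<Prod>j\<in>insert 1 {2..k}. \<Sum>v\<in>E. F j v) = exp_sum E m * (\<Prod>j\<in>{2..k}. \<Sum>v\<in>E. F j v)"
      by (simp add: F_def exp_sum_def)
    also have "(\<Prod>j\<in>{2..k}. \<Sum>v\<in>E. F j v) = (\<Prod>j\<in>{2..k}. cnj (exp_sum E m))"
      by (intro prod.cong) (auto simp: F_def exp_sum_def)
    finally show ?thesis by simp
  qed
  have "(\<Sum>v\<in>circ t. \<Sum>x\<in>Xa. \<Sum>m\<in>pl. \<psi> (dt m (R x - v))) = 0"
  proof (rule sum.neutral, rule ballI, rule sum.neutral, rule ballI)
    fix v x assume v: "v \<in> circ t" and x: "x \<in> Xa"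
    then have "R x \<noteq> v" using none[of x] by (auto simp: circ_def Xa_def R_def)
    moreover have "R x - v \<in> pl" using R_in[OF x] v by (auto simp: circ_def)
    ultimately show "(\<Sum>m\<in>pl. \<psi> (dt m (R x - v))) = 0" by (simp add: pl_orth')
  qed
  also have "(\<Sum>v\<in>circ t. \<Sum>x\<in>Xa. \<Sum>m\<in>pl. \<psi> (dt m (R x - v)))
    = (\<Sum>m\<in>pl. \<Sum>v\<in>circ t. \<Sum>x\<in>Xa. \<psi> (dt m (R x - v)))"
  proof -
    have "(\<Sum>v\<in>circ t. \<Sum>x\<in>Xa. \<Sum>m\<in>pl. \<psi> (dt m (R x - v))) = (\<Sum>v\<in>circ t. \<Sum>m\<in>pl. \<Sum>x\<in>Xa. \<psi> (dt m (R x - v)))"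
      by (intro sum.cong refl sum.swap)
    also have "\<dots> = (\<Sum>m\<in>pl. \<Sum>v\<in>circ t. \<Sum>x\<in>Xa. \<psi> (dt m (R x - v)))" by (rule sum.swap)
    finally show ?thesis .
  qed
  also have "\<dots> = (\<Sum>m\<in>pl. cnj (exp_sum (circ t) m) * (exp_sum E m * cnj (exp_sum E m) ^ (k - 1)))"
  proof (rule sum.cong[OF refl])
    fix m assume m: "m \<in> pl"
    have "(\<Sum>v\<in>circ t. \<Sum>x\<in>Xa. \<psi> (dt m (R x - v))) = (\<Sum>v\<in>circ t. \<Sum>x\<in>Xa. cnj (\<psi> (dt m v)) * \<psi> (dt m (R x)))"
      using m R_in by (intro sum.cong refl) (auto simp: dt_linear char_diff circ_def mult.commute)
    also have "\<dots> = cnj (exp_sum (circ t) m) * (\<Sum>x\<in>Xa. \<psi> (dt m (R x)))" by (simp add: exp_sum_def sum_product)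
    finally show "(\<Sum>v\<in>circ t. \<Sum>x\<in>Xa. \<psi> (dt m (R x - v))) = cnj (exp_sum (circ t) m) * (exp_sum E m * cnj (exp_sum E m) ^ (k - 1))"
      using Rsum[OF m] by simp
  qed
  finally have z: "(\<Sum>m\<in>pl. cnj (exp_sum (circ t) m) * (exp_sum E m * cnj (exp_sum E m) ^ (k - 1))) = 0" .
  define W where "W = (\<Sum>m\<in>pl - {0}. cnj (exp_sum (circ t) m) * (exp_sum E m * cnj (exp_sum E m) ^ (k - 1)))"
  have Npow: "x * x ^ (k - 1) = x ^ k" for x :: real using k by (cases k) auto
  have Npow': "x * x ^ (k - 1) = x ^ k" for x :: complex using k by (cases k) auto
  have "of_nat (card (circ t)) * of_nat (card E) ^ k + W = 0"
    using z sum.remove[of pl 0 "\<lambda>m. cnj (exp_sum (circ t) m) * (exp_sum E m * cnj (exp_sum E m) ^ (k - 1))"]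
    by (simp add: W_def Npow'[unfolded One_nat_def])
  then have "W = - (of_real (real (card (circ t)) * real (card E) ^ k))" by (simp add: eq_neg_iff_add_eq_0 add.commute)
  then have "real (card (circ t)) * real (card E) ^ k = norm W" by (simp add: norm_mult norm_power)
  also have "\<dots> \<le> (\<Sum>m\<in>pl - {0}. norm (exp_sum (circ t) m) * norm (exp_sum E m) ^ k)"
    unfolding W_def by (rule order_trans[OF norm_sum]) (simp add: norm_mult norm_power Npow[unfolded One_nat_def])
  also have "\<dots> \<le> (\<Sum>m\<in>pl - {0}. (2 * sqrt (real q)) * norm (exp_sum E m) ^ k)"
    using circle_decay[OF t] by (intro sum_mono mult_right_mono) (auto simp: exp_sum_def)
  also have "\<dots> = 2 * sqrt (real q) * moment E k" by (simp add: moment_def sum_distrib_left)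
  finally have "real (card (circ t)) * real (card E) ^ k \<le> 2 * sqrt (real q) * moment E k" .
  moreover have "(real q - 1) * real (card E) ^ k \<le> real (card (circ t)) * real (card E) ^ k"
    using card_circ_ge[OF t] by (intro mult_right_mono) auto
  ultimately show ?thesis by linarith
qed

end

section \<open>Polynomial functions in two variables\<close>

context subfld
begin

text \<open>Total degree at most \<open>d\<close>, as a predicate on functions: rule induction takes
  the place of coefficients, and \<open>eq_on\<close> discards everything outside
  \<open>K \<times> K\<close>.\<close>

inductive bpol :: "nat \<Rightarrow> ('u \<times> 'u \<Rightarrow> 'u) \<Rightarrow> bool" where
  const: "c \<in> K \<Longrightarrow> bpol d (\<lambda>v. c)"
| add: "bpol d f \<Longrightarrow> bpol d g \<Longrightarrow> bpol d (\<lambda>v. f v + g v)"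
| mult_fst: "bpol d f \<Longrightarrow> bpol (Suc d) (\<lambda>v. fst v * f v)"
| mult_snd: "bpol d f \<Longrightarrow> bpol (Suc d) (\<lambda>v. snd v * f v)"
| eq_on: "bpol d f \<Longrightarrow> (\<And>v. v \<in> K \<times> K \<Longrightarrow> f v = g v) \<Longrightarrow> bpol d g"

lemma bpol_closed: "bpol d f \<Longrightarrow> v \<in> K \<times> K \<Longrightarrow> f v \<in> K"
  by (induct rule: bpol.induct) auto

lemma bpol_cmult: "bpol d f \<Longrightarrow> c \<in> K \<Longrightarrow> bpol d (\<lambda>v. c * f v)"
proof (induct rule: bpol.induct)
  case (const c' d)
  then show ?case by (auto intro: bpol.const)
next
  case (add d f g)
  then show ?case using bpol.add[of d "\<lambda>v. c * f v" "\<lambda>v. c * g v"] by (simp add: distrib_left)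
next
  case (mult_fst d f)
  then show ?case using bpol.mult_fst[of d "\<lambda>v. c * f v"] by (simp add: mult.left_commute)
next
  case (mult_snd d f)
  then show ?case using bpol.mult_snd[of d "\<lambda>v. c * f v"] by (simp add: mult.left_commute)
next
  case (eq_on d f g)
  have "bpol d (\<lambda>v. c * f v)" using eq_on by blast
  then show ?case by (rule bpol.eq_on) (use eq_on in simp)
qed

lemma bpol_Suc: "bpol d f \<Longrightarrow> bpol (Suc d) f"
  by (induct rule: bpol.induct) (auto intro: bpol.intros)

lemma bpol_mono: "bpol d f \<Longrightarrow> d \<le> d' \<Longrightarrow> bpol d' f"
  by (induct d' rule: nat_induct) (auto simp: le_Suc_eq dest: bpol_Suc)

lemma bpol_diff: "bpol d f \<Longrightarrow> bpol d g \<Longrightarrow> bpol d (\<lambda>v. f v - g v)"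
proof -
  assume fg: "bpol d f" "bpol d g"
  have "bpol d (\<lambda>v. f v + (- e) * g v)" by (intro bpol.add bpol_cmult fg) auto
  then show ?thesis by (rule bpol.eq_on) (use bpol_closed[OF fg(2)] in simp)
qed

lemma bpol_mult: "bpol a f \<Longrightarrow> bpol b g \<Longrightarrow> bpol (a + b) (\<lambda>v. f v * g v)"
proof (induct rule: bpol.induct)
  case (const c d)
  then show ?case using bpol_mono[OF bpol_cmult] by simp
next
  case (add d f h)
  then show ?case using bpol.add[of "d + b" "\<lambda>v. f v * g v" "\<lambda>v. h v * g v"] by (simp add: distrib_right)
next
  case (mult_fst d f)
  then show ?case using bpol.mult_fst[of "d + b" "\<lambda>v. f v * g v"] by (simp add: mult.assoc)
next
  case (mult_snd d f)
  then show ?case using bpol.mult_snd[of "d + b" "\<lambda>v. f v * g v"] by (simp add: mult.assoc)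
next
  case (eq_on d f h)
  have "bpol (d + b) (\<lambda>v. f v * g v)" using eq_on by blast
  then show ?case by (rule bpol.eq_on) (use eq_on in simp)
qed

lemma bpol_fst: "bpol 1 fst"
  unfolding One_nat_def by (rule bpol.eq_on[OF bpol.mult_fst[OF bpol.const[OF e_in]]]) auto

lemma bpol_snd: "bpol 1 snd"
  unfolding One_nat_def by (rule bpol.eq_on[OF bpol.mult_snd[OF bpol.const[OF e_in]]]) auto

lemma bpol_sum: "(\<And>i. i \<in> I \<Longrightarrow> bpol n (g i)) \<Longrightarrow> bpol n (\<lambda>v. \<Sum>i\<in>I. g i v)"
proof (induct I rule: infinite_finite_induct)
  case (insert i I)
  then have "bpol n (\<lambda>v. g i v + (\<Sum>i\<in>I. g i v))" by (intro bpol.add) auto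
  then show ?case using insert by simp
qed (use bpol.const in auto)

lemma bpol_monom: "c \<in> K \<Longrightarrow> bpol (i + j) (\<lambda>v. c * (e * fst v ^ i) * (e * snd v ^ j))"
proof -
  assume c: "c \<in> K"
  have "bpol i (\<lambda>v. e * fst v ^ i)" for i
  proof (induct i)
    case (Suc i)
    show ?case using bpol.mult_fst[OF Suc] by (simp add: mult.left_commute)
  qed (use bpol.const[OF e_in] in simp)
  moreover have "bpol j (\<lambda>v. e * snd v ^ j)" for j
  proof (induct j)
    case (Suc j)
    show ?case using bpol.mult_snd[OF Suc] by (simp add: mult.left_commute)
  qed (use bpol.const[OF e_in] in simp)
  ultimately show ?thesis using bpol_mult[OF bpol_cmult[OF _ c]] by blast
qed

lemma bpol_prod:
  "finite I \<Longrightarrow> (\<And>i. i \<in> I \<Longrightarrow> bpol n (g i)) \<Longrightarrow> bpol (n * card I) (\<lambda>v. e * (\<Prod>i\<in>I. g i v))"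
proof (induct I rule: finite_induct)
  case (insert i I)
  have "bpol (n + n * card I) (\<lambda>v. g i v * (e * (\<Prod>i\<in>I. g i v)))"
    using insert by (intro bpol_mult) auto
  then show ?case using insert by (simp add: mult.left_commute)
qed (use bpol.const in simp)

lemma prod_nonzero:
  "finite I \<Longrightarrow> (\<And>i. i \<in> I \<Longrightarrow> x i \<in> K) \<Longrightarrow> e * (\<Prod>i\<in>I. x i) \<in> K \<and> (e * (\<Prod>i\<in>I. x i) = 0 \<longleftrightarrow> (\<exists>i\<in>I. x i = 0))"
proof (induct I rule: finite_induct)
  case (insert i I)
  then have eq: "e * (\<Prod>i\<in>insert i I. x i) = x i * (e * (\<Prod>i\<in>I. x i))" by (simp add: mult.left_commute)
  show ?case unfolding eq using insert by simp
qed simp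

lemma plus_in_pl: "v \<in> K \<times> K \<Longrightarrow> w \<in> K \<times> K \<Longrightarrow> v + w \<in> K \<times> K"
  and minus_in_pl: "v \<in> K \<times> K \<Longrightarrow> w \<in> K \<times> K \<Longrightarrow> v - w \<in> K \<times> K"
  and uminus_in_pl: "v \<in> K \<times> K \<Longrightarrow> - v \<in> K \<times> K"
  and zero_in_pl: "0 \<in> K \<times> K"
  by (auto simp: mem_Times_iff)

lemma bpol_shift: "bpol d f \<Longrightarrow> w \<in> K \<times> K \<Longrightarrow> bpol d (\<lambda>v. f (v + w))"
proof (induct rule: bpol.induct)
  case (const c' d)
  then show ?case by (auto intro: bpol.const)
next
  case (add d f g)
  then show ?case using bpol.add by blast
next
  case (mult_fst d f)
  have "bpol (Suc d) (\<lambda>v. fst v * f (v + w) + fst w * f (v + w))"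
    by (intro bpol.add bpol.mult_fst bpol_Suc[OF bpol_cmult]) (use mult_fst in auto)
  then show ?case by (simp add: distrib_right)
next
  case (mult_snd d f)
  have "bpol (Suc d) (\<lambda>v. snd v * f (v + w) + snd w * f (v + w))"
    by (intro bpol.add bpol.mult_snd bpol_Suc[OF bpol_cmult]) (use mult_snd in auto)
  then show ?case by (simp add: distrib_right)
next
  case (eq_on d f g)
  have "bpol d (\<lambda>v. f (v + w))" using eq_on by blast
  then show ?case by (rule bpol.eq_on) (rule eq_on(3)[OF plus_in_pl[OF _ eq_on(4)]])
qed

text \<open>Truncated subtraction hides the drop in degree at \<open>d = 0\<close>. The second
  conjunct restores it, and the induction needs it when a constant is multiplied by a
  coordinate.\<close>

lemma bpol_difference:
  "bpol d f \<Longrightarrow> w \<in> K \<times> K \<Longrightarrow>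
    bpol (d - 1) (\<lambda>v. f (v + w) - f v) \<and> (d = 0 \<longrightarrow> (\<forall>v\<in>K \<times> K. f (v + w) = f v))"
proof (induct rule: bpol.induct)
  case (const c' d)
  then show ?case using bpol.const[of 0] by simp
next
  case (add d f g)
  then have "bpol (d - 1) (\<lambda>v. (f (v + w) - f v) + (g (v + w) - g v))" by (intro bpol.add) auto
  then show ?case using add by (simp add: algebra_simps)
next
  case (mult_fst d f)
  have "bpol d (\<lambda>v. fst v * (f (v + w) - f v))"
  proof (cases d)
    case 0
    show ?thesis by (rule bpol.eq_on[OF bpol.const[OF zero_in]]) (use mult_fst 0 in auto)
  qed (use mult_fst bpol.mult_fst in auto)
  then have "bpol d (\<lambda>v. fst v * (f (v + w) - f v) + fst w * f (v + w))"
    by (rule bpol.add) (use mult_fst in \<open>auto intro: bpol_cmult bpol_shift\<close>)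
  then show ?case by (simp add: algebra_simps)
next
  case (mult_snd d f)
  have "bpol d (\<lambda>v. snd v * (f (v + w) - f v))"
  proof (cases d)
    case 0
    show ?thesis by (rule bpol.eq_on[OF bpol.const[OF zero_in]]) (use mult_snd 0 in auto)
  qed (use mult_snd bpol.mult_snd in auto)
  then have "bpol d (\<lambda>v. snd v * (f (v + w) - f v) + snd w * f (v + w))"
    by (rule bpol.add) (use mult_snd in \<open>auto intro: bpol_cmult bpol_shift\<close>)
  then show ?case by (simp add: algebra_simps)
next
  case (eq_on d f g)
  have eq: "g (v + w) = f (v + w)" "g v = f v" if "v \<in> K \<times> K" for v
    using eq_on(3)[OF that] eq_on(3)[OF plus_in_pl[OF that eq_on(4)]] by simp_all
  have "bpol (d - 1) (\<lambda>v. f (v + w) - f v)" using eq_on by blast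
  then have "bpol (d - 1) (\<lambda>v. g (v + w) - g v)" by (rule bpol.eq_on) (simp only: eq)
  then show ?case using eq_on(2)[OF eq_on(4)] eq by simp
qed

lemma bpol_row: "bpol d f \<Longrightarrow> y \<in> K \<Longrightarrow> (\<lambda>x. f (x, y)) \<in> upol K d"
proof (induct rule: bpol.induct)
  case (mult_snd d f)
  then show ?case using upol_Suc[OF upol_cmult] by simp
next
  case (eq_on d f g)
  have "(\<lambda>x. f (x, y)) \<in> upol K d" using eq_on by blast
  then show ?case by (rule upol_cong) (use eq_on in auto)
qed (auto intro: upol_const upol_add upol_shift simp del: upol.simps)

lemma bpol_column: "bpol d f \<Longrightarrow> x \<in> K \<Longrightarrow> (\<lambda>y. f (x, y)) \<in> upol K d"
proof (induct rule: bpol.induct)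
  case (mult_fst d f)
  then show ?case using upol_Suc[OF upol_cmult] by simp
next
  case (eq_on d f g)
  have "(\<lambda>y. f (x, y)) \<in> upol K d" using eq_on by blast
  then show ?case by (rule upol_cong) (use eq_on in auto)
qed (auto intro: upol_const upol_add upol_shift simp del: upol.simps)

text \<open>Division by the second coordinate, for the recursive count in
  \<open>hilbert_Pl_le\<close>. The clause for \<open>d = 0\<close> again makes up for truncated
  subtraction.\<close>

lemma bpol_decompose:
  "bpol d f \<Longrightarrow> \<exists>u\<in>upol K d. \<exists>g. (d = 0 \<longrightarrow> g = (\<lambda>v. 0)) \<and> (0 < d \<longrightarrow> bpol (d - 1) g) \<and>
    (\<forall>v\<in>K \<times> K. f v = u (fst v) + snd v * g v)"
proof (induct rule: bpol.induct)
  case (const c d)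
  show ?case
    by (intro bexI[of _ "\<lambda>x. c"] exI[of _ "\<lambda>v. 0"] upol_const) (use const bpol.const in auto)
next
  case (add d f f')
  then obtain u g u' g' where *: "u \<in> upol K d" "u' \<in> upol K d"
    "d = 0 \<longrightarrow> g = (\<lambda>v. 0)" "0 < d \<longrightarrow> bpol (d - 1) g" "\<forall>v\<in>K \<times> K. f v = u (fst v) + snd v * g v"
    "d = 0 \<longrightarrow> g' = (\<lambda>v. 0)" "0 < d \<longrightarrow> bpol (d - 1) g'" "\<forall>v\<in>K \<times> K. f' v = u' (fst v) + snd v * g' v"
    by (elim bexE exE conjE) blast
  show ?case
    by (intro bexI[of _ "\<lambda>x. u x + u' x"] exI[of _ "\<lambda>v. g v + g' v"] upol_add *(1,2))
      (use * bpol.add in \<open>auto simp: algebra_simps\<close>)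
next
  case (mult_fst d f)
  then obtain u g where *: "u \<in> upol K d" "d = 0 \<longrightarrow> g = (\<lambda>v. 0)" "0 < d \<longrightarrow> bpol (d - 1) g"
    "\<forall>v\<in>K \<times> K. f v = u (fst v) + snd v * g v" by blast
  have "bpol d (\<lambda>v. fst v * g v)"
  proof (cases d)
    case 0
    then show ?thesis using *(2) bpol.const[OF zero_in] by simp
  qed (use * bpol.mult_fst in auto)
  then show ?case
    by (intro bexI[of _ "\<lambda>x. x * u x"] exI[of _ "\<lambda>v. fst v * g v"] upol_shift *(1))
      (use *(4) in \<open>auto simp: algebra_simps\<close>)
next
  case (mult_snd d f)
  show ?case
    by (intro bexI[of _ "\<lambda>x. 0"] exI[of _ f] upol_const) (use mult_snd in auto)
next
  case (eq_on d f g)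
  then obtain u h where *: "u \<in> upol K d" "d = 0 \<longrightarrow> h = (\<lambda>v. 0)" "0 < d \<longrightarrow> bpol (d - 1) h"
    "\<forall>v\<in>K \<times> K. f v = u (fst v) + snd v * h v" by blast
  then have "\<forall>v\<in>K \<times> K. g v = u (fst v) + snd v * h v" using eq_on(3) by metis
  then show ?case using *(1-3) by blast
qed

end

section \<open>Hilbert functions of point sets, by counting\<close>

text \<open>\<open>(d + 1) * (d + 2) / 2\<close>, the number of monomials of degree at most
  \<open>d\<close> in two variables.\<close>

primrec tri :: "nat \<Rightarrow> nat" where
  "tri 0 = 1"
| "tri (Suc d) = tri d + (d + 2)"

lemma tri_add_le: "tri (d + n) \<le> tri d + n * (d + n + 1)"
  by (induct n) (auto simp: algebra_simps)

locale finite_subfld = subfld +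
  assumes finK: "finite K"
begin

abbreviation "Pl \<equiv> K \<times> K"

definition restr :: "('a \<times> 'a) set \<Rightarrow> ('a \<times> 'a \<Rightarrow> 'a) set \<Rightarrow> ('a \<times> 'a \<Rightarrow> 'a) set" where
  "restr S W = (\<lambda>f. restrict f S) ` W"

text \<open>Cardinalities replace dimensions: \<open>hilbert d S\<close> is \<open>q\<close> to the power of the Hilbert function of \<open>S\<close>.\<close>

definition hilbert :: "nat \<Rightarrow> ('a \<times> 'a) set \<Rightarrow> nat" where
  "hilbert d S = card (restr S (Collect (bpol d)))"

lemma finite_Pl: "finite Pl"
  using finK by simp

lemma card_K: "2 \<le> card K"
  using card_mono[OF finK, of "{0, e}"] by (simp add: zero_in e_neq_0[symmetric])

lemma finite_restr: "S \<subseteq> Pl \<Longrightarrow> W \<subseteq> Collect (bpol d) \<Longrightarrow> finite (restr S W)"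
proof (rule finite_subset)
  assume "S \<subseteq> Pl" "W \<subseteq> Collect (bpol d)"
  then have "restrict f S \<in> S \<rightarrow>\<^sub>E K" if "f \<in> W" for f
    unfolding restrict_PiE_iff using that bpol_closed by blast
  then show "restr S W \<subseteq> S \<rightarrow>\<^sub>E K" unfolding restr_def by blast
  show "finite (S \<rightarrow>\<^sub>E K)" using finite_subset[OF \<open>S \<subseteq> Pl\<close> finite_Pl] finK by (intro finite_PiE) auto
qed

lemma restrict_eq_iff: "restrict f S = restrict g S \<longleftrightarrow> (\<forall>v\<in>S. f v = g v)"
  by (auto simp: fun_eq_iff restrict_def)

text \<open>Restriction from \<open>B\<close> to \<open>A\<close> maps onto the functions on
  \<open>A\<close>, and its kernel contains \<open>restr B W\<close>. Counting form: a chosen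
  extension of a function on \<open>A\<close> plus an element of \<open>W\<close> determines
  both.\<close>

lemma hilbert_mult_le:
  assumes AB: "A \<subseteq> B" "B \<subseteq> Pl" and W: "\<And>w. w \<in> W \<Longrightarrow> bpol d w" "\<And>w v. w \<in> W \<Longrightarrow> v \<in> A \<Longrightarrow> w v = 0"
  shows "hilbert d A * card (restr B W) \<le> hilbert d B"
proof -
  define RA where "RA = restr A (Collect (bpol d))"
  define ext where "ext = (\<lambda>u. SOME f. bpol d f \<and> restrict f A = u)"
  have ext: "bpol d (ext u) \<and> restrict (ext u) A = u" if "u \<in> RA" for u
  proof -
    have "\<exists>f. bpol d f \<and> restrict f A = u" using that unfolding RA_def restr_def by blast
    then show ?thesis unfolding ext_def by (rule someI_ex)
  qed
  define \<Phi> where "\<Phi> = (\<lambda>(u, w). \<lambda>v\<in>B. ext u v + w v)"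
  have "card (RA \<times> restr B W) \<le> card (restr B (Collect (bpol d)))"
  proof (rule card_inj_on_le)
    show "inj_on \<Phi> (RA \<times> restr B W)"
    proof (rule inj_onI)
      fix p p' assume "p \<in> RA \<times> restr B W" "p' \<in> RA \<times> restr B W" and eq: "\<Phi> p = \<Phi> p'"
      then obtain u w u' w' where p: "p = (u, restrict w B)" "p' = (u', restrict w' B)" "u \<in> RA" "u' \<in> RA" "w \<in> W" "w' \<in> W"
        by (auto simp: restr_def)
      have pw: "ext u v + w v = ext u' v + w' v" if "v \<in> B" for v
        using fun_cong[OF eq, of v] that by (simp add: p \<Phi>_def)
      have "restrict (ext u) A = restrict (ext u') A"
        unfolding restrict_eq_iff using pw W(2) p AB(1) by (metis add_0_right subsetD)
      then have "u = u'" using ext p by metis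
      then show "p = p'" using pw by (simp add: p restrict_eq_iff)
    qed
    show "\<Phi> ` (RA \<times> restr B W) \<subseteq> restr B (Collect (bpol d))"
    proof
      fix h assume "h \<in> \<Phi> ` (RA \<times> restr B W)"
      then obtain u w where *: "u \<in> RA" "w \<in> W" "h = \<Phi> (u, restrict w B)" by (auto simp: restr_def)
      then have "h = restrict (\<lambda>v. ext u v + w v) B" by (auto simp: \<Phi>_def fun_eq_iff)
      moreover have "bpol d (\<lambda>v. ext u v + w v)" using ext W * by (intro bpol.add) auto
      ultimately show "h \<in> restr B (Collect (bpol d))" by (auto simp: restr_def)
    qed
    show "finite (restr B (Collect (bpol d)))" by (rule finite_restr[OF AB(2), of _ d]) simp
  qed
  then show ?thesis by (simp add: hilbert_def RA_def card_cartesian_product)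
qed

lemma hilbert_mono: "A \<subseteq> B \<Longrightarrow> B \<subseteq> Pl \<Longrightarrow> hilbert d A \<le> hilbert d B"
  using hilbert_mult_le[of A B "{\<lambda>v. 0}" d] bpol.const[OF zero_in] by (simp add: restr_def)

text \<open>On \<open>S\<close> the factor \<open>p\<close> can be divided out, so the products
  determine all functions on \<open>S\<close>.\<close>

lemma hilbert_le_card_mult:
  assumes "S \<subseteq> B" "B \<subseteq> Pl" "bpol m p" "\<And>v. v \<in> S \<Longrightarrow> p v \<noteq> 0"
  shows "hilbert d S \<le> card (restr B ((\<lambda>u v. p v * u v) ` Collect (bpol d)))"
proof -
  let ?W = "(\<lambda>u v. p v * u v) ` Collect (bpol d)"
  define \<Phi> where "\<Phi> = (\<lambda>h. \<lambda>v\<in>S. ivs (p v) * h v)"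
  have "restr S (Collect (bpol d)) \<subseteq> \<Phi> ` restr B ?W"
  proof
    fix h assume "h \<in> restr S (Collect (bpol d))"
    then obtain u where u: "bpol d u" "h = restrict u S" by (auto simp: restr_def)
    have "h = \<Phi> (restrict (\<lambda>v. p v * u v) B)"
    proof
      fix v show "h v = \<Phi> (restrict (\<lambda>v. p v * u v) B) v"
      proof (cases "v \<in> S")
        case True
        then have v: "v \<in> B" "v \<in> Pl" using assms by auto
        have "ivs (p v) * (p v * u v) = (ivs (p v) * p v) * u v" by (simp add: mult.assoc)
        then show ?thesis using True v bpol_closed[OF assms(3) v(2)] bpol_closed[OF u(1) v(2)] assms(4)[OF True]
          by (simp add: u \<Phi>_def)
      qed (simp add: u \<Phi>_def)
    qed
    then show "h \<in> \<Phi> ` restr B ?W" using u by (auto simp: restr_def)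
  qed
  moreover have "finite (restr B ?W)"
    by (rule finite_restr[OF assms(2), of _ "m + d"]) (use assms(3) bpol_mult in auto)
  ultimately show ?thesis unfolding hilbert_def by (rule surj_card_le[rotated])
qed

lemma card_restr_cmult:
  assumes B: "B \<subseteq> Pl" and g: "bpol m g" and a: "a \<in> B" "g a \<noteq> 0"
  shows "card (restr B ((\<lambda>c v. c * g v) ` K)) = card K"
proof -
  have "inj_on (\<lambda>c. restrict (\<lambda>v. c * g v) B) K"
  proof (rule inj_onI)
    fix c d assume cd: "c \<in> K" "d \<in> K" "restrict (\<lambda>v. c * g v) B = restrict (\<lambda>v. d * g v) B"
    then have "g a * c = g a * d" using a by (simp add: restrict_eq_iff mult.commute)
    moreover have "g a \<in> K" using bpol_closed[OF g] a B by auto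
    ultimately show "c = d" using cancel_left[of "g a" c d] cd a by simp
  qed
  then show ?thesis by (simp add: restr_def image_image card_image)
qed

lemma separating_poly:
  "finite A \<Longrightarrow> A \<subseteq> Pl \<Longrightarrow> a \<in> Pl \<Longrightarrow> a \<notin> A \<Longrightarrow> \<exists>g. bpol (card A) g \<and> (\<forall>v\<in>A. g v = 0) \<and> g a \<noteq> 0"
proof (induct A rule: finite_induct)
  case empty
  then show ?case using bpol.const[OF e_in] by (intro exI[of _ "\<lambda>v. e"]) auto
next
  case (insert b A)
  then obtain g where g: "bpol (card A) g" "\<forall>v\<in>A. g v = 0" "g a \<noteq> 0" by auto
  have ex: "\<exists>l. bpol 1 l \<and> l b = 0 \<and> l a \<noteq> 0"
  proof (cases "fst a = fst b")
    case False
    then show ?thesis using insert bpol_diff[OF bpol_fst bpol.const[of "fst b"]]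
      by (intro exI[of _ "\<lambda>v. fst v - fst b"]) auto
  next
    case True
    then have "snd a \<noteq> snd b" using insert by (auto simp: prod_eq_iff)
    then show ?thesis using insert bpol_diff[OF bpol_snd bpol.const[of "snd b"]]
      by (intro exI[of _ "\<lambda>v. snd v - snd b"]) auto
  qed
  then obtain l where l: "bpol 1 l" "l b = 0" "l a \<noteq> 0" by blast
  have "bpol (card (insert b A)) (\<lambda>v. l v * g v)" using bpol_mult[OF l(1) g(1)] insert by simp
  moreover have "l a * g a \<noteq> 0" using l g bpol_closed[OF l(1)] bpol_closed[OF g(1)] insert by simp
  moreover have "\<forall>v\<in>insert b A. l v * g v = 0" using l g by simp
  ultimately show ?case by blast
qed

text \<open>At most \<open>d + 1\<close> points impose independent conditions in degree
  \<open>d\<close>: for each new point the scalar multiples of a polynomial separating it from the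
  earlier ones are added.\<close>

lemma hilbert_points: "finite A \<Longrightarrow> A \<subseteq> Pl \<Longrightarrow> card A \<le> Suc d \<Longrightarrow> card K ^ card A \<le> hilbert d A"
proof (induct A rule: finite_induct)
  case empty
  have "restr {} (Collect (bpol d)) = {\<lambda>v. undefined}" using bpol.const[OF e_in] by (auto simp: restr_def restrict_def)
  then show ?case by (simp add: hilbert_def)
next
  case (insert a A)
  obtain g where g: "bpol (card A) g" "\<forall>v\<in>A. g v = 0" "g a \<noteq> 0" using separating_poly[of A a] insert by auto
  have "hilbert d A * card (restr (insert a A) ((\<lambda>c v. c * g v) ` K)) \<le> hilbert d (insert a A)"
  proof (rule hilbert_mult_le)
    show "bpol d w" if "w \<in> (\<lambda>c v. c * g v) ` K" for w
      using that insert bpol_mono[OF bpol_cmult[OF g(1)]] by auto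
  qed (use insert g in auto)
  then have "hilbert d A * card K \<le> hilbert d (insert a A)"
    using card_restr_cmult[OF insert(4) g(1), of a] g by simp
  moreover have "card K ^ card A * card K \<le> hilbert d A * card K" using insert by simp
  moreover have "card K ^ card (insert a A) = card K ^ card A * card K" using insert by simp
  ultimately show ?case by (metis order_trans)
qed

lemma hilbert_ge:
  assumes "S \<subseteq> Pl" "Suc d \<le> card S"
  shows "card K ^ Suc d \<le> hilbert d S"
proof -
  obtain A where A: "A \<subseteq> S" "card A = Suc d" "finite A" using obtain_subset_with_card_n[OF assms(2)] by blast
  then have "card K ^ Suc d \<le> hilbert d A" using hilbert_points[of A d] assms(1) by (simp del: power_Suc)
  also have "\<dots> \<le> hilbert d S" using A(1) assms(1) by (rule hilbert_mono)
  finally show ?thesis .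
qed

text \<open>A row with enough points contributes the \<open>d + 1\<close> dimensions of polynomials
  in one variable. Multiples of \<open>snd v - y\<close> vanish on it, and they carry the remaining
  rows in degree one less; the dimensions add up to \<open>tri d\<close>.\<close>

lemma hilbert_rows:
  assumes "Xa \<subseteq> Pl" "Y \<subseteq> K" "Suc d \<le> card Y" "\<And>y. y \<in> Y \<Longrightarrow> Suc d \<le> card {v\<in>Xa. snd v = y}"
  shows "card K ^ tri d \<le> hilbert d Xa"
  using assms
proof (induct d arbitrary: Xa Y)
  case 0
  then have "Y \<noteq> {}" by auto
  then obtain y where y: "y \<in> Y" by blast
  have "{v\<in>Xa. snd v = y} \<subseteq> Pl" using 0 by auto
  from hilbert_ge[OF this 0(4)[OF y]] show ?case using hilbert_mono[of "{v\<in>Xa. snd v = y}" Xa 0] 0(1) by simp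
next
  case (Suc d)
  have finY: "finite Y" using Suc finK finite_subset by blast
  have "Y \<noteq> {}" using Suc(4) by auto
  then obtain y where y: "y \<in> Y" by blast
  have yK: "y \<in> K" using y Suc by auto
  define A where "A = {v\<in>Xa. snd v = y}"
  have A: "A \<subseteq> Xa" "A \<subseteq> Pl" "Suc (Suc d) \<le> card A" using Suc y by (auto simp: A_def)
  define p where "p = (\<lambda>v::'a \<times> 'a. snd v - y)"
  have p: "bpol 1 p" unfolding p_def by (intro bpol_diff bpol_snd bpol.const yK)
  have "card K ^ tri d \<le> hilbert d (Xa - A)"
  proof (rule Suc(1))
    show "Suc d \<le> card (Y - {y})" using Suc(4) y finY by simp
    fix z assume z: "z \<in> Y - {y}"
    then have "{v \<in> Xa - A. snd v = z} = {v\<in>Xa. snd v = z}" by (auto simp: A_def)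
    then show "Suc d \<le> card {v \<in> Xa - A. snd v = z}" using Suc(5)[of z] z by simp
  qed (use Suc in auto)
  also have "\<dots> \<le> card (restr Xa ((\<lambda>u v. p v * u v) ` Collect (bpol d)))"
    by (rule hilbert_le_card_mult[OF _ Suc(2) p]) (auto simp: A_def p_def)
  finally have "card K ^ Suc (Suc d) * card K ^ tri d \<le> hilbert (Suc d) A * card (restr Xa ((\<lambda>u v. p v * u v) ` Collect (bpol d)))"
    by (intro mult_le_mono hilbert_ge A)
  also have "\<dots> \<le> hilbert (Suc d) Xa"
    by (rule hilbert_mult_le[OF A(1) Suc(2)]) (use bpol_mult[OF p] in \<open>auto simp: A_def p_def\<close>)
  finally show ?case by (simp add: power_add mult_ac)
qed

lemma hilbert_Pl_le: "hilbert d Pl \<le> card K ^ tri d"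
proof (induct d)
  case 0
  have "restr Pl (Collect (bpol 0)) \<subseteq> (\<lambda>c. \<lambda>v\<in>Pl. c) ` K"
  proof
    fix h assume "h \<in> restr Pl (Collect (bpol 0))"
    then obtain f where f: "bpol 0 f" "h = restrict f Pl" by (auto simp: restr_def)
    have "f v = f 0" if "v \<in> Pl" for v
      using bpol_difference[OF f(1) that] zero_in_pl by (metis add_0)
    then have "h = (\<lambda>v\<in>Pl. f 0)" unfolding f(2) restrict_eq_iff by blast
    then show "h \<in> (\<lambda>c. \<lambda>v\<in>Pl. c) ` K" using bpol_closed[OF f(1) zero_in_pl] by blast
  qed
  then have "card (restr Pl (Collect (bpol 0))) \<le> card K" by (rule surj_card_le[OF finK])
  then show ?case by (simp add: hilbert_def)
next
  case (Suc d)
  define R where "R = (\<lambda>f. restrict f K) ` upol K (Suc d)"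
  define R' where "R' = restr Pl (Collect (bpol d))"
  define \<Phi> where "\<Phi> = (\<lambda>(u, g). \<lambda>v\<in>Pl. u (fst v) + snd v * g v)"
  have "restr Pl (Collect (bpol (Suc d))) \<subseteq> \<Phi> ` (R \<times> R')"
  proof
    fix h assume "h \<in> restr Pl (Collect (bpol (Suc d)))"
    then obtain f where f: "bpol (Suc d) f" "h = restrict f Pl" by (auto simp: restr_def)
    then obtain u g where *: "u \<in> upol K (Suc d)" "bpol d g" "\<forall>v\<in>Pl. f v = u (fst v) + snd v * g v"
      using bpol_decompose[OF f(1)] by auto
    have "h = \<Phi> (restrict u K, restrict g Pl)"
      unfolding f(2) \<Phi>_def prod.case restrict_eq_iff using *(3) by (auto simp: mem_Times_iff)
    moreover have "(restrict u K, restrict g Pl) \<in> R \<times> R'" using * unfolding R_def R'_def restr_def by blast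
    ultimately show "h \<in> \<Phi> ` (R \<times> R')" by blast
  qed
  moreover have fin: "finite R" "finite R'"
    using upol_card[OF finK, of "Suc d"] finite_restr[of Pl "Collect (bpol d)" d]
    unfolding R_def R'_def by blast+
  ultimately have "hilbert (Suc d) Pl \<le> card R * card R'"
    unfolding hilbert_def card_cartesian_product[symmetric] by (intro surj_card_le) auto
  also have "\<dots> \<le> card K ^ Suc (Suc d) * card K ^ tri d"
    using Suc upol_card[OF finK, of "Suc d"] unfolding R_def R'_def hilbert_def by (intro mult_le_mono) blast+
  finally show ?case by (simp add: power_add mult_ac)
qed

text \<open>The products \<open>f * u\<close> with \<open>u\<close> of degree \<open>d - n\<close>
  vanish on the curve. Since \<open>d < card K\<close>, the complement of the curve has enough
  points in enough rows for them to fill \<open>tri (d - n)\<close> dimensions. At most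
  \<open>tri d - tri (d - n) \<le> n * (d + 1)\<close> dimensions are left for the curve.\<close>

lemma hilbert_zeros_le:
  assumes f: "bpol n f" "w \<in> Pl" "f w \<noteq> 0" and d: "n \<le> d" "d < card K"
  shows "hilbert d {v\<in>Pl. f v = 0} \<le> card K ^ (n * (d + 1))"
proof -
  define Z where "Z = {v\<in>Pl. f v = 0}"
  define Y where "Y = {y\<in>K. f (fst w, y) \<noteq> 0}"
  have many: "Suc (d - n) \<le> card {x\<in>K. u x \<noteq> 0}" if u: "u \<in> upol K n" "x \<in> K" "u x \<noteq> 0" for u x
  proof -
    have "card {x\<in>K. u x = 0} \<le> n" using upol_vanish[OF u(1) subset_refl _ u(2)] u(3) by (meson not_le)
    moreover have "card K = card {x\<in>K. u x = 0} + card {x\<in>K. u x \<noteq> 0}"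
      by (subst card_Un_disjoint[symmetric]) (use finK in \<open>auto intro: arg_cong[of _ _ card]\<close>)
    ultimately show ?thesis using d by linarith
  qed
  have "card K ^ tri (d - n) \<le> hilbert (d - n) (Pl - Z)"
  proof (rule hilbert_rows)
    show "Suc (d - n) \<le> card Y" unfolding Y_def
      by (rule many[OF bpol_column[OF f(1), of "fst w"], of "snd w"]) (use f in \<open>auto simp: mem_Times_iff\<close>)
    fix y assume y: "y \<in> Y"
    have "Suc (d - n) \<le> card {x\<in>K. f (x, y) \<noteq> 0}"
      by (rule many[OF bpol_row[OF f(1)], of _ "fst w"]) (use y f in \<open>auto simp: Y_def mem_Times_iff\<close>)
    also have "\<dots> = card ((\<lambda>x. (x, y)) ` {x\<in>K. f (x, y) \<noteq> 0})"
      by (rule card_image[symmetric]) (auto simp: inj_on_def)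
    also have "(\<lambda>x. (x, y)) ` {x\<in>K. f (x, y) \<noteq> 0} = {v \<in> Pl - Z. snd v = y}"
      using y by (auto simp: Z_def Y_def)
    finally show "Suc (d - n) \<le> card {v \<in> Pl - Z. snd v = y}" .
  qed (auto simp: Y_def)
  also have "\<dots> \<le> card (restr Pl ((\<lambda>u v. f v * u v) ` Collect (bpol (d - n))))"
    by (rule hilbert_le_card_mult[OF _ _ f(1)]) (auto simp: Z_def)
  finally have "hilbert d Z * card K ^ tri (d - n) \<le> hilbert d Z * card (restr Pl ((\<lambda>u v. f v * u v) ` Collect (bpol (d - n))))"
    by simp
  also have "\<dots> \<le> hilbert d Pl"
  proof (rule hilbert_mult_le)
    show "bpol d w" if "w \<in> (\<lambda>u v. f v * u v) ` Collect (bpol (d - n))" for w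
      using that bpol_mult[OF f(1), of "d - n"] d by auto
  qed (auto simp: Z_def)
  also have "\<dots> \<le> card K ^ tri d" by (rule hilbert_Pl_le)
  also have "\<dots> \<le> card K ^ (n * (d + 1) + tri (d - n))"
    using tri_add_le[of "d - n" n] d card_K by (intro power_increasing) auto
  finally have "hilbert d Z * card K ^ tri (d - n) \<le> card K ^ (n * (d + 1)) * card K ^ tri (d - n)"
    by (simp add: power_add)
  then show ?thesis using card_K unfolding Z_def by simp
qed

end

section \<open>Translates of plane curves\<close>

text \<open>The first factor is the size \<open>2 * (d + 1)\<close> demanded of a piece, with
  \<open>d = n * n * (n + 1)\<close> from \<open>card_van_ideals_le\<close>. Each of the at most
  \<open>tri n\<close> steps of \<open>ex_irr\<close> may cost a factor
  \<open>2 * (n + 1)\<close>.\<close>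

definition irr_bound :: "nat \<Rightarrow> nat" where
  "irr_bound n = 2 * (n * n * (n + 1) + 1) * (2 * (n + 1)) ^ tri n"

context finite_subfld
begin

definition van_ideal :: "nat \<Rightarrow> ('a \<times> 'a) set \<Rightarrow> ('a \<times> 'a \<Rightarrow> 'a) set" where
  "van_ideal n S = {g. bpol n g \<and> (\<forall>v\<in>S. g v = 0)}"

text \<open>The factor \<open>2 (n + 1)\<close> ensures that \<open>n\<close> polynomials, none of which vanishes on \<open>S\<close>, have zeros on
  at most half of \<open>S\<close>.\<close>

definition irr :: "nat \<Rightarrow> nat \<Rightarrow> ('a \<times> 'a) set \<Rightarrow> bool" where
  "irr n L S \<longleftrightarrow> S \<subseteq> Pl \<and> L \<le> card S \<and>
    (\<forall>g. bpol n g \<longrightarrow> (\<forall>v\<in>S. g v = 0) \<or> 2 * (n + 1) * card {v\<in>S. g v = 0} \<le> card S)"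

definition transl :: "('a \<times> 'a) set \<Rightarrow> 'a \<times> 'a \<Rightarrow> ('a \<times> 'a) set" where
  "transl S t = (\<lambda>v. v + t) ` S"

definition subgrp :: "('a \<times> 'a) set \<Rightarrow> bool" where
  "subgrp G \<longleftrightarrow> G \<subseteq> Pl \<and> 0 \<in> G \<and> (\<forall>g\<in>G. \<forall>h\<in>G. g - h \<in> G)"

text \<open>The substitute for passing to an irreducible component. If some \<open>g\<close>
  vanishes on a sizeable part of \<open>S\<close> but not on all of it, continue with that part: its
  Hilbert exponent is smaller by at least one, since the multiples of \<open>g\<close> are lost. The
  exponent \<open>j\<close> therefore bounds the number of steps.\<close>

lemma ex_irr:
  assumes "S \<subseteq> Pl" "0 < L" "L * (2 * (n + 1)) ^ j \<le> card S" "hilbert n S \<le> card K ^ j"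
  shows "\<exists>S'\<subseteq>S. irr n L S'"
  using assms
proof (induct j arbitrary: S)
  case 0
  then have "Suc 0 \<le> card S" by simp
  then have "card K ^ Suc 0 \<le> hilbert 0 S" using hilbert_ge[OF 0(1), of 0] by simp
  also have "\<dots> \<le> hilbert n S" unfolding hilbert_def
    by (rule card_mono[OF finite_restr[OF 0(1), of _ n]]) (use bpol_mono in \<open>auto simp: restr_def\<close>)
  finally show ?case using 0(4) card_K by simp
next
  case (Suc j)
  have finS: "finite S" using Suc(2) finite_Pl finite_subset by blast
  have "1 \<le> (2 * (n + 1)) ^ Suc j" by (rule one_le_power) simp
  then have "L * 1 \<le> L * (2 * (n + 1)) ^ Suc j" by (rule mult_le_mono2)
  then have LS: "L \<le> card S" using Suc(4) unfolding mult_1_right by (rule le_trans)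
  show ?case
  proof (cases "irr n L S")
    case False
    then obtain g where g: "bpol n g" "\<not> (\<forall>v\<in>S. g v = 0)" "card S < 2 * (n + 1) * card {v\<in>S. g v = 0}"
      using Suc(2) LS unfolding irr_def by (meson not_le)
    define S' where "S' = {v\<in>S. g v = 0}"
    obtain a where a: "a \<in> S" "g a \<noteq> 0" using g by blast
    have S': "S' \<subseteq> S" "S' \<subseteq> Pl" using Suc(2) by (auto simp: S'_def)
    have "hilbert n S' * card (restr S ((\<lambda>c v. c * g v) ` K)) \<le> hilbert n S"
      by (rule hilbert_mult_le[OF S'(1) Suc(2)]) (use bpol_cmult[OF g(1)] in \<open>auto simp: S'_def\<close>)
    then have "hilbert n S' * card K \<le> hilbert n S" using card_restr_cmult[OF Suc(2) g(1) a] by simp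
    also have "\<dots> \<le> card K ^ j * card K" using Suc(5) by (simp add: mult.commute)
    finally have "hilbert n S' \<le> card K ^ j" using card_K by simp
    moreover have "L * (2 * (n + 1)) ^ j \<le> card S'"
    proof -
      have "(2 * (n + 1)) * (L * (2 * (n + 1)) ^ j) \<le> (2 * (n + 1)) * card S'"
        using Suc(4) g(3) unfolding S'_def by (simp only: power_Suc mult_ac)
      then show ?thesis by (simp only: mult_le_cancel1) simp
    qed
    ultimately show ?thesis using Suc(1)[OF S'(2) Suc(3)] S'(1) by blast
  qed auto
qed

lemma in_van_ideal_transl: "g \<in> van_ideal n (transl S t) \<longleftrightarrow> bpol n g \<and> (\<forall>v\<in>S. g (v + t) = 0)"
  by (auto simp: van_ideal_def transl_def)

lemma van_ideal_transl_cong: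
  assumes "van_ideal n S = van_ideal n S'" "t \<in> Pl"
  shows "van_ideal n (transl S t) = van_ideal n (transl S' t)"
proof -
  have "g \<in> van_ideal n (transl S t) \<longleftrightarrow> g \<in> van_ideal n (transl S' t)" if "bpol n g" for g
  proof -
    have "bpol n (\<lambda>v. g (v + t))" using bpol_shift[OF that assms(2)] .
    then have "(\<lambda>v. g (v + t)) \<in> van_ideal n S \<longleftrightarrow> (\<lambda>v. g (v + t)) \<in> van_ideal n S'" using assms(1) by simp
    then show ?thesis using that \<open>bpol n (\<lambda>v. g (v + t))\<close> by (auto simp: transl_def van_ideal_def)
  qed
  then show ?thesis by (auto simp: van_ideal_def)
qed

lemma transl_transl: "transl (transl S s) t = transl S (s + t)"
  by (auto simp: transl_def image_image add.assoc)

lemma transl_0 [simp]: "transl S 0 = S"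
  by (simp add: transl_def)

lemma irr_transl:
  assumes "irr n L S" "t \<in> Pl"
  shows "irr n L (transl S t)"
  unfolding irr_def
proof (intro conjI allI impI)
  have inj: "inj_on (\<lambda>v. v + t) A" for A by (auto simp: inj_on_def)
  show "transl S t \<subseteq> Pl" using assms plus_in_pl by (auto simp: irr_def transl_def)
  have c: "card (transl S t) = card S" unfolding transl_def by (rule card_image[OF inj])
  then show "L \<le> card (transl S t)" using assms by (simp add: irr_def)
  fix g assume g: "bpol n g"
  have "{v \<in> transl S t. g v = 0} = (\<lambda>v. v + t) ` {v\<in>S. g (v + t) = 0}" by (auto simp: transl_def)
  then have "card {v \<in> transl S t. g v = 0} = card {v\<in>S. g (v + t) = 0}" by (simp only: card_image[OF inj])
  moreover have "(\<forall>v\<in>S. g (v + t) = 0) \<or> 2 * (n + 1) * card {v\<in>S. g (v + t) = 0} \<le> card S"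
    using assms(1) bpol_shift[OF g assms(2)] unfolding irr_def by blast
  moreover have "(\<forall>v\<in>transl S t. g v = 0) \<longleftrightarrow> (\<forall>v\<in>S. g (v + t) = 0)" by (auto simp: transl_def)
  ultimately show "(\<forall>v\<in>transl S t. g v = 0) \<or> 2 * (n + 1) * card {v \<in> transl S t. g v = 0} \<le> card (transl S t)"
    by (simp only: c)
qed

text \<open>Sets with different ideals contribute independently, which replaces Bezout's theorem.\<close>

lemma hilbert_Union_irr:
  assumes "finite \<C>" "card \<C> \<le> n + 1" "\<And>S. S \<in> \<C> \<Longrightarrow> irr n (2 * (d + 1)) S" "inj_on (van_ideal n) \<C>" "n * n \<le> d"
  shows "card K ^ (card \<C> * (d - n * n + 1)) \<le> hilbert d (\<Union>\<C>)"
  using assms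
proof (induct "card \<C>" arbitrary: \<C>)
  case 0
  then have "\<C> = {}" by simp
  moreover have "card K ^ 0 \<le> hilbert d {}" using hilbert_points[of "{}" d] by simp
  ultimately show ?case by simp
next
  case (Suc s)
  have "van_ideal n ` \<C> \<noteq> {}" "finite (van_ideal n ` \<C>)" using Suc by auto
  \<comment> \<open>Minimality of the ideal of \<open>S0\<close> supplies, for every other member, a
    polynomial that vanishes there but not identically on \<open>S0\<close>.\<close>
  then obtain I0 where "I0 \<in> van_ideal n ` \<C>" "\<And>I. I \<in> van_ideal n ` \<C> \<Longrightarrow> I \<subseteq> I0 \<Longrightarrow> I = I0"
    using finite_has_minimal[of "van_ideal n ` \<C>"] by metis
  then obtain S0 where S0: "S0 \<in> \<C>" "\<And>S. S \<in> \<C> \<Longrightarrow> van_ideal n S \<subseteq> van_ideal n S0 \<Longrightarrow> van_ideal n S = van_ideal n S0" by auto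
  define \<D> where "\<D> = \<C> - {S0}"
  have \<D>: "finite \<D>" "card \<D> = s" "\<D> \<subseteq> \<C>" "\<Union>\<C> = S0 \<union> \<Union>\<D>" "s \<le> n" using Suc S0 by (auto simp: \<D>_def)
  have "\<exists>g. g \<in> van_ideal n S \<and> g \<notin> van_ideal n S0" if "S \<in> \<D>" for S
  proof (rule ccontr)
    assume "\<not> ?thesis"
    then have "van_ideal n S = van_ideal n S0" using S0(2)[of S] that \<D>(3) by blast
    then show False using that Suc(6) S0(1) unfolding \<D>_def inj_on_def by blast
  qed
  then obtain g where g: "\<And>S. S \<in> \<D> \<Longrightarrow> g S \<in> van_ideal n S \<and> g S \<notin> van_ideal n S0" by metis
  have bg: "bpol n (g S)" if "S \<in> \<D>" for S using g[OF that] by (auto simp: van_ideal_def)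
  \<comment> \<open>The product vanishes on all other members and has degree at most
    \<open>n * n\<close>, which is the loss \<open>d - n * n\<close> in the exponent. Each factor
    kills at most the fraction \<open>1 / (2 * (n + 1))\<close> of \<open>S0\<close>, so at least
    half of \<open>S0\<close> survives.\<close>
  define p where "p = (\<lambda>v. e * (\<Prod>S\<in>\<D>. g S v))"
  have p: "bpol (n * s) p" unfolding p_def \<D>(2)[symmetric] by (rule bpol_prod[OF \<D>(1) bg])
  have irr0: "irr n (2 * (d + 1)) S0" using Suc(5) S0(1) by blast
  then have S0Pl: "S0 \<subseteq> Pl" by (simp add: irr_def)
  have finS0: "finite S0" using S0Pl finite_Pl finite_subset by blast
  have p0: "p v = 0 \<longleftrightarrow> (\<exists>S\<in>\<D>. g S v = 0)" if "v \<in> Pl" for v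
    unfolding p_def using prod_nonzero[OF \<D>(1), of "\<lambda>S. g S v"] bpol_closed[OF bg that] by blast
  define S1 where "S1 = {v\<in>S0. p v \<noteq> 0}"
  have "2 * card {v\<in>S0. p v = 0} \<le> card S0"
  proof -
    have sub: "{v\<in>S0. p v = 0} \<subseteq> (\<Union>S\<in>\<D>. {v\<in>S0. g S v = 0})" using p0 S0Pl by blast
    have "card {v\<in>S0. p v = 0} \<le> card (\<Union>S\<in>\<D>. {v\<in>S0. g S v = 0})"
      by (rule card_mono[OF _ sub]) (use finS0 \<D> in auto)
    also have "\<dots> \<le> (\<Sum>S\<in>\<D>. card {v\<in>S0. g S v = 0})" by (rule card_UN_le[OF \<D>(1)])
    finally have "2 * (n + 1) * card {v\<in>S0. p v = 0} \<le> (\<Sum>S\<in>\<D>. 2 * (n + 1) * card {v\<in>S0. g S v = 0})"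
      unfolding sum_distrib_left[symmetric] by (intro mult_le_mono2)
    also have "\<dots> \<le> (\<Sum>S\<in>\<D>. card S0)"
    proof (rule sum_mono)
      fix S assume S: "S \<in> \<D>"
      have "\<not> (\<forall>v\<in>S0. g S v = 0)" using g[OF S] by (auto simp: van_ideal_def)
      then show "2 * (n + 1) * card {v\<in>S0. g S v = 0} \<le> card S0" using irr0 bg[OF S] unfolding irr_def by blast
    qed
    also have "\<dots> \<le> (n + 1) * card S0" unfolding sum_constant using \<D> by (intro mult_le_mono) auto
    finally have "(n + 1) * (2 * card {v\<in>S0. p v = 0}) \<le> (n + 1) * card S0" by (simp only: mult_ac)
    then show ?thesis by (simp only: mult_le_cancel1)
  qed
  moreover have "card S0 = card {v\<in>S0. p v = 0} + card S1" unfolding S1_def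
    by (subst card_Un_disjoint[symmetric]) (use finS0 in \<open>auto intro: arg_cong[of _ _ card]\<close>)
  moreover have "2 * (d + 1) \<le> card S0" using irr0 by (simp add: irr_def)
  ultimately have "2 * (d + 1) \<le> 2 * card S1" by simp
  then have "Suc d \<le> card S1" by simp
  then have S1: "Suc (d - n * n) \<le> card S1" by (meson Suc_le_mono diff_le_self le_trans)
  have UPl: "\<Union>\<C> \<subseteq> Pl" using Suc(5) by (auto simp: irr_def)
  have "card K ^ Suc (d - n * n) \<le> hilbert (d - n * n) S1"
    by (rule hilbert_ge[OF _ S1]) (use S0Pl in \<open>auto simp: S1_def\<close>)
  also have "\<dots> \<le> card (restr (\<Union>\<C>) ((\<lambda>u v. p v * u v) ` Collect (bpol (d - n * n))))"
    by (rule hilbert_le_card_mult[OF _ UPl p]) (use S0(1) in \<open>auto simp: S1_def\<close>)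
  finally have 1: "card K ^ (d - n * n + 1) \<le> card (restr (\<Union>\<C>) ((\<lambda>u v. p v * u v) ` Collect (bpol (d - n * n))))" by simp
  have "card K ^ (card \<D> * (d - n * n + 1)) \<le> hilbert d (\<Union>\<D>)"
    by (rule Suc(1)) (use Suc \<D> inj_on_subset in auto)
  then have "card K ^ (card \<D> * (d - n * n + 1)) * card K ^ (d - n * n + 1)
    \<le> hilbert d (\<Union>\<D>) * card (restr (\<Union>\<C>) ((\<lambda>u v. p v * u v) ` Collect (bpol (d - n * n))))"
    using 1 by (rule mult_le_mono)
  also have "\<dots> \<le> hilbert d (\<Union>\<C>)"
  proof (rule hilbert_mult_le[OF _ UPl])
    show "\<Union>\<D> \<subseteq> \<Union>\<C>" using \<D> by auto
    fix w assume w: "w \<in> (\<lambda>u v. p v * u v) ` Collect (bpol (d - n * n))"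
    have "n * s \<le> n * n" using \<D>(5) by simp
    then have "n * s + (d - n * n) \<le> d" using Suc(7) by linarith
    then show "bpol d w" using w bpol_mono[OF bpol_mult[OF p]] by auto
    fix v assume "v \<in> \<Union>\<D>"
    then obtain S where "S \<in> \<D>" "v \<in> S" by blast
    moreover from this have "v \<in> Pl" using UPl \<D>(3) by blast
    ultimately have "p v = 0" using p0[of v] g[of S] unfolding van_ideal_def by blast
    then show "w v = 0" using w by auto
  qed
  finally show ?case
    unfolding Suc(2)[symmetric] \<D>(2) mult_Suc power_add by (simp only: mult.commute)
qed

text \<open>With \<open>n + 1\<close> distinct ideals, \<open>hilbert_Union_irr\<close> would give
  the curve at least \<open>(n + 1) * (d - n * n + 1)\<close> dimensions, against at most
  \<open>n * (d + 1)\<close>. For \<open>d = n * n * (n + 1)\<close> the former is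
  \<open>n * d + n + 1\<close>, too large by one; this is the origin of \<open>d\<close>.\<close>

lemma card_van_ideals_le:
  assumes f: "bpol n f" "w \<in> Pl" "f w \<noteq> 0" and d: "d = n * n * (n + 1)" "d < card K"
  shows "finite (van_ideal n ` {S. irr n (2 * (d + 1)) S \<and> (\<forall>v\<in>S. f v = 0)})"
    "card (van_ideal n ` {S. irr n (2 * (d + 1)) S \<and> (\<forall>v\<in>S. f v = 0)}) \<le> n"
proof -
  define Xa where "Xa = {S. irr n (2 * (d + 1)) S \<and> (\<forall>v\<in>S. f v = 0)}"
  have Xa: "Xa \<subseteq> Pow Pl" by (auto simp: Xa_def irr_def)
  show fin: "finite (van_ideal n ` {S. irr n (2 * (d + 1)) S \<and> (\<forall>v\<in>S. f v = 0)})"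
    using finite_subset[OF Xa] finite_Pl unfolding Xa_def by simp
  show "card (van_ideal n ` {S. irr n (2 * (d + 1)) S \<and> (\<forall>v\<in>S. f v = 0)}) \<le> n"
  proof (rule ccontr)
    assume "\<not> ?thesis"
    then have "Suc n \<le> card (van_ideal n ` Xa)" by (simp add: Xa_def)
    then obtain \<I> where \<I>: "\<I> \<subseteq> van_ideal n ` Xa" "card \<I> = Suc n" "finite \<I>"
      using obtain_subset_with_card_n by metis
    then obtain \<C> where \<C>: "\<C> \<subseteq> Xa" "inj_on (van_ideal n) \<C>" "\<I> = van_ideal n ` \<C>" by (metis subset_image_inj)
    then have card\<C>: "card \<C> = Suc n" "finite \<C>" using \<I> card_image[OF \<C>(2)] finite_imageD by auto
    have nd: "n * n \<le> d" unfolding d by simp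
    have "n \<le> n * n" by (cases n) auto
    then have nd': "n \<le> d" using nd by (rule le_trans)
    have "card K ^ (card \<C> * (d - n * n + 1)) \<le> hilbert d (\<Union>\<C>)"
      by (rule hilbert_Union_irr) (use \<C> card\<C> nd in \<open>auto simp: Xa_def\<close>)
    also have "\<dots> \<le> hilbert d {v\<in>Pl. f v = 0}"
    proof (rule hilbert_mono)
      have "S \<subseteq> {v\<in>Pl. f v = 0}" if "S \<in> Xa" for S using that Xa unfolding Xa_def by blast
      then show "\<Union>\<C> \<subseteq> {v\<in>Pl. f v = 0}" using \<C>(1) by blast
    qed blast
    also have "\<dots> \<le> card K ^ (n * (d + 1))" using hilbert_zeros_le[OF f nd' d(2)] .
    finally have "card \<C> * (d - n * n + 1) \<le> n * (d + 1)"
      using card_K by (metis power_le_imp_le_exp less_le_trans one_less_numeral_iff semiring_norm(76))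
    then have "(n + 1) * (d - n * n) + (n + 1) \<le> n * d + n" using card\<C> by (simp add: algebra_simps)
    moreover have "(n + 1) * (d - n * n) = (n + 1) * d - d" unfolding d by (simp add: diff_mult_distrib2 mult_ac)
    ultimately show False by simp
  qed
qed

lemma card_le_fibres:
  assumes "finite A" "finite B" "card B \<le> n" "h ` A \<subseteq> B" "\<And>a. a \<in> A \<Longrightarrow> card {x\<in>A. h x = h a} \<le> m"
  shows "card A \<le> n * m"
proof -
  have "card A = card (\<Union>b\<in>h ` A. {x\<in>A. h x = b})" by (rule arg_cong[of _ _ card]) auto
  also have "\<dots> \<le> (\<Sum>b\<in>h ` A. card {x\<in>A. h x = b})" by (rule card_UN_le) (use assms in simp)
  also have "\<dots> \<le> (\<Sum>b\<in>h ` A. m)" using assms(5) by (intro sum_mono) auto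
  also have "\<dots> \<le> n * m" using card_mono[OF assms(2,4)] assms(3) by simp
  finally show ?thesis .
qed

section \<open>Stabilisers of ideals and cosets on the curve\<close>

text \<open>The ideal has to be preserved, not the point set; this is why arbitrary pieces
  \<open>S\<close> of a curve can have large stabilisers.\<close>

definition stab :: "nat \<Rightarrow> ('a \<times> 'a) set \<Rightarrow> ('a \<times> 'a) set" where
  "stab n S = {t\<in>Pl. van_ideal n (transl S t) = van_ideal n S}"

lemma diff_in_stab:
  assumes S: "van_ideal n S = van_ideal n S'" and t: "t \<in> Pl" "t' \<in> Pl" "van_ideal n (transl S t) = van_ideal n (transl S' t')"
  shows "t - t' \<in> stab n S'"
proof -
  have "van_ideal n (transl S' (t - t')) = van_ideal n (transl S (t - t'))"
    by (rule van_ideal_transl_cong[OF S[symmetric]]) (use t minus_in_pl in auto)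
  also have "\<dots> = van_ideal n (transl (transl S t) (- t'))" by (simp add: transl_transl)
  also have "\<dots> = van_ideal n (transl (transl S' t') (- t'))" by (rule van_ideal_transl_cong[OF t(3)]) (use t uminus_in_pl in auto)
  also have "\<dots> = van_ideal n S'" by (simp add: transl_transl)
  finally show ?thesis using t minus_in_pl by (auto simp: stab_def)
qed

lemma subgrp_stab: "subgrp (stab n S)"
  unfolding subgrp_def
proof (intro conjI ballI)
  show "0 \<in> stab n S" by (simp add: stab_def zero_in_pl)
  show "g - h \<in> stab n S" if "g \<in> stab n S" "h \<in> stab n S" for g h
    using that by (intro diff_in_stab) (auto simp: stab_def)
qed (auto simp: stab_def)

lemma stab_vanish:
  assumes "f \<in> van_ideal n S" "v \<in> S" "t \<in> stab n S" shows "f (v + t) = 0"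
  using assms in_van_ideal_transl[of f n S t] by (auto simp: stab_def)

text \<open>All translates of \<open>S\<close> by \<open>G\<close> lie on the curve, so their ideals
  fall into at most \<open>n\<close> classes, and translations in one class differ by elements of
  the stabiliser.\<close>

lemma card_le_stab:
  assumes f: "bpol n f" "w \<in> Pl" "f w \<noteq> 0" and d: "d = n * n * (n + 1)" "d < card K"
    and S: "irr n (2 * (d + 1)) S" and G: "G \<subseteq> Pl" "\<And>v t. v \<in> S \<Longrightarrow> t \<in> G \<Longrightarrow> f (v + t) = 0"
  shows "card G \<le> n * card (stab n S)"
proof (rule card_le_fibres[OF _ card_van_ideals_le[OF f d]])
  show "finite G" using G finite_Pl finite_subset by blast
  show "(\<lambda>t. van_ideal n (transl S t)) ` G \<subseteq> van_ideal n ` {S. irr n (2 * (d + 1)) S \<and> (\<forall>v\<in>S. f v = 0)}"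
    using G irr_transl[OF S] by (intro image_subsetI imageI) (auto simp: transl_def)
  fix t assume t: "t \<in> G"
  have "inj_on (\<lambda>x. x - t) {x\<in>G. van_ideal n (transl S x) = van_ideal n (transl S t)}" by (auto simp: inj_on_def)
  moreover have "(\<lambda>x. x - t) ` {x\<in>G. van_ideal n (transl S x) = van_ideal n (transl S t)} \<subseteq> stab n S"
    using diff_in_stab[OF refl, of _ t n S] t G(1) by blast
  moreover have "finite (stab n S)" using finite_Pl by (auto simp: stab_def)
  ultimately show "card {x\<in>G. van_ideal n (transl S x) = van_ideal n (transl S t)} \<le> card (stab n S)"
    by (rule card_inj_on_le)
qed

text \<open>A polynomial of minimal degree vanishing on a coset \<open>v0 + T\<close> is \<open>T\<close>-periodic because its
  differences have smaller degree; the same argument in the other variable makes it additive.\<close>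

lemma minimal_poly_additive:
  assumes T: "subgrp T" and v0: "v0 \<in> Pl"
    and f: "bpol n f" "w \<in> Pl" "f w \<noteq> 0" "\<And>t. t \<in> T \<Longrightarrow> f (v0 + t) = 0"
  obtains P w' where "bpol n P" "w' \<in> Pl" "P w' \<noteq> 0" "\<And>t. t \<in> T \<Longrightarrow> P (v0 + t) = 0"
    "\<And>x y. x \<in> Pl \<Longrightarrow> y \<in> Pl \<Longrightarrow> P (v0 + (x + y)) = P (v0 + x) + P (v0 + y)"
proof -
  define good where "good = (\<lambda>d. \<exists>P. bpol d P \<and> (\<forall>t\<in>T. P (v0 + t) = 0) \<and> (\<exists>w\<in>Pl. P w \<noteq> 0))"
  define d where "d = (LEAST d. good d)"
  have gn: "good n" unfolding good_def using f by blast
  then have "good d" and dn: "d \<le> n" unfolding d_def by (rule LeastI, rule Least_le)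
  then obtain P w' where P: "bpol d P" "\<And>t. t \<in> T \<Longrightarrow> P (v0 + t) = 0" "w' \<in> Pl" "P w' \<noteq> 0"
    unfolding good_def by blast
  have T0: "0 \<in> T" "T \<subseteq> Pl" using T by (auto simp: subgrp_def)
  have Tadd: "s + t \<in> T" if "s \<in> T" "t \<in> T" for s t
  proof -
    have "0 - t \<in> T" using T that(2) T0(1) unfolding subgrp_def by blast
    then have "s - (0 - t) \<in> T" using T that(1) unfolding subgrp_def by blast
    then show ?thesis by simp
  qed
  have Pv0: "P v0 = 0" using P(2)[OF T0(1)] by simp
  have "d \<noteq> 0"
  proof
    assume "d = 0"
    then have "P (v0 + (w' - v0)) = P v0"
      using bpol_difference[OF P(1), of "w' - v0"] minus_in_pl[OF P(3) v0] v0 by blast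
    then show False using P(4) Pv0 by simp
  qed
  then obtain d' where d': "d = Suc d'" by (cases d) auto
  have not_good: "\<not> good d'" using not_less_Least[of d' good] unfolding d_def[symmetric] d' by simp
  have min: "g v = 0" if "bpol d' g" "\<And>t. t \<in> T \<Longrightarrow> g (v0 + t) = 0" "v \<in> Pl" for g v
    using not_good that unfolding good_def by blast
  have vt: "v0 + t \<in> Pl" if "t \<in> T" for t using that T0 v0 plus_in_pl by blast
  have per: "P (v + t) = P v" if "t \<in> T" "v \<in> Pl" for t v
  proof -
    have "P (v + t) - P v = 0"
    proof (rule min[where g = "\<lambda>v. P (v + t) - P v" and v = v])
      show "bpol d' (\<lambda>v. P (v + t) - P v)" using bpol_difference[OF P(1), of t] that T0 by (auto simp: d')
      show "P (v0 + s + t) - P (v0 + s) = 0" if "s \<in> T" for s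
        using P(2)[OF Tadd[OF that \<open>t \<in> T\<close>]] P(2)[OF that] by (simp add: add.assoc)
    qed (use that in simp)
    then show ?thesis by simp
  qed
  have addi: "P (v0 + (x + y)) = P (v0 + x) + P (v0 + y)" if "x \<in> Pl" "y \<in> Pl" for x y
  proof -
    have vx: "v0 + x \<in> Pl" using v0 that plus_in_pl by blast
    have "(P (v0 + y + x) - P (v0 + y)) - P (v0 + x) = 0"
    proof (rule min[where g = "\<lambda>v. (P (v + x) - P v) - P (v0 + x)" and v = "v0 + y"])
      show "bpol d' (\<lambda>v. (P (v + x) - P v) - P (v0 + x))"
        by (rule bpol_diff[OF _ bpol.const[OF bpol_closed[OF P(1) vx]]])
          (use bpol_difference[OF P(1), of x] that in \<open>simp add: d'\<close>)
      show "P (v0 + t + x) - P (v0 + t) - P (v0 + x) = 0" if "t \<in> T" for t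
        using per[OF that vx] P(2)[OF that] by (simp add: ac_simps)
      show "v0 + y \<in> Pl" using v0 that plus_in_pl by blast
    qed
    then show ?thesis by (simp add: algebra_simps)
  qed
  show thesis by (rule that[OF bpol_mono[OF P(1) dn] P(3,4,2) addi])
qed

lemma ex_irr_bound:
  assumes "S \<subseteq> Pl" "irr_bound n \<le> card S"
  shows "\<exists>S'\<subseteq>S. irr n (2 * (n * n * (n + 1) + 1)) S'"
proof (rule ex_irr[OF assms(1)])
  show "hilbert n S \<le> card K ^ tri n" using hilbert_mono[OF assms(1) subset_refl, of n] hilbert_Pl_le[of n] by simp
qed (use assms in \<open>auto simp: irr_bound_def\<close>)

text \<open>The additive \<open>P\<close> takes at most \<open>q\<close> values on
  \<open>q^2\<close> points, so its kernel \<open>H\<close> has at least \<open>q\<close> elements.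
  As \<open>f\<close> may fail to vanish on \<open>H\<close>, a detour is made through a piece
  \<open>S\<close> of the coset: translates of \<open>S\<close> by \<open>H\<close> stay among the
  zeros of \<open>P\<close>, so \<open>card_le_stab\<close> gives \<open>S\<close> a stabiliser of
  order at least \<open>q / n\<close>, and this stabiliser respects every polynomial of degree
  \<open>n\<close> vanishing on \<open>S\<close>, among them \<open>f\<close>.\<close>

lemma large_coset:
  assumes T: "subgrp T" and v0: "v0 \<in> Pl" and f: "bpol n f" "w \<in> Pl" "f w \<noteq> 0" "\<And>t. t \<in> T \<Longrightarrow> f (v0 + t) = 0"
    and q: "n * n * (n + 1) < card K" and big: "irr_bound n \<le> card T"
  shows "\<exists>G v. subgrp G \<and> v \<in> Pl \<and> (\<forall>t\<in>G. f (v + t) = 0) \<and> card K \<le> n * card G"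
proof -
  define d where "d = n * n * (n + 1)"
  obtain P w' where P: "bpol n P" "w' \<in> Pl" "P w' \<noteq> 0" "\<And>t. t \<in> T \<Longrightarrow> P (v0 + t) = 0"
    "\<And>x y. x \<in> Pl \<Longrightarrow> y \<in> Pl \<Longrightarrow> P (v0 + (x + y)) = P (v0 + x) + P (v0 + y)"
    using minimal_poly_additive[OF T v0 f] by metis
  define H where "H = {h\<in>Pl. P (v0 + h) = 0}"
  have TPl: "T \<subseteq> Pl" using T by (simp add: subgrp_def)
  have "transl T v0 \<subseteq> Pl" using TPl v0 plus_in_pl by (auto simp: transl_def)
  moreover have "card (transl T v0) = card T" unfolding transl_def by (rule card_image) (auto simp: inj_on_def)
  ultimately obtain S where S: "S \<subseteq> transl T v0" "irr n (2 * (d + 1)) S"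
    using ex_irr_bound[of "transl T v0" n] big unfolding d_def by auto
  have "card Pl \<le> card K * card H"
  proof (rule card_le_fibres[where h = "\<lambda>x. P (v0 + x)", OF finite_Pl finK order_refl])
    show "(\<lambda>x. P (v0 + x)) ` Pl \<subseteq> K" using bpol_closed[OF P(1)] plus_in_pl[OF v0] by blast
    fix a assume a: "a \<in> Pl"
    have "inj_on (\<lambda>x. x - a) {x\<in>Pl. P (v0 + x) = P (v0 + a)}" by (auto simp: inj_on_def)
    moreover have "(\<lambda>x. x - a) ` {x\<in>Pl. P (v0 + x) = P (v0 + a)} \<subseteq> H"
    proof
      fix y assume "y \<in> (\<lambda>x. x - a) ` {x\<in>Pl. P (v0 + x) = P (v0 + a)}"
      then obtain x where x: "x \<in> Pl" "P (v0 + x) = P (v0 + a)" and y: "y = x - a" by blast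
      have "P (v0 + (a + (x - a))) = P (v0 + a) + P (v0 + (x - a))" using P(5)[OF a minus_in_pl[OF x(1) a]] .
      then show "y \<in> H" unfolding y using x(2) minus_in_pl[OF x(1) a] by (simp add: H_def)
    qed
    ultimately show "card {x\<in>Pl. P (v0 + x) = P (v0 + a)} \<le> card H"
      by (rule card_inj_on_le) (use finite_Pl in \<open>simp add: H_def\<close>)
  qed
  then have "card K \<le> card H" using card_K by (simp add: card_cartesian_product)
  also have "card H \<le> n * card (stab n S)"
  proof (rule card_le_stab[OF P(1-3) d_def q[folded d_def] S(2)])
    show "H \<subseteq> Pl" by (auto simp: H_def)
    fix v h assume "v \<in> S" "h \<in> H"
    then obtain t where t: "t \<in> T" "v = t + v0" using S(1) by (auto simp: transl_def)
    have "P (v0 + (t + h)) = P (v0 + t) + P (v0 + h)" using P(5) t TPl \<open>h \<in> H\<close> by (auto simp: H_def)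
    then have "P (v0 + (t + h)) = 0" using P(4)[OF t(1)] \<open>h \<in> H\<close> by (simp add: H_def)
    then show "P (v + h) = 0" unfolding t(2) by (simp add: ac_simps)
  qed
  finally have q_le: "card K \<le> n * card (stab n S)" .
  have fS: "f \<in> van_ideal n S" using f S(1) by (auto simp: van_ideal_def transl_def add.commute)
  have "S \<noteq> {}" using S(2) by (auto simp: irr_def)
  then obtain v where v: "v \<in> S" by blast
  then have "v \<in> Pl" using S(2) by (auto simp: irr_def)
  then show ?thesis using subgrp_stab q_le stab_vanish[OF fS v] by blast
qed

text \<open>A popular \<open>z\<close> yields a piece \<open>S z\<close> such that it and its
  translate by \<open>z\<close> both lie on the curve. There are at most \<open>n * n\<close> pairs
  of ideals, and two values of \<open>z\<close> with the same pair differ by an element of one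
  stabiliser, whose order stays below \<open>irr_bound n\<close> by
  \<open>large_coset\<close>.\<close>

lemma few_popular_differences:
  assumes f: "bpol n f" "w \<in> Pl" "f w \<noteq> 0" and q: "n * n * (n + 1) < card K"
    and no_coset: "\<And>G v. subgrp G \<Longrightarrow> v \<in> Pl \<Longrightarrow> (\<And>t. t \<in> G \<Longrightarrow> f (v + t) = 0) \<Longrightarrow> n * card G < card K"
  shows "card {z\<in>Pl. irr_bound n \<le> card {v\<in>Pl. f v = 0 \<and> f (v + z) = 0}} \<le> (n * n) * irr_bound n"
proof -
  define d where "d = n * n * (n + 1)"
  define B where "B = {z\<in>Pl. irr_bound n \<le> card {v\<in>Pl. f v = 0 \<and> f (v + z) = 0}}"
  define Xa where "Xa = {S. irr n (2 * (d + 1)) S \<and> (\<forall>v\<in>S. f v = 0)}"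
  have "\<exists>S. S \<subseteq> {v\<in>Pl. f v = 0 \<and> f (v + z) = 0} \<and> irr n (2 * (d + 1)) S" if "z \<in> B" for z
    using ex_irr_bound[of "{v\<in>Pl. f v = 0 \<and> f (v + z) = 0}" n] that unfolding B_def d_def by auto
  then obtain S where "\<forall>z\<in>B. S z \<subseteq> {v\<in>Pl. f v = 0 \<and> f (v + z) = 0} \<and> irr n (2 * (d + 1)) (S z)"
    using bchoice[of B "\<lambda>z S. S \<subseteq> {v\<in>Pl. f v = 0 \<and> f (v + z) = 0} \<and> irr n (2 * (d + 1)) S"] by blast
  then have S: "\<And>z. z \<in> B \<Longrightarrow> S z \<subseteq> {v\<in>Pl. f v = 0 \<and> f (v + z) = 0} \<and> irr n (2 * (d + 1)) (S z)" by blast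
  have ideals: "finite (van_ideal n ` Xa)" "card (van_ideal n ` Xa) \<le> n"
    using card_van_ideals_le[OF f d_def q[folded d_def]] by (simp_all add: Xa_def)
  have "card B \<le> (n * n) * irr_bound n"
  proof (rule card_le_fibres)
    show "finite B" using finite_Pl by (simp add: B_def)
    show "finite (van_ideal n ` Xa \<times> van_ideal n ` Xa)" using ideals by simp
    show "card (van_ideal n ` Xa \<times> van_ideal n ` Xa) \<le> n * n" using ideals by (simp add: card_cartesian_product mult_le_mono)
    show "(\<lambda>z. (van_ideal n (S z), van_ideal n (transl (S z) z))) ` B \<subseteq> van_ideal n ` Xa \<times> van_ideal n ` Xa"
    proof
      fix p assume "p \<in> (\<lambda>z. (van_ideal n (S z), van_ideal n (transl (S z) z))) ` B"
      then obtain z where z: "z \<in> B" "p = (van_ideal n (S z), van_ideal n (transl (S z) z))" by blast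
      have "S z \<in> Xa" "transl (S z) z \<in> Xa"
        using S[OF z(1)] irr_transl[of n _ "S z" z] z(1) by (auto simp: Xa_def B_def transl_def)
      then show "p \<in> van_ideal n ` Xa \<times> van_ideal n ` Xa" using z(2) by blast
    qed
    fix z0 assume z0: "z0 \<in> B"
    let ?F = "{z\<in>B. (van_ideal n (S z), van_ideal n (transl (S z) z)) = (van_ideal n (S z0), van_ideal n (transl (S z0) z0))}"
    have "inj_on (\<lambda>z. z - z0) ?F" by (auto simp: inj_on_def)
    moreover have "(\<lambda>z. z - z0) ` ?F \<subseteq> stab n (S z0)"
    proof
      fix t assume "t \<in> (\<lambda>z. z - z0) ` ?F"
      then obtain z where z: "z \<in> B" "van_ideal n (S z) = van_ideal n (S z0)"
        "van_ideal n (transl (S z) z) = van_ideal n (transl (S z0) z0)" "t = z - z0" by auto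
      show "t \<in> stab n (S z0)" unfolding z(4) by (rule diff_in_stab[OF z(2) _ _ z(3)]) (use z(1) z0 in \<open>auto simp: B_def\<close>)
    qed
    ultimately have "card ?F \<le> card (stab n (S z0))"
      by (rule card_inj_on_le) (use finite_Pl in \<open>simp add: stab_def\<close>)
    also have "card (stab n (S z0)) < irr_bound n"
    proof (rule ccontr)
      assume "\<not> card (stab n (S z0)) < irr_bound n"
      then have big: "irr_bound n \<le> card (stab n (S z0))" by simp
      have "S z0 \<noteq> {}" using S[OF z0] by (auto simp: irr_def)
      then obtain v where v: "v \<in> S z0" by blast
      have vPl: "v \<in> Pl" using v S[OF z0] by auto
      have "f \<in> van_ideal n (S z0)" using f S[OF z0] by (auto simp: van_ideal_def)
      then have "f (v + t) = 0" if "t \<in> stab n (S z0)" for t using stab_vanish v that by blast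
      from large_coset[OF subgrp_stab vPl f this q big] no_coset show False by (meson not_le)
    qed
    finally show "card ?F \<le> irr_bound n" by simp
  qed
  then show ?thesis unfolding B_def .
qed

end

section \<open>Resultants of points on a curve\<close>

sublocale additive_char \<subseteq> finite_subfld
  by unfold_locales (rule fin)

text \<open>The recursion of \<open>moment_step\<close> for \<open>card V \<le> b * q\<close> and
  \<open>\<kappa> = c * sqrt q\<close>, after the powers of \<open>q\<close> are taken out;
  \<open>A\<close> is the constant of the fourth moment.\<close>

fun moment_const :: "nat \<Rightarrow> real \<Rightarrow> real \<Rightarrow> nat \<Rightarrow> real" where
  "moment_const A b c 0 = real A"
| "moment_const A b c (Suc s) = 2 * b + c\<^sup>2 * moment_const A b c s"

context char_plane
begin

lemma rep_count_le: "E \<subseteq> V \<Longrightarrow> V \<subseteq> pl \<Longrightarrow> rep_count E z \<le> card {v\<in>pl. v \<in> V \<and> v + z \<in> V}"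
proof -
  assume EV: "E \<subseteq> V" "V \<subseteq> pl"
  have "rep_count E z = card (snd ` {s\<in>E \<times> E. fst s - snd s = z})"
    unfolding rep_count_def by (rule card_image[symmetric]) (auto simp: inj_on_def algebra_simps)
  also have "\<dots> \<le> card {v\<in>pl. v \<in> V \<and> v + z \<in> V}"
    by (rule card_mono) (use EV in \<open>auto simp: subset_eq\<close>)
  finally show ?thesis .
qed

lemma rep_count_le_card:
  assumes "E \<subseteq> pl" shows "rep_count E z \<le> card E"
proof -
  have "rep_count E z = card (snd ` {s\<in>E \<times> E. fst s - snd s = z})"
    unfolding rep_count_def by (rule card_image[symmetric]) (auto simp: inj_on_def algebra_simps)
  also have "\<dots> \<le> card E" by (rule card_mono) (use assms finite_subset[OF assms] in auto)
  finally show ?thesis .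
qed

lemma sum_rep_count:
  assumes "E \<subseteq> pl" shows "(\<Sum>z\<in>pl. rep_count E z) = card E ^ 2"
proof -
  have "finite E" using assms finite_subset[OF assms] by simp
  then have "(\<Sum>z\<in>pl. rep_count E z) = card (\<Union>z\<in>pl. {s\<in>E \<times> E. fst s - snd s = z})"
    unfolding rep_count_def by (intro card_UN_disjoint[symmetric]) auto
  also have "(\<Union>z\<in>pl. {s\<in>E \<times> E. fst s - snd s = z}) = E \<times> E"
  proof -
    have "fst s - snd s \<in> pl" if "s \<in> E \<times> E" for s
      using that subsetD[OF assms] by (intro pl_simps(3)) (simp_all only: mem_Times_iff)
    then show ?thesis by blast
  qed
  finally show ?thesis by (simp add: card_cartesian_product power2_eq_square)
qed

text \<open>At nonzero frequencies two of the four factors are bounded by the decay and the other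
  two summed by Parseval, which gives \<open>c\<^sup>2 * b\<close>; the zero frequency gives
  \<open>b ^ 4\<close>.\<close>

lemma energy_variety:
  assumes V: "V \<subseteq> pl" and b: "real (card V) \<le> b * real q"
    and decay: "\<And>m. m \<in> pl \<Longrightarrow> m \<noteq> 0 \<Longrightarrow> norm (exp_sum V m) \<le> c * sqrt (real q)"
  shows "(\<Sum>z\<in>pl. (real (rep_count V z))\<^sup>2) \<le> (b ^ 4 + c\<^sup>2 * b) * (real q)\<^sup>2"
proof -
  have q0: "real q > 0" using q_pos by simp
  have "(\<Sum>m\<in>pl - {0}. norm (exp_sum V m) ^ 4) \<le> (\<Sum>m\<in>pl - {0}. (c\<^sup>2 * real q) * (norm (exp_sum V m))\<^sup>2)"
  proof (rule sum_mono)
    fix m assume m: "m \<in> pl - {0}"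
    have "(norm (exp_sum V m))\<^sup>2 \<le> (c * sqrt (real q))\<^sup>2" using decay[of m] m by (intro power_mono) auto
    then have "(norm (exp_sum V m))\<^sup>2 \<le> c\<^sup>2 * real q" using q0 by (simp add: power_mult_distrib)
    then have "(norm (exp_sum V m))\<^sup>2 * (norm (exp_sum V m))\<^sup>2 \<le> (c\<^sup>2 * real q) * (norm (exp_sum V m))\<^sup>2" by (intro mult_right_mono) auto
    then show "norm (exp_sum V m) ^ 4 \<le> (c\<^sup>2 * real q) * (norm (exp_sum V m))\<^sup>2" by (simp add: power4_eq_xxxx power2_eq_square mult_ac)
  qed
  also have "\<dots> = (c\<^sup>2 * real q) * (\<Sum>m\<in>pl - {0}. (norm (exp_sum V m))\<^sup>2)" by (simp add: sum_distrib_left)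
  also have "\<dots> \<le> (c\<^sup>2 * real q) * (\<Sum>m\<in>pl. (norm (exp_sum V m))\<^sup>2)" by (intro mult_left_mono sum_mono2) auto
  also have "\<dots> = (c\<^sup>2 * real q) * (real (q ^ 2) * real (card V))" using sum_norm_exp_sum_sq[OF V] by simp
  also have "\<dots> \<le> (c\<^sup>2 * real q) * (real (q ^ 2) * (b * real q))" using b by (intro mult_left_mono) auto
  finally have "moment V 4 \<le> c\<^sup>2 * b * real q ^ 4" by (simp add: moment_def power4_eq_xxxx power2_eq_square mult_ac)
  moreover have "real (card V) ^ 4 \<le> (b * real q) ^ 4" using b by (intro power_mono) auto
  ultimately have "real (q ^ 2) * (\<Sum>z\<in>pl. (real (rep_count V z))\<^sup>2) \<le> (b * real q) ^ 4 + c\<^sup>2 * b * real q ^ 4"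
    using energy[OF V] moment_split[of V 4] by linarith
  also have "\<dots> = real (q ^ 2) * ((b ^ 4 + c\<^sup>2 * b) * (real q)\<^sup>2)"
    by (simp add: power_mult_distrib power4_eq_xxxx power2_eq_square algebra_simps)
  finally show ?thesis using q0 by (simp add: mult_le_cancel_left)
qed

text \<open>Each \<open>h\<close> in \<open>G\<close> has at least \<open>card G\<close>
  representations as a difference of points of \<open>v + G\<close>, so the energy of
  \<open>V\<close> is at least the cube of \<open>card G\<close>. If \<open>card G\<close> were at
  least \<open>q / n\<close>, this would be of order \<open>q^3\<close>, against
  \<open>O(q^2)\<close> from the decay.\<close>

lemma no_large_coset:
  assumes V: "V \<subseteq> pl" and b: "real (card V) \<le> b * real q"
    and decay: "\<And>m. m \<in> pl \<Longrightarrow> m \<noteq> 0 \<Longrightarrow> norm (exp_sum V m) \<le> c * sqrt (real q)"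
    and q: "real n ^ 3 * (b ^ 4 + c\<^sup>2 * b) < real q"
    and G: "subgrp G" "\<And>t. t \<in> G \<Longrightarrow> v + t \<in> V"
  shows "n * card G < q"
proof (rule ccontr)
  assume "\<not> n * card G < q"
  then have "real q \<le> real (n * card G)" by (simp only: of_nat_le_iff not_less)
  then have nG: "real q \<le> real n * real (card G)" by simp
  have G': "G \<subseteq> pl" "\<And>g h. g \<in> G \<Longrightarrow> h \<in> G \<Longrightarrow> g - h \<in> G" using G(1) by (auto simp: subgrp_def pl_def)
  have finG: "finite G" using finite_subset[OF G'(1)] by simp
  have finV: "finite V" using finite_subset[OF V] by simp
  have rep_count: "card G \<le> rep_count V h" if h: "h \<in> G" for h
  proof -
    have "card G = card ((\<lambda>g. (v + g, v + (g - h))) ` G)"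
      by (rule card_image[symmetric]) (auto simp: inj_on_def)
    also have "\<dots> \<le> rep_count V h" unfolding rep_count_def
    proof (rule card_mono)
      have "(v + g, v + (g - h)) \<in> {s\<in>V \<times> V. fst s - snd s = h}" if "g \<in> G" for g
        using G(2)[OF that] G(2)[OF G'(2)[OF that h]] by simp
      then show "(\<lambda>g. (v + g, v + (g - h))) ` G \<subseteq> {s\<in>V \<times> V. fst s - snd s = h}" by blast
    qed (use finV in simp)
    finally show ?thesis .
  qed
  have "real (card G) * (real (card G))\<^sup>2 = (\<Sum>z\<in>G. (real (card G))\<^sup>2)" by simp
  also have "\<dots> \<le> (\<Sum>z\<in>G. (real (rep_count V z))\<^sup>2)" using rep_count by (intro sum_mono power_mono) auto
  also have "\<dots> \<le> (\<Sum>z\<in>pl. (real (rep_count V z))\<^sup>2)" using G'(1) by (intro sum_mono2) auto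
  also have "\<dots> \<le> (b ^ 4 + c\<^sup>2 * b) * (real q)\<^sup>2" by (rule energy_variety[OF V b decay])
  finally have 1: "real (card G) ^ 3 \<le> (b ^ 4 + c\<^sup>2 * b) * (real q)\<^sup>2" by (simp add: power3_eq_cube power2_eq_square)
  have "real q ^ 3 \<le> (real n * real (card G)) ^ 3" using nG by (intro power_mono) auto
  also have "\<dots> = real n ^ 3 * real (card G) ^ 3" by (simp add: power_mult_distrib)
  also have "\<dots> \<le> real n ^ 3 * ((b ^ 4 + c\<^sup>2 * b) * (real q)\<^sup>2)" using 1 by (intro mult_left_mono) auto
  finally have "real q * (real q)\<^sup>2 \<le> (real n ^ 3 * (b ^ 4 + c\<^sup>2 * b)) * (real q)\<^sup>2"
    by (simp add: power3_eq_cube power2_eq_square mult_ac)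
  then have "real q \<le> real n ^ 3 * (b ^ 4 + c\<^sup>2 * b)" using q_pos by (simp add: mult_le_cancel_right)
  then show False using q by linarith
qed

text \<open>The fourth moment is at most \<open>q^2\<close> times the additive energy. The boundedly
  many popular differences contribute at most \<open>|E|^2\<close> each; for all others the
  representation count is bounded, and the counts sum to \<open>|E|^2\<close>.\<close>

lemma fourth_moment:
  assumes f: "bpol n f" and V: "V = {v\<in>pl. f v = 0}" and b: "real (card V) \<le> b * real q"
    and decay: "\<And>m. m \<in> pl \<Longrightarrow> m \<noteq> 0 \<Longrightarrow> norm (exp_sum V m) \<le> c * sqrt (real q)"
    and q: "real n ^ 3 * (b ^ 4 + c\<^sup>2 * b) < real q" "b < real q" "n * n * (n + 1) < q" and E: "E \<subseteq> V"
  shows "moment E 4 \<le> real (irr_bound n * (1 + n * n)) * ((real q)\<^sup>2 * (real (card E))\<^sup>2)"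
proof -
  have Vpl: "V \<subseteq> pl" and Epl: "E \<subseteq> pl" using V E by auto
  \<comment> \<open>Otherwise \<open>V\<close> would have \<open>q^2\<close> points, more than
    \<open>b * q\<close>.\<close>
  have "\<exists>w\<in>pl. f w \<noteq> 0"
  proof (rule ccontr)
    assume "\<not> ?thesis"
    then have "V = pl" using V by auto
    then have "real q * real q \<le> b * real q" using b card_pl by (simp add: power2_eq_square)
    then show False using q(2) q_pos by simp
  qed
  then obtain w where w: "w \<in> Pl" "f w \<noteq> 0" by (auto simp: pl_def)
  define B where "B = {z\<in>pl. irr_bound n \<le> card {v\<in>pl. f v = 0 \<and> f (v + z) = 0}}"
  have cardB: "card B \<le> n * n * irr_bound n"
    unfolding B_def pl_def
  proof (rule few_popular_differences[OF f w q(3)])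
    fix G v assume G: "subgrp G" "v \<in> Pl" "\<And>t. t \<in> G \<Longrightarrow> f (v + t) = 0"
    have "v + t \<in> V" if "t \<in> G" for t
      using G that plus_in_pl[OF G(2)] unfolding V subgrp_def pl_def by blast
    then show "n * card G < q" using no_large_coset[OF Vpl b decay q(1) G(1)] by blast
  qed
  have small: "rep_count E z \<le> irr_bound n" if "z \<in> pl - B" for z
  proof -
    have "{v\<in>pl. v \<in> V \<and> v + z \<in> V} = {v\<in>pl. f v = 0 \<and> f (v + z) = 0}" using that V by auto
    then show ?thesis using rep_count_le[OF E Vpl, of z] that by (auto simp: B_def)
  qed
  have "(\<Sum>z\<in>pl. (real (rep_count E z))\<^sup>2) = (\<Sum>z\<in>B. (real (rep_count E z))\<^sup>2) + (\<Sum>z\<in>pl - B. (real (rep_count E z))\<^sup>2)"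
    using sum.subset_diff[of B pl "\<lambda>z. (real (rep_count E z))\<^sup>2"] by (auto simp: B_def)
  also have "(\<Sum>z\<in>B. (real (rep_count E z))\<^sup>2) \<le> (\<Sum>z\<in>B. (real (card E))\<^sup>2)"
    using rep_count_le_card[OF Epl] by (intro sum_mono power_mono) auto
  also have "\<dots> = real (card B) * (real (card E))\<^sup>2" by simp
  also have "\<dots> \<le> real (n * n * irr_bound n) * (real (card E))\<^sup>2" using cardB by (intro mult_right_mono) (auto simp del: of_nat_mult)
  also have "(\<Sum>z\<in>pl - B. (real (rep_count E z))\<^sup>2) \<le> (\<Sum>z\<in>pl - B. real (irr_bound n) * real (rep_count E z))"
    using small unfolding power2_eq_square by (intro sum_mono mult_right_mono) auto
  also have "\<dots> \<le> (\<Sum>z\<in>pl. real (irr_bound n) * real (rep_count E z))" by (intro sum_mono2) auto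
  also have "\<dots> = real (irr_bound n) * real (\<Sum>z\<in>pl. rep_count E z)" by (simp add: sum_distrib_left)
  also have "\<dots> = real (irr_bound n) * (real (card E))\<^sup>2" by (simp add: sum_rep_count[OF Epl])
  finally have "(\<Sum>z\<in>pl. (real (rep_count E z))\<^sup>2) \<le> real (irr_bound n * (1 + n * n)) * (real (card E))\<^sup>2"
    by (simp add: algebra_simps)
  then have "real (q ^ 2) * (\<Sum>z\<in>pl. (real (rep_count E z))\<^sup>2) \<le> real (q ^ 2) * (real (irr_bound n * (1 + n * n)) * (real (card E))\<^sup>2)"
    by (intro mult_left_mono) auto
  moreover have "moment E 4 \<le> real (q ^ 2) * (\<Sum>z\<in>pl. (real (rep_count E z))\<^sup>2)"
    using energy[OF Epl] moment_split[of E 4] by (smt (verit) of_nat_0_le_iff zero_le_power)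
  ultimately show ?thesis by (simp add: mult_ac)
qed

text \<open>Iteration of \<open>moment_step\<close> from the fourth moment. Each step multiplies the
  second term \<open>q * |E|^(2s+3)\<close> by \<open>q\<close>, and \<open>q \<le> |E|^2\<close>
  trades that factor for two more powers of \<open>|E|\<close>.\<close>

lemma even_moment:
  assumes V: "V \<subseteq> pl" and E: "E \<subseteq> V" and b: "real (card V) \<le> b * real q" "0 \<le> b"
    and decay: "\<And>m. m \<in> pl \<Longrightarrow> m \<noteq> 0 \<Longrightarrow> norm (exp_sum V m) \<le> c * sqrt (real q)"
    and m4: "moment E 4 \<le> real A * ((real q)\<^sup>2 * (real (card E))\<^sup>2)" and N: "real q \<le> (real (card E))\<^sup>2"
  shows "moment E (2 * (s + 2)) \<le> moment_const A b c s *
    (real q ^ (s + 2) * (real (card E))\<^sup>2 + real q * real (card E) ^ (2 * s + 3)) \<and> 0 \<le> moment_const A b c s"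
proof (induct s)
  case 0
  have "real A * ((real q)\<^sup>2 * (real (card E))\<^sup>2) \<le> real A * ((real q)\<^sup>2 * (real (card E))\<^sup>2 + real q * real (card E) ^ 3)"
    by (intro mult_left_mono) auto
  then show ?case using m4 by (simp add: power2_eq_square)
next
  case (Suc s)
  define N' Q D where "N' = real (card E)" and "Q = real q" and "D = moment_const A b c s"
  have pos: "0 \<le> N'" "0 \<le> Q" "0 \<le> D" using Suc by (auto simp: N'_def Q_def D_def)
  have "moment E (2 * (Suc s + 2)) \<le> 2 * real (card V) * N' ^ (2 * Suc s + 3) + (c * sqrt Q)\<^sup>2 * moment E (2 * (Suc s + 1))"
    unfolding N'_def Q_def by (rule moment_step[OF V E decay])
  also have "2 * real (card V) * N' ^ (2 * Suc s + 3) \<le> 2 * (b * Q) * N' ^ (2 * Suc s + 3)"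
    using b pos unfolding Q_def by (intro mult_right_mono) auto
  also have "(c * sqrt Q)\<^sup>2 * moment E (2 * (Suc s + 1)) \<le> (c * sqrt Q)\<^sup>2 * (D * (Q ^ (s + 2) * N'\<^sup>2 + Q * N' ^ (2 * s + 3)))"
    using Suc unfolding D_def Q_def N'_def by (intro mult_left_mono) auto
  also have "\<dots> = c\<^sup>2 * D * (Q ^ (Suc s + 2) * N'\<^sup>2 + Q * (Q * N' ^ (2 * s + 3)))"
    using pos by (simp add: power_mult_distrib algebra_simps)
  also have "\<dots> \<le> c\<^sup>2 * D * (Q ^ (Suc s + 2) * N'\<^sup>2 + Q * (N'\<^sup>2 * N' ^ (2 * s + 3)))"
    using N pos unfolding N'_def Q_def by (intro mult_left_mono add_left_mono mult_right_mono) auto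
  also have "N'\<^sup>2 * N' ^ (2 * s + 3) = N' ^ (2 * Suc s + 3)" by (simp add: power_add[symmetric] numeral_eq_Suc)
  finally have "moment E (2 * (Suc s + 2)) \<le> 2 * (b * Q) * N' ^ (2 * Suc s + 3) + c\<^sup>2 * D * (Q ^ (Suc s + 2) * N'\<^sup>2 + Q * N' ^ (2 * Suc s + 3))"
    by simp
  moreover have "0 \<le> 2 * b * (Q ^ (Suc s + 2) * N'\<^sup>2)" using b pos by simp
  ultimately have "moment E (2 * (Suc s + 2)) \<le> (2 * b + c\<^sup>2 * D) * (Q ^ (Suc s + 2) * N'\<^sup>2 + Q * N' ^ (2 * Suc s + 3))"
    by (simp only: distrib_left distrib_right)
  moreover have "0 \<le> 2 * b + c\<^sup>2 * D" using b pos by simp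
  ultimately show ?case by (simp only: moment_const.simps N'_def Q_def D_def)
qed

end

section \<open>Balancing the estimates\<close>

text \<open>Each of the four terms of the expanded product is at most
  \<open>Q * N ^ (2 * k) / C\<close>. The term \<open>Q ^ k * N ^ 4\<close> uses the second
  hypothesis on \<open>C\<close>, the size condition raised to the power \<open>2 * k - 4\<close>;
  the term without high powers of \<open>Q\<close> uses the first. For \<open>i = j\<close> the
  mixed terms are the geometric mean of these two; for \<open>j = i + 1\<close> the larger mixed
  term is squared and compared with the second hypothesis.\<close>

lemma moment_product_bound:
  fixes N Q C :: real
  assumes ij: "i + j = k" "i \<le> j" "j \<le> i + 1" "2 \<le> i" and Q: "1 \<le> Q" and N: "0 \<le> N" and C: "1 \<le> C"
    and NC: "C\<^sup>2 * Q \<le> N\<^sup>2" "C ^ (2 * k - 4) * Q ^ (k - 1) \<le> N ^ (2 * k - 4)"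
  shows "C * ((Q ^ i * N\<^sup>2 + Q * N ^ (2 * i - 1)) * (Q ^ j * N\<^sup>2 + Q * N ^ (2 * j - 1))) \<le> 4 * (Q * N ^ (2 * k))"
proof -
  define Xa where "Xa = Q * N ^ (2 * k)"
  have k: "4 \<le> k" using ij by simp
  have Xa0: "0 \<le> Xa" using Q N by (simp add: Xa_def)
  have CC: "C \<le> C ^ m" if "1 \<le> m" for m using C that by (metis power_increasing power_one_right)
  have D1: "C * (Q ^ (k - 1) * N ^ 4) \<le> N ^ (2 * k)" and D2: "C\<^sup>2 * (Q ^ (k - 1) * N ^ 4) \<le> N ^ (2 * k)"
  proof -
    have "C\<^sup>2 * Q ^ (k - 1) \<le> C ^ (2 * k - 4) * Q ^ (k - 1)"
      using C Q k by (intro mult_right_mono power_increasing) auto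
    then have *: "C\<^sup>2 * Q ^ (k - 1) \<le> N ^ (2 * k - 4)" using NC(2) by linarith
    have "C\<^sup>2 * Q ^ (k - 1) * N ^ 4 \<le> N ^ (2 * k - 4) * N ^ 4" using * N by (intro mult_right_mono) auto
    also have "\<dots> = N ^ (2 * k)" using k by (simp add: power_add[symmetric])
    finally have b: "C\<^sup>2 * (Q ^ (k - 1) * N ^ 4) \<le> N ^ (2 * k)" by (simp add: mult_ac)
    have "C * (Q ^ (k - 1) * N ^ 4) \<le> C\<^sup>2 * (Q ^ (k - 1) * N ^ 4)"
      using CC[of 2] Q N by (intro mult_right_mono) auto
    then show "C * (Q ^ (k - 1) * N ^ 4) \<le> N ^ (2 * k)" using b by linarith
    show "C\<^sup>2 * (Q ^ (k - 1) * N ^ 4) \<le> N ^ (2 * k)" by (rule b)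
  qed
  have QN: "C * Q \<le> N\<^sup>2"
  proof -
    have "C * Q \<le> C\<^sup>2 * Q" using CC[of 2] Q by (intro mult_right_mono) auto
    then show ?thesis using NC(1) by linarith
  qed
  have "1 * Q \<le> C * Q" using C Q by (intro mult_right_mono) auto
  then have QN': "Q \<le> N\<^sup>2" using QN by linarith
  have T1: "C * ((Q ^ i * N\<^sup>2) * (Q ^ j * N\<^sup>2)) \<le> Xa"
  proof -
    have "Q ^ k = Q * Q ^ (k - 1)" using k by (cases k) auto
    then have "C * ((Q ^ i * N\<^sup>2) * (Q ^ j * N\<^sup>2)) = Q * (C * (Q ^ (k - 1) * N ^ 4))"
      unfolding ij(1)[symmetric] by (simp add: power_add power4_eq_xxxx power2_eq_square mult_ac)
    also have "\<dots> \<le> Q * N ^ (2 * k)" using D1 Q by (intro mult_left_mono) auto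
    finally show ?thesis by (simp add: Xa_def)
  qed
  have T4: "C * ((Q * N ^ (2 * i - 1)) * (Q * N ^ (2 * j - 1))) \<le> Xa"
  proof -
    have e: "(2 * i - 1) + (2 * j - 1) = 2 * k - 2" "2 + (2 * k - 2) = 2 * k" using ij by auto
    have "C * ((Q * N ^ (2 * i - 1)) * (Q * N ^ (2 * j - 1))) = Q * ((C * Q) * N ^ (2 * k - 2))"
      unfolding e(1)[symmetric] by (simp add: power_add mult_ac)
    also have "\<dots> \<le> Q * (N\<^sup>2 * N ^ (2 * k - 2))" using QN Q N by (intro mult_left_mono mult_right_mono) auto
    also have "N\<^sup>2 * N ^ (2 * k - 2) = N ^ (2 * k)" unfolding power_add[symmetric] e(2) ..
    finally show ?thesis by (simp add: Xa_def)
  qed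
  have T2: "C * ((Q ^ i * N\<^sup>2) * (Q * N ^ (2 * j - 1))) \<le> Xa" and T3: "C * ((Q * N ^ (2 * i - 1)) * (Q ^ j * N\<^sup>2)) \<le> Xa"
  proof -
    consider "j = i" | "j = i + 1" using ij by linarith
    then have "C * ((Q ^ i * N\<^sup>2) * (Q * N ^ (2 * j - 1))) \<le> Xa \<and> C * ((Q * N ^ (2 * i - 1)) * (Q ^ j * N\<^sup>2)) \<le> Xa"
    proof cases
      case 1
      define T where "T = C * ((Q ^ i * N\<^sup>2) * (Q * N ^ (2 * j - 1)))"
      have "T\<^sup>2 = (C * ((Q ^ i * N\<^sup>2) * (Q ^ j * N\<^sup>2))) * (C * ((Q * N ^ (2 * i - 1)) * (Q * N ^ (2 * j - 1))))"
        by (simp add: T_def 1 power2_eq_square mult_ac)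
      also have "\<dots> \<le> Xa * Xa" using T1 T4 Xa0 Q N C by (intro mult_mono) auto
      finally have "T\<^sup>2 \<le> Xa\<^sup>2" unfolding power2_eq_square[of Xa] .
      then have "T \<le> Xa" using Xa0 by (rule power2_le_imp_le)
      then show ?thesis by (simp add: T_def 1 mult_ac)
    next
      case 2
      have k2: "k = 2 * i + 1" "2 * j - 1 = 2 * i + 1" using 2 ij by auto
      define T where "T = C * (Q ^ (i + 1) * N ^ (2 * i + 3))"
      have T: "C * ((Q ^ i * N\<^sup>2) * (Q * N ^ (2 * j - 1))) = T"
        unfolding T_def k2 by (simp add: power_add power2_eq_square power3_eq_cube mult_ac)
      have "T\<^sup>2 = (Q * Q) * (C\<^sup>2 * (Q ^ (k - 1) * N ^ 4)) * N ^ (2 * k)"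
        by (simp add: T_def k2 power2_eq_square power_add[symmetric] mult_ac numeral_eq_Suc power_mult_distrib)
      also have "\<dots> \<le> (Q * Q) * N ^ (2 * k) * N ^ (2 * k)"
        using D2 Q N by (intro mult_right_mono mult_left_mono) auto
      also have "\<dots> = Xa\<^sup>2" by (simp add: Xa_def power2_eq_square mult_ac)
      finally have TX: "T \<le> Xa" using Xa0 by (rule power2_le_imp_le)
      have e: "2 * i - 1 + 2 = 2 * i + 1" using ij by simp
      have "C * ((Q * N ^ (2 * i - 1)) * (Q ^ j * N\<^sup>2)) = C * (Q ^ (i + 1) * (Q * N ^ (2 * i + 1)))"
        unfolding e[symmetric] by (simp add: 2 power_add power2_eq_square mult_ac)
      also have "\<dots> \<le> C * (Q ^ (i + 1) * (N\<^sup>2 * N ^ (2 * i + 1)))"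
        using QN' Q N C by (intro mult_left_mono mult_right_mono) auto
      also have "\<dots> = T" by (simp add: T_def power_add[symmetric] numeral_eq_Suc)
      finally show ?thesis using TX T by linarith
    qed
    then show "C * ((Q ^ i * N\<^sup>2) * (Q * N ^ (2 * j - 1))) \<le> Xa" "C * ((Q * N ^ (2 * i - 1)) * (Q ^ j * N\<^sup>2)) \<le> Xa" by auto
  qed
  show ?thesis using T1 T2 T3 T4 unfolding Xa_def[symmetric] by (simp add: distrib_left distrib_right)
qed

text \<open>For \<open>q \<le> threshold n b c\<close> the size hypothesis fails, as \<open>\<bar>E\<bar> \<le> q\<^sup>2 < size_const k n b c\<close>.\<close>

definition threshold :: "nat \<Rightarrow> real \<Rightarrow> real \<Rightarrow> real" where
  "threshold n b c = real n ^ 3 * (b ^ 4 + c\<^sup>2 * b) + b + real (n * n * (n + 1)) + 2"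

definition size_const :: "nat \<Rightarrow> nat \<Rightarrow> real \<Rightarrow> real \<Rightarrow> real" where
  "size_const k n b c = 1 + (threshold n b c)\<^sup>2 +
    64 * (moment_const (irr_bound n * (1 + n * n)) b c (k div 2 - 2) *
      moment_const (irr_bound n * (1 + n * n)) b c (k - k div 2 - 2))"

context char_plane
begin

theorem resultant_hits:
  assumes k: "4 \<le> k" and bc: "0 < b" "0 < c"
    and f: "bpol n f" and V: "V = {v\<in>pl. f v = 0}" and b: "real (card V) \<le> b * real q"
    and decay: "\<And>m. m \<in> pl \<Longrightarrow> m \<noteq> 0 \<Longrightarrow> norm (exp_sum V m) \<le> c * sqrt (real q)"
    and E: "E \<subseteq> V" and size: "size_const k n b c * real q powr (1 / 2 + 1 / (2 * real k - 4)) \<le> real (card E)"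
    and t: "t \<in> K" "t \<noteq> 0"
  shows "\<exists>x. (\<forall>j\<in>{1..k}. x j \<in> E) \<and> nrm (x 1 - (\<Sum>j\<in>{2..k}. x j)) = t"
proof (rule ccontr)
  assume "\<not> ?thesis"
  then have none: "nrm (x 1 - (\<Sum>j\<in>{2..k}. x j)) \<noteq> t" if "x \<in> {1..k} \<rightarrow>\<^sub>E E" for x
    using that by (auto simp: PiE_iff)
  have Vpl: "V \<subseteq> pl" and Epl: "E \<subseteq> pl" using V E by auto
  define A where "A = irr_bound n * (1 + n * n)"
  \<comment> \<open>The nearly equal split of \<open>k\<close> keeps \<open>i\<close> and
    \<open>j\<close> at least 2, so that both even moments lie in the range of
    \<open>even_moment\<close>.\<close>
  define i j where "i = k div 2" and "j = k - i"
  have ij: "i + j = k" "i \<le> j" "j \<le> i + 1" "2 \<le> i" "2 \<le> j" using k by (auto simp: i_def j_def)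
  define Di Dj where "Di = moment_const A b c (i - 2)" and "Dj = moment_const A b c (j - 2)"
  define C where "C = size_const k n b c"
  define N Q where "N = real (card E)" and "Q = real q"
  have mc: "0 \<le> moment_const A b c s" for s using bc by (induct s) auto
  have C: "C = 1 + (threshold n b c)\<^sup>2 + 64 * (Di * Dj)"
    by (simp add: C_def size_const_def Di_def Dj_def i_def j_def A_def)
  have DD: "0 \<le> Di" "0 \<le> Dj" using mc by (auto simp: Di_def Dj_def)
  have C1: "1 \<le> C" using DD by (simp add: C)
  have thr: "0 \<le> threshold n b c" using bc by (simp add: threshold_def)
  have Q1: "1 \<le> Q" "0 < Q" using q_pos by (auto simp: Q_def)
  have N0: "0 \<le> N" by (simp add: N_def)
  have size': "C * Q powr (1 / 2 + 1 / (2 * real k - 4)) \<le> N" using size by (simp add: C_def Q_def N_def)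
  have rk: "2 * real k - 4 > 0" using k by simp
  have large: "threshold n b c < Q"
  proof (rule ccontr)
    assume "\<not> threshold n b c < Q"
    then have "Q\<^sup>2 \<le> (threshold n b c)\<^sup>2" using Q1 by (intro power_mono) auto
    also have "\<dots> < C" using mult_nonneg_nonneg[OF DD] unfolding C by linarith
    also have "C * 1 \<le> C * Q powr (1 / 2 + 1 / (2 * real k - 4))"
      using Q1 rk C1 by (intro mult_left_mono ge_one_powr_ge_zero) auto
    also have "\<dots> \<le> N" by (rule size')
    also have "N \<le> Q\<^sup>2" using card_mono[OF finite_pl Epl] card_pl by (simp add: N_def Q_def flip: of_nat_power)
    finally show False by simp
  qed
  have thr_parts: "real n ^ 3 * (b ^ 4 + c\<^sup>2 * b) < Q" "b < Q" "n * n * (n + 1) < q" "2 < Q"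
  proof -
    have p: "0 \<le> real n ^ 3 * (b ^ 4 + c\<^sup>2 * b)" "0 \<le> real (n * n * (n + 1))" using bc by auto
    show "real n ^ 3 * (b ^ 4 + c\<^sup>2 * b) < Q" "b < Q" "2 < Q" using large p bc unfolding threshold_def by linarith+
    have "real (n * n * (n + 1)) < real q" using large p bc unfolding threshold_def Q_def by linarith
    then show "n * n * (n + 1) < q" by (simp only: of_nat_less_iff)
  qed
  have NC1: "C\<^sup>2 * Q \<le> N\<^sup>2"
  proof -
    have "sqrt Q = Q powr (1 / 2)" using Q1 by (simp add: powr_half_sqrt)
    also have "\<dots> \<le> Q powr (1 / 2 + 1 / (2 * real k - 4))" using Q1 rk by (intro powr_mono) auto
    finally have "C * sqrt Q \<le> N" using size' mult_left_mono[of _ _ C] C1 by (meson order_trans zero_le_one)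
    then have "(C * sqrt Q)\<^sup>2 \<le> N\<^sup>2" using C1 Q1 by (intro power_mono) auto
    then show ?thesis using Q1 by (simp add: power_mult_distrib)
  qed
  have NC2: "C ^ (2 * k - 4) * Q ^ (k - 1) \<le> N ^ (2 * k - 4)"
  proof -
    have "(C * Q powr (1 / 2 + 1 / (2 * real k - 4))) ^ (2 * k - 4) \<le> N ^ (2 * k - 4)"
      using size' C1 by (intro power_mono) auto
    moreover have "(Q powr (1 / 2 + 1 / (2 * real k - 4))) ^ (2 * k - 4) = Q ^ (k - 1)"
    proof -
      have "(Q powr (1 / 2 + 1 / (2 * real k - 4))) ^ (2 * k - 4)
        = (Q powr (1 / 2 + 1 / (2 * real k - 4))) powr real (2 * k - 4)" using Q1 by (intro powr_realpow[symmetric]) auto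
      also have "\<dots> = Q powr ((1 / 2 + 1 / (2 * real k - 4)) * real (2 * k - 4))" by (rule powr_powr)
      also have "(1 / 2 + 1 / (2 * real k - 4)) * real (2 * k - 4) = real (k - 1)"
        using k rk by (simp add: of_nat_diff field_simps)
      finally show ?thesis using Q1 by (simp add: powr_realpow)
    qed
    ultimately show ?thesis by (simp add: power_mult_distrib)
  qed
  have QN: "real q \<le> (real (card E))\<^sup>2"
  proof -
    have "1 * Q \<le> C\<^sup>2 * Q" using C1 Q1 by (intro mult_right_mono one_le_power) auto
    then show ?thesis using NC1 unfolding N_def Q_def by linarith
  qed
  have m4: "moment E 4 \<le> real A * ((real q)\<^sup>2 * (real (card E))\<^sup>2)" unfolding A_def
    by (rule fourth_moment[OF f V b decay]) (use thr_parts E in \<open>auto simp: Q_def\<close>)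
  have even: "moment E (2 * l) \<le> moment_const A b c (l - 2) * (Q ^ l * N\<^sup>2 + Q * N ^ (2 * l - 1))" if "2 \<le> l" for l
  proof -
    have "l - 2 + 2 = l" "2 * (l - 2) + 3 = 2 * l - 1" using that by auto
    then show ?thesis
      using even_moment[OF Vpl E b less_imp_le[OF bc(1)] decay m4 QN, of "l - 2"] by (simp add: N_def Q_def)
  qed
  define Pi Pj where "Pi = Q ^ i * N\<^sup>2 + Q * N ^ (2 * i - 1)" and "Pj = Q ^ j * N\<^sup>2 + Q * N ^ (2 * j - 1)"
  have PP: "0 \<le> Pi" "0 \<le> Pj" using Q1 N0 by (auto simp: Pi_def Pj_def)
  have "(moment E k)\<^sup>2 \<le> moment E (2 * i) * moment E (2 * j)" using moment_cauchy_schwarz[of E i j] ij(1) by simp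
  also have "\<dots> \<le> (Di * Pi) * (Dj * Pj)"
    using even[OF ij(4)] even[OF ij(5)] moment_nonneg DD PP unfolding Di_def Dj_def Pi_def Pj_def
    by (intro mult_mono) auto
  finally have mk: "(moment E k)\<^sup>2 \<le> (Di * Dj) * (Pi * Pj)" by (simp add: mult_ac)
  \<comment> \<open>With \<open>Q - 1 >= Q / 2\<close> the constant 2 becomes 4, and squaring makes
    it 16. Together with the 4 of \<open>moment_product_bound\<close> this is the 64 in
    \<open>size_const\<close>, whose summand 1 makes the contradiction strict.\<close>
  have "(Q - 1) * N ^ k \<le> 2 * sqrt Q * moment E k"
    using resultant_count[OF Epl t _ none] k by (simp add: N_def Q_def)
  moreover have "Q / 2 * N ^ k \<le> (Q - 1) * N ^ k" using thr_parts(4) N0 by (intro mult_right_mono) auto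
  ultimately have "Q * N ^ k \<le> 4 * sqrt Q * moment E k" by simp
  then have "(Q * N ^ k)\<^sup>2 \<le> (4 * sqrt Q * moment E k)\<^sup>2" using Q1 N0 by (intro power_mono) auto
  then have "Q\<^sup>2 * N ^ (2 * k) \<le> 16 * Q * (moment E k)\<^sup>2"
    using Q1 by (simp add: power_mult_distrib power_mult[symmetric] mult.commute)
  then have "Q * (Q * N ^ (2 * k)) \<le> Q * (16 * (moment E k)\<^sup>2)" by (simp add: power2_eq_square mult_ac)
  then have "Q * N ^ (2 * k) \<le> 16 * (moment E k)\<^sup>2" using Q1 by (simp add: mult_le_cancel_left)
  also have "\<dots> \<le> 16 * ((Di * Dj) * (Pi * Pj))" using mk by simp
  finally have 1: "Q * N ^ (2 * k) \<le> 16 * (Di * Dj) * (Pi * Pj)" by simp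
  have 2: "C * (Pi * Pj) \<le> 4 * (Q * N ^ (2 * k))"
    unfolding Pi_def Pj_def by (rule moment_product_bound[OF ij(1-4) Q1(1) N0 C1 NC1 NC2])
  have "C * (Pi * Pj) \<le> 64 * (Di * Dj) * (Pi * Pj)" using 1 2 by linarith
  moreover have "0 < Pi * Pj"
  proof -
    have "0 < C\<^sup>2 * Q" using C1 Q1 by simp
    then have "N \<noteq> 0" using NC1 by auto
    then have "N > 0" using N0 by simp
    then show ?thesis using Q1 unfolding Pi_def Pj_def by (intro mult_pos_pos add_pos_pos) auto
  qed
  ultimately have "C \<le> 64 * (Di * Dj)" by (simp only: mult_le_cancel_right)
  then show False using C by (smt (verit) zero_le_power2)
qed

end

section \<open>Embedding a finite field into a commutative ring\<close>

text \<open>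
  The product of all fields with elements of type \<open>'a\<close>. Each of them embeds as a subset, so that the
  arithmetic of an arbitrary field record becomes that of a type of class \<open>comm_ring_1\<close>. The factor
  \<open>int\<close> ensures \<open>0 \<noteq> 1\<close> when there is no field on \<open>'a\<close>.
\<close>

typedef 'a field_prod = "{p :: int \<times> ('a ring \<Rightarrow> 'a).
    \<forall>F. (field F \<longrightarrow> snd p F \<in> carrier F) \<and> (\<not> field F \<longrightarrow> snd p F = undefined)}"
proof
  show "(0, \<lambda>F. if field F then \<zero>\<^bsub>F\<^esub> else undefined) \<in> {p :: int \<times> ('a ring \<Rightarrow> 'a).
    \<forall>F. (field F \<longrightarrow> snd p F \<in> carrier F) \<and> (\<not> field F \<longrightarrow> snd p F = undefined)}"
    using field.is_ring ring.ring_simprules(2) by fastforce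
qed

setup_lifting type_definition_field_prod

instantiation field_prod :: (type) comm_ring_1
begin

lift_definition zero_field_prod :: "'a field_prod"
  is "(0, \<lambda>F. if field F then \<zero>\<^bsub>F\<^esub> else undefined)"
  using field.is_ring ring.ring_simprules(2) by fastforce

lift_definition one_field_prod :: "'a field_prod"
  is "(1, \<lambda>F. if field F then \<one>\<^bsub>F\<^esub> else undefined)"
  using field.is_ring ring.ring_simprules(6) by fastforce

lift_definition plus_field_prod :: "'a field_prod \<Rightarrow> 'a field_prod \<Rightarrow> 'a field_prod"
  is "\<lambda>p p'. (fst p + fst p', \<lambda>F. if field F then snd p F \<oplus>\<^bsub>F\<^esub> snd p' F else undefined)"
  using field.is_ring ring.ring_simprules(1) by fastforce

lift_definition times_field_prod :: "'a field_prod \<Rightarrow> 'a field_prod \<Rightarrow> 'a field_prod"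
  is "\<lambda>p p'. (fst p * fst p', \<lambda>F. if field F then snd p F \<otimes>\<^bsub>F\<^esub> snd p' F else undefined)"
  using field.is_ring ring.ring_simprules(5) by fastforce

lift_definition uminus_field_prod :: "'a field_prod \<Rightarrow> 'a field_prod"
  is "\<lambda>p. (- fst p, \<lambda>F. if field F then \<ominus>\<^bsub>F\<^esub> snd p F else undefined)"
  using field.is_ring ring.ring_simprules(3) by fastforce

definition minus_field_prod :: "'a field_prod \<Rightarrow> 'a field_prod \<Rightarrow> 'a field_prod" where
  "minus_field_prod p p' = p + - p'"

instance
proof
  fix a b c :: "'a field_prod"
  have cr: "field F \<Longrightarrow> cring F" for F :: "'a ring" by (simp add: field_def domain_def)
  show "a + b + c = a + (b + c)"
    by transfer (auto simp: fun_eq_iff cring.cring_simprules(7)[OF cr])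
  show "a + b = b + a"
    by transfer (auto simp: fun_eq_iff cring.cring_simprules(10)[OF cr])
  show "0 + a = a"
    by transfer (auto simp: fun_eq_iff prod_eq_iff cring.cring_simprules(8)[OF cr])
  show "- a + a = 0"
    by transfer (auto simp: fun_eq_iff cring.cring_simprules(9)[OF cr])
  show "a - b = a + - b" by (simp add: minus_field_prod_def)
  show "a * b * c = a * (b * c)"
    by transfer (auto simp: fun_eq_iff cring.cring_simprules(11)[OF cr])
  show "a * b = b * a"
    by transfer (auto simp: fun_eq_iff cring.cring_simprules(14)[OF cr])
  show "1 * a = a"
    by transfer (auto simp: fun_eq_iff prod_eq_iff cring.cring_simprules(12)[OF cr])
  show "(a + b) * c = a * c + b * c"
    by transfer (auto simp: fun_eq_iff cring.cring_simprules(13)[OF cr] algebra_simps)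
  show "(0::'a field_prod) \<noteq> 1" by transfer simp
qed

end

text \<open>The image occupies a single factor of the product and is zero in all others. Its unit is
  therefore not the \<open>1\<close> of the ring, which is why \<open>subfld\<close> carries its own
  unit \<open>e\<close>.\<close>

lift_definition embed :: "'a ring \<Rightarrow> 'a \<Rightarrow> 'a field_prod"
  is "\<lambda>F a. (0, \<lambda>G. if field G then (if G = F \<and> a \<in> carrier F then a else \<zero>\<^bsub>G\<^esub>) else undefined)"
  using field.is_ring ring.ring_simprules(2) by fastforce

locale embedded_field = field F for F :: "'a ring" (structure) +
  fixes \<iota> :: "'a \<Rightarrow> 'u::comm_ring_1"
  assumes \<iota>_add [simp]: "x \<in> carrier F \<Longrightarrow> y \<in> carrier F \<Longrightarrow> \<iota> (x \<oplus> y) = \<iota> x + \<iota> y"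
    and \<iota>_mult [simp]: "x \<in> carrier F \<Longrightarrow> y \<in> carrier F \<Longrightarrow> \<iota> (x \<otimes> y) = \<iota> x * \<iota> y"
    and \<iota>_inj: "inj_on \<iota> (carrier F)"
begin

lemma \<iota>_zero [simp]: "\<iota> \<zero> = 0"
  using \<iota>_add[of \<zero> \<zero>] by simp

lemma \<iota>_uminus [simp]: "x \<in> carrier F \<Longrightarrow> \<iota> (\<ominus> x) = - \<iota> x"
  using \<iota>_add[of x "\<ominus> x"] by (simp add: r_neg eq_neg_iff_add_eq_0 add.commute)

lemma \<iota>_minus [simp]: "x \<in> carrier F \<Longrightarrow> y \<in> carrier F \<Longrightarrow> \<iota> (x \<ominus> y) = \<iota> x - \<iota> y"
  by (simp add: a_minus_def)

lemma \<iota>_pow: "x \<in> carrier F \<Longrightarrow> \<iota> (x [^] (n::nat)) = \<iota> \<one> * \<iota> x ^ n"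
proof (induct n)
  case (Suc n)
  then show ?case by (simp add: mult_ac)
qed simp

lemma \<iota>_finsum: "finite A \<Longrightarrow> g \<in> A \<rightarrow> carrier F \<Longrightarrow> \<iota> (\<Oplus>j\<in>A. g j) = (\<Sum>j\<in>A. \<iota> (g j))"
  by (induct A rule: finite_induct) (auto simp: Pi_def)

lemma \<iota>_eq_iff: "x \<in> carrier F \<Longrightarrow> y \<in> carrier F \<Longrightarrow> \<iota> x = \<iota> y \<longleftrightarrow> x = y"
  using \<iota>_inj by (auto simp: inj_on_def)

lemma subfld_image: "subfld (\<iota> ` carrier F) (\<iota> \<one>)"
proof
  fix x y assume "x \<in> \<iota> ` carrier F" "y \<in> \<iota> ` carrier F"
  then obtain a b where ab: "a \<in> carrier F" "b \<in> carrier F" "x = \<iota> a" "y = \<iota> b" by blast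
  show "x + y \<in> \<iota> ` carrier F" using ab by (intro image_eqI[of _ _ "a \<oplus> b"]) auto
  show "x * y \<in> \<iota> ` carrier F" using ab by (intro image_eqI[of _ _ "a \<otimes> b"]) auto
  show "- x \<in> \<iota> ` carrier F" using ab by (intro image_eqI[of _ _ "\<ominus> a"]) auto
  show "\<iota> \<one> * x = x" using ab \<iota>_mult[of \<one> a] by simp
next
  fix x assume "x \<in> \<iota> ` carrier F" "x \<noteq> 0"
  then obtain a where a: "a \<in> carrier F" "x = \<iota> a" by blast
  moreover have "a \<noteq> \<zero>" using \<open>x \<noteq> 0\<close> a by auto
  ultimately have "inv a \<in> carrier F" "a \<otimes> inv a = \<one>" using field_Units by auto
  then have "x * \<iota> (inv a) = \<iota> \<one>" using a \<iota>_mult[of a "inv a"] by simp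
  then show "\<exists>y\<in>\<iota> ` carrier F. x * y = \<iota> \<one>" using \<open>inv a \<in> carrier F\<close> by blast
next
  show "0 \<in> \<iota> ` carrier F" by (rule image_eqI[of _ _ \<zero>]) auto
  show "\<iota> \<one> \<noteq> 0" using \<iota>_eq_iff[of \<one> \<zero>] by simp
qed auto

end

lemma embedded_field_embed:
  fixes F :: "'a ring"
  assumes "field F"
  shows "embedded_field F (embed F)"
proof (intro embedded_field.intro assms embedded_field_axioms.intro)
  have cr: "field G \<Longrightarrow> cring G" for G :: "'a ring" by (simp add: field_def domain_def)
  show "embed F (x \<oplus>\<^bsub>F\<^esub> y) = embed F x + embed F y" if "x \<in> carrier F" "y \<in> carrier F" for x y
    using that cr[OF assms]
    by transfer (auto simp: fun_eq_iff cring.cring_simprules(2,8)[OF cr] cring.cring_simprules(1))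
  show "embed F (x \<otimes>\<^bsub>F\<^esub> y) = embed F x * embed F y" if "x \<in> carrier F" "y \<in> carrier F" for x y
    using that cr[OF assms]
    by transfer (auto simp: fun_eq_iff cring.cring_simprules(2,26)[OF cr] cring.cring_simprules(5))
  show "inj_on (embed F) (carrier F)"
  proof (rule inj_onI)
    fix x y assume xy: "x \<in> carrier F" "y \<in> carrier F" "embed F x = embed F y"
    then have "snd (Rep_field_prod (embed F x)) F = snd (Rep_field_prod (embed F y)) F" by simp
    then show "x = y" using xy(1,2) assms by (simp add: embed.rep_eq)
  qed
qed

section \<open>Algebraic closure and Frobenius\<close>

lemma sqrt_in_closure:
  assumes "algebraically_closed L" "x \<in> carrier L"
  shows "\<exists>y\<in>carrier L. y \<otimes>\<^bsub>L\<^esub> y = x"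
proof -
  interpret algebraically_closed L by fact
  define p where "p = [\<one>\<^bsub>L\<^esub>, \<zero>\<^bsub>L\<^esub>, \<ominus>\<^bsub>L\<^esub> x]"
  have p: "p \<in> carrier (poly_ring L)"
    unfolding p_def univ_poly_carrier[symmetric] polynomial_def using assms by auto
  have "size (roots p) = 2" using roots_over_carrier[OF p] unfolding splitted_def by (simp add: p_def)
  then obtain y where "y \<in># roots p" by fastforce
  then have "is_root p y" using roots_mem_iff_is_root[OF p] by simp
  then have y: "y \<in> carrier L" "eval p y = \<zero>\<^bsub>L\<^esub>" by (auto simp: is_root_def)
  then have "y \<otimes>\<^bsub>L\<^esub> y \<oplus>\<^bsub>L\<^esub> \<ominus>\<^bsub>L\<^esub> x = \<zero>\<^bsub>L\<^esub>"
    using assms(2) by (simp add: p_def numeral_2_eq_2)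
  then have "y \<otimes>\<^bsub>L\<^esub> y = x" using y assms(2) by (metis a_minus_def r_right_minus_eq m_closed)
  then show ?thesis using y by blast
qed

text \<open>The middle binomial coefficients vanish because \<open>(x + 1)^q - x^q - 1\<close> is a polynomial of
  degree less than \<open>q\<close> with \<open>q\<close> zeros.\<close>

lemma frob_subfld_extension:
  assumes Om: "subfld Om e" and K: "subfld K e" "K \<subseteq> Om" "finite K"
  shows "frob_subfld Om e (card K)"
proof -
  interpret Om: subfld Om e by fact
  interpret K: finite_subfld K e by (intro finite_subfld.intro K finite_subfld_axioms.intro)
  define q where "q = card K"
  have q2: "2 \<le> q" using K.card_K by (simp add: q_def)
  have binom: "(x + y) ^ q = x ^ q + y ^ q + (\<Sum>i\<in>{1..<q}. of_nat (q choose i) * (x ^ i * y ^ (q - i)))"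
    if "x \<in> Om" "y \<in> Om" for x y
  proof -
    have "{..q} = insert 0 (insert q {1..<q})" using q2 by auto
    then show ?thesis using q2 by (simp add: binomial_ring add_ac mult.assoc)
  qed
  have nat_in: "of_nat m * x \<in> K" if "x \<in> K" for m x
    by (induct m) (use that in \<open>auto simp: algebra_simps\<close>)
  have coeff: "of_nat (q choose i) * e = 0" if i: "i \<in> {1..<q}" for i
  proof (rule ccontr)
    assume nz: "of_nat (q choose i) * e \<noteq> 0"
    obtain i0 where i0: "i0 \<in> {1..<q}"
      "(\<lambda>x. \<Sum>i\<in>{1..<q}. (of_nat (q choose i) * e) * (e * x ^ i)) \<in> upol_exact K i0"
      using K.upol_exact_lincomb[of "{1..<q}" "\<lambda>i. of_nat (q choose i) * e" "\<lambda>i. i" "\<lambda>i x. e * x ^ i", OF _ _ _ _ i nz]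
        K.upol_exact_monom[of e] nat_in by auto
    have "(\<Sum>i\<in>{1..<q}. (of_nat (q choose i) * e) * (e * x ^ i)) = 0" if x: "x \<in> K" for x
    proof -
      have "(\<Sum>i\<in>{1..<q}. (of_nat (q choose i) * e) * (e * x ^ i)) = (\<Sum>i\<in>{1..<q}. of_nat (q choose i) * (x ^ i * e ^ (q - i)))"
      proof (rule sum.cong[OF refl])
        fix i assume i: "i \<in> {1..<q}"
        then have xi: "x ^ i \<in> K" using x by auto
        have "(of_nat (q choose i) * e) * (e * x ^ i) = of_nat (q choose i) * (e * (e * x ^ i))" by (simp only: mult.assoc)
        also have "\<dots> = of_nat (q choose i) * (x ^ i * e ^ (q - i))"
          using K.e_left[OF xi] K.e_right[OF xi] K.e_power[of "q - i"] i by simp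
        finally show "(of_nat (q choose i) * e) * (e * x ^ i) = of_nat (q choose i) * (x ^ i * e ^ (q - i))" .
      qed
      moreover have "(x + e) ^ q = x + e" "x ^ q = x" "e ^ q = e"
        using K.power_card[OF K(3)] x unfolding q_def by auto
      ultimately show ?thesis using binom[of x e] x K(2) by auto
    qed
    then have "{x\<in>K. (\<Sum>i\<in>{1..<q}. (of_nat (q choose i) * e) * (e * x ^ i)) = 0} = K" by blast
    then have "card K \<le> i0" using K.upol_exact_roots[OF i0(2)] by simp
    then show False using i0(1) by (simp add: q_def)
  qed
  show ?thesis unfolding q_def[symmetric]
  proof (intro frob_subfld.intro Om frob_subfld_axioms.intro)
    fix x y assume xy: "x \<in> Om" "y \<in> Om"
    have "of_nat (q choose i) * (x ^ i * y ^ (q - i)) = 0" if i: "i \<in> {1..<q}" for i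
    proof -
      have "x ^ i * y ^ (q - i) \<in> Om" using xy i by (intro Om.mult_in Om.power_in) auto
      then have "of_nat (q choose i) * (x ^ i * y ^ (q - i)) = (of_nat (q choose i) * e) * (x ^ i * y ^ (q - i))"
        by (simp only: mult.assoc Om.e_left)
      then show ?thesis using coeff[OF i] by simp
    qed
    then show "(x + y) ^ q = x ^ q + y ^ q" using binom[OF xy] by simp
  qed (rule q2)
qed

text \<open>Translation by \<open>e\<close> permutes \<open>K\<close>, so comparing the sums over
  \<open>K\<close> gives \<open>card K\<close> times \<open>e\<close> equal to 0. With
  \<open>card K\<close> odd, \<open>e + e = 0\<close> would force \<open>e = 0\<close>.\<close>

lemma odd_subfld_two:
  assumes "subfld K e" "finite K" "odd (card K)"
  shows "e + e \<noteq> 0"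
proof
  interpret subfld K e by fact
  assume ee: "e + e = 0"
  have "(\<Sum>x\<in>K. x) = (\<Sum>x\<in>K. x + e)"
    by (rule sum.reindex_bij_witness[of _ "\<lambda>x. x + e" "\<lambda>x. x - e"]) auto
  then have "of_nat (card K) * e = 0" by (simp add: sum.distrib)
  moreover obtain m where "card K = 2 * m + 1" using assms(3) oddE by blast
  moreover have "of_nat (2 * m + 1) * e = of_nat m * (e + e) + e" by (simp add: algebra_simps)
  ultimately show False using ee e_neq_0 by simp
qed

text \<open>All elements of \<open>K\<close> are zeros of \<open>z ^ card K - z\<close>, which has
  at most \<open>card K\<close> zeros in the big field.\<close>

lemma fix_fld_eq:
  assumes Om: "frob_subfld Om e (card K)" and t: "tower Om e (card K)" and K: "subfld K e" "K \<subseteq> Om" "finite K"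
  shows "tower.fix_fld Om (card K) 1 = K"
proof -
  interpret tower Om e "card K" by fact
  interpret K: subfld K e by fact
  have sub: "K \<subseteq> fix_fld 1" using K.power_card[OF K(3)] K(2) by (auto simp: fix_fld_def)
  obtain d where d: "card K = Suc (Suc d)" using q_ge by (metis Suc_le_D numeral_2_eq_2 Suc_le_mono)
  have "(\<lambda>z. e * z ^ Suc (Suc d) + (- e) * z ^ 1) \<in> upol_exact Om (Suc (Suc d))"
    by (intro upol_exact_add upol_exact_monom upol_mono[OF upol_monom]) auto
  from upol_exact_roots[OF this]
  have fin: "finite {z\<in>Om. e * z ^ Suc (Suc d) + (- e) * z ^ 1 = 0}"
    and le: "card {z\<in>Om. e * z ^ Suc (Suc d) + (- e) * z ^ 1 = 0} \<le> card K" unfolding d by auto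
  have "{z\<in>Om. e * z ^ Suc (Suc d) + (- e) * z ^ 1 = 0} = fix_fld 1"
  proof -
    have eq: "e * z ^ Suc (Suc d) + (- e) * z ^ 1 = z ^ card K - z" if "z \<in> Om" for z
      using e_left[of "z ^ Suc (Suc d)"] that unfolding d by (simp del: power_Suc)
    have "{z\<in>Om. e * z ^ Suc (Suc d) + (- e) * z ^ 1 = 0} = {z\<in>Om. z ^ card K - z = 0}"
      by (intro Collect_cong conj_cong refl) (simp only: eq)
    then show ?thesis by (simp only: fix_fld_def power_one_right right_minus_eq)
  qed
  then show ?thesis using card_seteq[OF _ sub] fin le by simp
qed

text \<open>The algebraic closure of \<open>F\<close> supplies the square roots that
  \<open>tower\<close> demands. The product ring is formed over the element type of the closure, so
  that \<open>F\<close> and the whole tower lie in one ring type.\<close>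

lemma embedding_exists:
  fixes F :: "'a ring"
  assumes F: "field F" "finite (carrier F)" "odd (order F)"
  obtains \<iota> :: "'a \<Rightarrow> (('a list \<times> nat) multiset \<Rightarrow> 'a) field_prod" and Om
  where "embedded_field F \<iota>" "tower Om (\<iota> \<one>\<^bsub>F\<^esub>) (order F)"
    "tower.fix_fld Om (order F) 1 = \<iota> ` carrier F"
proof -
  interpret F: field F by fact
  define L where "L = F.alg_closure"
  interpret A: algebraic_closure L "F.indexed_const ` carrier F"
    unfolding L_def by (rule F.alg_closureE)
  have h: "F.indexed_const \<in> ring_hom F L" unfolding L_def by (rule F.alg_closureE)
  have acl: "algebraically_closed L" by (rule A.algebraically_closed_axioms)
  then have L: "field L" by (simp add: algebraically_closed_def)
  interpret L: embedded_field L "embed L" by (rule embedded_field_embed[OF L])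
  define \<iota> where "\<iota> = embed L \<circ> F.indexed_const"
  have hin: "x \<in> carrier F \<Longrightarrow> F.indexed_const x \<in> carrier L" for x using h by (auto simp: ring_hom_def)
  have emb: "embedded_field F \<iota>"
  proof (intro embedded_field.intro F(1) embedded_field_axioms.intro)
    show "\<iota> (x \<oplus>\<^bsub>F\<^esub> y) = \<iota> x + \<iota> y" if "x \<in> carrier F" "y \<in> carrier F" for x y
      using that h hin by (simp add: \<iota>_def ring_hom_def)
    show "\<iota> (x \<otimes>\<^bsub>F\<^esub> y) = \<iota> x * \<iota> y" if "x \<in> carrier F" "y \<in> carrier F" for x y
      using that h hin by (simp add: \<iota>_def ring_hom_def)
    show "inj_on \<iota> (carrier F)"
      unfolding \<iota>_def using hin by (intro comp_inj_on F.indexed_const_inj_on inj_on_subset[OF L.\<iota>_inj]) auto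
  qed
  interpret E: embedded_field F \<iota> by (rule emb)
  define Om where "Om = embed L ` carrier L"
  define K where "K = \<iota> ` carrier F"
  have e: "\<iota> \<one>\<^bsub>F\<^esub> = embed L \<one>\<^bsub>L\<^esub>" using h by (simp add: \<iota>_def ring_hom_def)
  have OmK: "subfld Om (\<iota> \<one>\<^bsub>F\<^esub>)" "subfld K (\<iota> \<one>\<^bsub>F\<^esub>)" "K \<subseteq> Om" "finite K"
    using L.subfld_image E.subfld_image F(2) hin by (auto simp: Om_def K_def e[symmetric] \<iota>_def)
  have card: "card K = order F" unfolding K_def order_def by (rule card_image[OF E.\<iota>_inj])
  have frob: "frob_subfld Om (\<iota> \<one>\<^bsub>F\<^esub>) (card K)" by (rule frob_subfld_extension[OF OmK])
  have tow: "tower Om (\<iota> \<one>\<^bsub>F\<^esub>) (card K)"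
  proof (intro tower.intro frob tower_axioms.intro)
    show "\<iota> \<one>\<^bsub>F\<^esub> + \<iota> \<one>\<^bsub>F\<^esub> \<noteq> 0" using odd_subfld_two[OF OmK(2,4)] F(3) card by simp
    fix x assume "x \<in> Om"
    then obtain a where a: "a \<in> carrier L" "x = embed L a" by (auto simp: Om_def)
    then obtain b where "b \<in> carrier L" "b \<otimes>\<^bsub>L\<^esub> b = a" using sqrt_in_closure[OF acl] by blast
    then show "\<exists>y\<in>Om. y * y = x" using a L.\<iota>_mult[of b b] by (auto simp: Om_def)
  qed
  show thesis
    by (rule that[OF emb]) (use tow fix_fld_eq[OF frob tow OmK(2-4)] card in \<open>simp_all add: K_def\<close>)
qed

section \<open>Transfer to field records\<close>

lemma (in embedded_field) \<iota>_eval: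
  assumes "p \<in> carrier (UP F)" "x \<in> carrier F"
  shows "UnivPoly.eval F F id x p \<in> carrier F"
    "\<iota> (UnivPoly.eval F F id x p) = (\<Sum>i\<le>deg F p. \<iota> (up_ring.coeff (UP F) p i) * (\<iota> \<one> * \<iota> x ^ i))"
proof -
  note fc = finsum_closed
  interpret UP_ring F "UP F" by (intro UP_ring.intro ring_axioms) simp
  have ev: "UnivPoly.eval F F id x p = (\<Oplus>i\<in>{..deg F p}. up_ring.coeff (UP F) p i \<otimes> x [^] i)"
    using assms by (simp add: eval_def)
  have c: "up_ring.coeff (UP F) p i \<otimes> x [^] i \<in> carrier F" for i using assms by simp
  show "UnivPoly.eval F F id x p \<in> carrier F" unfolding ev using c by (intro fc) auto
  show "\<iota> (UnivPoly.eval F F id x p) = (\<Sum>i\<le>deg F p. \<iota> (up_ring.coeff (UP F) p i) * (\<iota> \<one> * \<iota> x ^ i))"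
    unfolding ev using c assms by (subst \<iota>_finsum) (auto simp: \<iota>_pow)
qed

lemma (in embedded_field) \<iota>_bieval:
  assumes "Q \<in> carrier (UP (UP F))" "x \<in> carrier F" "y \<in> carrier F"
  shows "bieval F Q (x, y) \<in> carrier F"
    "\<iota> (bieval F Q (x, y)) = (\<Sum>j\<le>deg (UP F) Q. \<Sum>i\<le>deg F (up_ring.coeff (UP (UP F)) Q j).
      \<iota> (bicoeff F Q i j) * (\<iota> \<one> * \<iota> x ^ i) * (\<iota> \<one> * \<iota> y ^ j))"
proof -
  note fc = finsum_closed
  interpret U: UP_ring F "UP F" by (intro UP_ring.intro ring_axioms) simp
  interpret UU: UP_ring "UP F" "UP (UP F)" by (intro UP_ring.intro U.UP_ring) simp
  have c: "up_ring.coeff (UP (UP F)) Q j \<in> carrier (UP F)" for j using assms by simp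
  have ev: "bieval F Q (x, y) = (\<Oplus>j\<in>{..deg (UP F) Q}. UnivPoly.eval F F id x (up_ring.coeff (UP (UP F)) Q j) \<otimes> y [^] j)"
    using assms by (simp add: bieval_def eval_def[of "UP F"])
  have cl: "UnivPoly.eval F F id x (up_ring.coeff (UP (UP F)) Q j) \<otimes> y [^] j \<in> carrier F" for j
    using \<iota>_eval(1)[OF c assms(2)] assms(3) by simp
  show "bieval F Q (x, y) \<in> carrier F" unfolding ev using cl by (intro fc) auto
  show "\<iota> (bieval F Q (x, y)) = (\<Sum>j\<le>deg (UP F) Q. \<Sum>i\<le>deg F (up_ring.coeff (UP (UP F)) Q j).
      \<iota> (bicoeff F Q i j) * (\<iota> \<one> * \<iota> x ^ i) * (\<iota> \<one> * \<iota> y ^ j))"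
    unfolding ev using cl assms(3) \<iota>_eval[OF c assms(2)]
    by (subst \<iota>_finsum) (auto simp: \<iota>_pow sum_distrib_right bicoeff_def)
qed

text \<open>Everything is transported along \<open>\<iota>\<close>. The image \<open>K\<close> of
  \<open>F\<close> is the fixed field at the bottom of the tower, so
  \<open>kloosterman_bound\<close> discharges the assumption \<open>kbound\<close> of
  \<open>char_plane\<close>, and \<open>resultant_hits\<close> applies to the images of
  \<open>V\<close> and \<open>E\<close>.\<close>

lemma resultant_modulus_set_covers:
  fixes F :: "'a ring"
  assumes k: "4 \<le> k" and bc: "0 < b" "0 < c"
    and F: "field F" "finite (carrier F)" "odd (order F)"
    and \<chi>: "nontrivial_additive_character F \<chi>"
    and Q: "Q \<in> carrier (UP (UP F))" "total_degree_le F n Q" and reg: "regular_curve F \<chi> a b c (variety F Q)"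
    and E: "E \<subseteq> variety F Q"
    and size: "size_const k n b c * real (order F) powr (1 / 2 + 1 / (2 * real k - 4)) \<le> real (card E)"
  shows "carrier F - {\<zero>\<^bsub>F\<^esub>} \<subseteq> resultant_modulus_set F k E"
proof
  fix t assume t: "t \<in> carrier F - {\<zero>\<^bsub>F\<^esub>}"
  obtain \<iota> :: "'a \<Rightarrow> (('a list \<times> nat) multiset \<Rightarrow> 'a) field_prod" and Om
    where emb: "embedded_field F \<iota>" and tow: "tower Om (\<iota> \<one>\<^bsub>F\<^esub>) (order F)"
      and fixK: "tower.fix_fld Om (order F) 1 = \<iota> ` carrier F"
    using embedding_exists[OF F] by metis
  interpret E: embedded_field F \<iota> by (rule emb)
  define e K where "e = \<iota> \<one>\<^bsub>F\<^esub>" and "K = \<iota> ` carrier F"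
  define \<psi> where "\<psi> = (\<lambda>z. \<chi> (inv_into (carrier F) \<iota> z))"
  have \<psi>: "\<psi> (\<iota> x) = \<chi> x" if "x \<in> carrier F" for x
    using that E.\<iota>_inj by (simp add: \<psi>_def)
  have cardK: "card K = order F" unfolding K_def order_def by (rule card_image[OF E.\<iota>_inj])
  have ac: "additive_char K e \<psi>"
  proof (intro additive_char.intro additive_char_axioms.intro)
    show "subfld K e" unfolding K_def e_def by (rule E.subfld_image)
    show "finite K" using F by (simp add: K_def)
    show "\<psi> (x + y) = \<psi> x * \<psi> y" if xy: "x \<in> K" "y \<in> K" for x y
    proof -
      obtain x' y' where x': "x' \<in> carrier F" "y' \<in> carrier F" "x = \<iota> x'" "y = \<iota> y'" using xy by (auto simp: K_def)
      then have "\<psi> (x + y) = \<psi> (\<iota> (x' \<oplus>\<^bsub>F\<^esub> y'))" by simp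
      then show ?thesis using x' \<chi> \<psi> by (simp add: nontrivial_additive_character_def additive_character_def del: E.\<iota>_add)
    qed
    show "norm (\<psi> x) = 1" if "x \<in> K" for x
      using that \<chi> \<psi> by (auto simp: K_def nontrivial_additive_character_def additive_character_def)
    show "\<exists>x\<in>K. \<psi> x \<noteq> 1" using \<chi> \<psi> by (auto simp: K_def nontrivial_additive_character_def)
  qed
  interpret T: tower Om e "order F" unfolding e_def by (rule tow)
  interpret T: char_tower Om e "order F" \<psi>
    by (intro char_tower.intro T.tower_axioms char_tower_axioms.intro) (use fixK ac cardK in \<open>simp_all add: K_def\<close>)
  have cp: "char_plane K e \<psi>"
  proof (intro char_plane.intro ac char_plane_axioms.intro T.two)
    show "norm (additive_char.kloosterman K e \<psi> x y) \<le> 2 * sqrt (real (card K))"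
      if "x \<in> K" "x \<noteq> 0" "y \<in> K" for x y
      using T.kloosterman_bound[of x y] that fixK cardK by (simp add: K_def)
  qed
  interpret P: char_plane K e \<psi> by (rule cp)
  define \<iota>2 where "\<iota>2 = (\<lambda>v::'a \<times> 'a. (\<iota> (fst v), \<iota> (snd v)))"
  have inj2: "inj_on \<iota>2 (plane F)" using E.\<iota>_eq_iff by (auto simp: inj_on_def \<iota>2_def plane_def)
  have pl: "P.pl = \<iota>2 ` plane F" unfolding P.pl_def by (auto simp: K_def \<iota>2_def plane_def image_iff)
  define inv\<iota> where "inv\<iota> = inv_into (carrier F) \<iota>"
  have inv\<iota>: "inv\<iota> (\<iota> x) = x" if "x \<in> carrier F" for x using that E.\<iota>_inj by (simp add: inv\<iota>_def)
  define f where "f = (\<lambda>v. \<iota> (bieval F Q (inv\<iota> (fst v), inv\<iota> (snd v))))"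
  have f\<iota>2: "f (\<iota>2 v) = \<iota> (bieval F Q v)" if "v \<in> plane F" for v
    using that by (auto simp: f_def \<iota>2_def plane_def inv\<iota>)
  have bpolf: "P.bpol n f"
  proof -
    have bic: "\<iota> (bicoeff F Q i j) \<in> K" for i j
    proof -
      interpret U: UP_ring F "UP F" by (intro UP_ring.intro E.ring_axioms) simp
      interpret UU: UP_ring "UP F" "UP (UP F)" by (intro UP_ring.intro U.UP_ring) simp
      show ?thesis using Q(1) by (simp add: K_def bicoeff_def)
    qed
    have "P.bpol n (\<lambda>v. \<Sum>j\<le>deg (UP F) Q. \<Sum>i\<le>deg F (coeff (UP (UP F)) Q j).
      \<iota> (bicoeff F Q i j) * (e * fst v ^ i) * (e * snd v ^ j))"
    proof (intro P.bpol_sum)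
      fix j i
      show "P.bpol n (\<lambda>v. \<iota> (bicoeff F Q i j) * (e * fst v ^ i) * (e * snd v ^ j))"
      proof (cases "bicoeff F Q i j = \<zero>\<^bsub>F\<^esub>")
        case True
        then show ?thesis using P.bpol.const[OF P.zero_in] by simp
      next
        case False
        then have "i + j \<le> n" using Q(2) by (auto simp: total_degree_le_def)
        then show ?thesis by (rule P.bpol_mono[OF P.bpol_monom[OF bic]])
      qed
    qed
    then show ?thesis
    proof (rule P.bpol.eq_on)
      fix v assume "v \<in> K \<times> K"
      then obtain x y where v: "x \<in> carrier F" "y \<in> carrier F" "v = (\<iota> x, \<iota> y)" by (auto simp: K_def)
      then show "(\<Sum>j\<le>deg (UP F) Q. \<Sum>i\<le>deg F (coeff (UP (UP F)) Q j).
        \<iota> (bicoeff F Q i j) * (e * fst v ^ i) * (e * snd v ^ j)) = f v"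
        using E.\<iota>_bieval(2)[OF Q(1) v(1,2)] by (simp add: f_def inv\<iota> e_def)
    qed
  qed
  define V where "V = {v\<in>P.pl. f v = 0}"
  have varsub: "variety F Q \<subseteq> plane F" by (auto simp: variety_def)
  have V: "V = \<iota>2 ` variety F Q"
  proof -
    have "f (\<iota>2 v) = 0 \<longleftrightarrow> bieval F Q v = \<zero>\<^bsub>F\<^esub>" if v: "v \<in> plane F" for v
    proof -
      have "bieval F Q v \<in> carrier F" using E.\<iota>_bieval(1)[OF Q(1), of "fst v" "snd v"] v by (auto simp: plane_def)
      then show ?thesis using f\<iota>2[OF v] E.\<iota>_eq_iff[of "bieval F Q v" "\<zero>\<^bsub>F\<^esub>"] by simp
    qed
    then show ?thesis unfolding V_def pl variety_def by blast
  qed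
  have cardV: "card V = card (variety F Q)" unfolding V by (rule card_image[OF inj_on_subset[OF inj2 varsub]])
  have dot_in: "dot F x y \<in> carrier F" if "x \<in> plane F" "y \<in> plane F" for x y
    using that by (auto simp: dot_def plane_def)
  have dt: "P.dt (\<iota>2 x) (\<iota>2 y) = \<iota> (dot F x y)" if "x \<in> plane F" "y \<in> plane F" for x y
    using that by (auto simp: dot_def plane_def P.dt_def \<iota>2_def)
  have q0: "0 < real (order F)" using P.q_pos cardK by simp
  have decay: "norm (P.exp_sum V m) \<le> c * sqrt (real (card K))" if m: "m \<in> P.pl" "m \<noteq> 0" for m
  proof -
    obtain m0 where m0: "m0 \<in> plane F" "m = \<iota>2 m0" using m(1) pl by blast
    \<comment> \<open>\<open>fourier\<close> carries the sign \<open>- m\<close> in the character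
      and \<open>exp_sum\<close> does not, hence the passage to \<open>- m0\<close>. The
      normalisation \<open>q^2\<close> then turns the decay \<open>q^(-3/2)\<close> into
      \<open>sqrt q\<close>.\<close>
    define m1 where "m1 = (\<ominus>\<^bsub>F\<^esub> fst m0, \<ominus>\<^bsub>F\<^esub> snd m0)"
    have m1: "m1 \<in> plane F" using m0 by (auto simp: m1_def plane_def)
    have "m1 \<noteq> (\<zero>\<^bsub>F\<^esub>, \<zero>\<^bsub>F\<^esub>)"
    proof
      assume "m1 = (\<zero>\<^bsub>F\<^esub>, \<zero>\<^bsub>F\<^esub>)"
      then have "\<iota> (\<ominus>\<^bsub>F\<^esub> fst m0) = 0" "\<iota> (\<ominus>\<^bsub>F\<^esub> snd m0) = 0" by (simp_all add: m1_def)
      then have "m = 0" using m0 by (auto simp: \<iota>2_def plane_def zero_prod_def)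
      then show False using m by simp
    qed
    then have le: "norm (fourier F \<chi> (indicator (variety F Q)) m1) \<le> c * real (order F) powr (- (3 / 2))"
      using reg m1 by (auto simp: regular_curve_def)
    have neg: "\<ominus>\<^bsub>F\<^esub> dot F m1 x = dot F m0 x" if "x \<in> plane F" for x
    proof -
      have cl: "fst m0 \<in> carrier F" "snd m0 \<in> carrier F" "fst x \<in> carrier F" "snd x \<in> carrier F"
        using m0 that by (auto simp: plane_def)
      then show ?thesis unfolding dot_def m1_def fst_conv snd_conv
        by (simp add: E.l_minus E.minus_add)
    qed
    have "P.exp_sum V m = (\<Sum>x\<in>variety F Q. \<psi> (P.dt m (\<iota>2 x)))"
      unfolding P.exp_sum_def V by (subst sum.reindex[OF inj_on_subset[OF inj2 varsub]]) simp
    also have "\<dots> = (\<Sum>x\<in>variety F Q. \<chi> (dot F m0 x))"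
      using varsub m0 dt \<psi> dot_in by (intro sum.cong) (auto simp: subset_eq)
    also have "\<dots> = (\<Sum>x\<in>plane F. \<chi> (\<ominus>\<^bsub>F\<^esub> dot F m1 x) * indicator (variety F Q) x)"
      using varsub neg F(2) by (intro sum.mono_neutral_cong_left) (auto simp: plane_def)
    also have "\<dots> = of_nat (order F ^ 2) * fourier F \<chi> (indicator (variety F Q)) m1"
      using q0 by (simp add: fourier_def)
    finally have "norm (P.exp_sum V m) = real (order F) ^ 2 * norm (fourier F \<chi> (indicator (variety F Q)) m1)"
      by (simp add: norm_mult norm_power)
    also have "\<dots> \<le> real (order F) ^ 2 * (c * real (order F) powr (- (3 / 2)))" using le by (intro mult_left_mono) auto
    also have "\<dots> = c * (real (order F) powr 2 * real (order F) powr (- (3 / 2)))" using q0 by (simp add: powr_numeral)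
    also have "real (order F) powr 2 * real (order F) powr (- (3 / 2)) = sqrt (real (order F))"
      unfolding powr_add[symmetric] using q0 by (simp add: powr_half_sqrt)
    finally show ?thesis by (simp add: cardK)
  qed
  have bV: "real (card V) \<le> b * real (card K)" using reg by (simp add: regular_curve_def cardV cardK)
  have Epl: "E \<subseteq> plane F" using E varsub by blast
  have cardE: "card (\<iota>2 ` E) = card E" by (rule card_image[OF inj_on_subset[OF inj2 Epl]])
  have "\<exists>x. (\<forall>j\<in>{1..k}. x j \<in> \<iota>2 ` E) \<and> P.nrm (x 1 - (\<Sum>j\<in>{2..k}. x j)) = \<iota> t"
  proof (rule P.resultant_hits[OF k bc bpolf V_def bV decay])
    show "\<iota>2 ` E \<subseteq> V" using E V by blast
    show "size_const k n b c * real (card K) powr (1 / 2 + 1 / (2 * real k - 4)) \<le> real (card (\<iota>2 ` E))"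
      using size by (simp add: cardE cardK)
    show "\<iota> t \<in> K" using t by (simp add: K_def)
    show "\<iota> t \<noteq> 0" using t E.\<iota>_eq_iff[of t "\<zero>\<^bsub>F\<^esub>"] by auto
  qed
  then obtain x where x: "\<And>j. j \<in> {1..k} \<Longrightarrow> x j \<in> \<iota>2 ` E" "P.nrm (x 1 - (\<Sum>j\<in>{2..k}. x j)) = \<iota> t" by blast
  have "\<forall>j\<in>{1..k}. \<exists>y. y \<in> E \<and> x j = \<iota>2 y" using x(1) by blast
  then obtain y where "\<forall>j\<in>{1..k}. y j \<in> E \<and> x j = \<iota>2 (y j)" by (rule bchoice[THEN exE])
  then have y: "\<And>j. j \<in> {1..k} \<Longrightarrow> y j \<in> E" "\<And>j. j \<in> {1..k} \<Longrightarrow> x j = \<iota>2 (y j)" by blast+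
  have yF: "fst (y j) \<in> carrier F" "snd (y j) \<in> carrier F" if "j \<in> {1..k}" for j
    using y(1)[OF that] Epl by (auto simp: plane_def)
  have k1: "1 \<in> {1..k}" and k2: "{2..k} \<subseteq> {1..k}" using k by auto
  have fs: "(\<Oplus>\<^bsub>F\<^esub>j\<in>{2..k}. fst (y j)) \<in> carrier F" "(\<Oplus>\<^bsub>F\<^esub>j\<in>{2..k}. snd (y j)) \<in> carrier F"
    using yF k2 by (auto intro!: E.finsum_closed)
  have "\<iota>2 (resultant F k y) = x 1 - (\<Sum>j\<in>{2..k}. x j)"
  proof -
    have sums: "\<iota> (\<Oplus>\<^bsub>F\<^esub>j\<in>{2..k}. fst (y j)) = (\<Sum>j\<in>{2..k}. \<iota> (fst (y j)))"
      "\<iota> (\<Oplus>\<^bsub>F\<^esub>j\<in>{2..k}. snd (y j)) = (\<Sum>j\<in>{2..k}. \<iota> (snd (y j)))"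
      using yF k2 by (auto intro!: E.\<iota>_finsum)
    have "(\<Sum>j\<in>{2..k}. x j) = (\<Sum>j\<in>{2..k}. \<iota>2 (y j))" using y(2) k2 by (intro sum.cong) auto
    then have "x 1 - (\<Sum>j\<in>{2..k}. x j) = \<iota>2 (y 1) - (\<Sum>j\<in>{2..k}. \<iota>2 (y j))" using y(2)[OF k1] by simp
    then show ?thesis using yF[OF k1] fs sums
      by (simp add: prod_eq_iff \<iota>2_def resultant_def fst_sum snd_sum)
  qed
  moreover have rin: "fst (resultant F k y) \<in> carrier F" "snd (resultant F k y) \<in> carrier F"
    using yF[OF k1] fs by (auto simp: resultant_def)
  moreover have "\<iota> (modulus F v) = P.nrm (\<iota>2 v)" "modulus F v \<in> carrier F"
    if "fst v \<in> carrier F" "snd v \<in> carrier F" for v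
    using that by (auto simp: modulus_def P.nrm_def \<iota>2_def numeral_2_eq_2)
  ultimately have "\<iota> (modulus F (resultant F k y)) = \<iota> t" "modulus F (resultant F k y) \<in> carrier F" using x(2) by auto
  then have "modulus F (resultant F k y) = t" using t E.\<iota>_eq_iff by auto
  then show "t \<in> resultant_modulus_set F k E" using y(1) by (auto simp: resultant_modulus_set_def)
qed

theorem theorem2p3:
  fixes k n :: nat and a b c :: real
  assumes "k \<ge> 4" and "a > 0" and "b > 0" and "c > 0"
  shows "\<exists>C>0. \<forall>(F :: 'a ring) \<chi> Q E.
    field F \<longrightarrow> finite (carrier F) \<longrightarrow> odd (order F) \<longrightarrow>
    nontrivial_additive_character F \<chi> \<longrightarrow>
    nondegenerate_regular_curve F \<chi> a b c Q \<longrightarrow> total_degree_le F n Q \<longrightarrow>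
    E \<subseteq> variety F Q \<longrightarrow>
    real (card E) \<ge> C * real (order F) powr (1 / 2 + 1 / (2 * real k - 4)) \<longrightarrow>
    carrier F - {\<zero>\<^bsub>F\<^esub>} \<subseteq> resultant_modulus_set F k E"
proof (intro exI[of _ "size_const k n b c"] conjI allI impI)
  have "0 \<le> moment_const A b c s" for A s using assms by (induct s) auto
  then show "0 < size_const k n b c" unfolding size_const_def by (intro add_pos_nonneg) auto
  show "carrier F - {\<zero>\<^bsub>F\<^esub>} \<subseteq> resultant_modulus_set F k E"
    if "field F" "finite (carrier F)" "odd (order F)" "nontrivial_additive_character F \<chi>"
      "nondegenerate_regular_curve F \<chi> a b c Q" "total_degree_le F n Q" "E \<subseteq> variety F Q"
      "real (card E) \<ge> size_const k n b c * real (order F) powr (1 / 2 + 1 / (2 * real k - 4))"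
    for F :: "'a ring" and \<chi> Q E
    using that unfolding nondegenerate_regular_curve_def
    by (intro resultant_modulus_set_covers[OF assms(1,3,4)]) auto
qed

end
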